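(* Consider problem (P) of the context, where $f$ has $L$-Lipschitz gradient, and suppose $\mathcal I_1,\mathcal I_2$ form a partition of $\{1,\dots,N-1\}$ such that $r_i$ is (possibly nonsmooth but) convex for $i\in\mathcal I_1$, while for $i\in\mathcal I_2$ the function $r_i$ is possibly nonsmooth and nonconvex but locally Lipschitz continuous. Suppose there are no manifold constraints on the blocks in $\mathcal I_2$, i.e. $\mathcal M_i=\mathbb R^{n_i}$ for $i\in\mathcal I_2$. Let $\epsilon>0$, write $\sigma_{\min}$ for the smallest singular value, $\theta_k:=\sum_{i=1}^N(\|x_i^k-x_i^{k+1}\|^2+\|x_i^{k-1}-x_i^k\|^2)$, $Q:=L+\beta\sqrt N\max_{1\le i\le N}\|A_i\|_2^2+\max_{1\le i\le N-1}\|H_i\|_2$, and (for a given integer $K$) $k^*:=\operatorname{argmin}_{2\le k\le K+1}\theta_k$. Then the following hold. (a) Let the sequence be generated by Algorithm 1, with $\beta>\frac{6+18\sqrt3}{13}L$, $\gamma\in\left(\frac{12}{13\beta+\sqrt{13\beta^2-12\beta L-72L^2}},\frac{12}{13\beta-\sqrt{13\beta^2-12\beta L-72L^2}}\right)$ and $H_i\succ\frac{6L^2}\beta I$. With $\kappa_1=\frac3{\beta^2}[(\beta-\frac1\gamma)^2+L^2]$, $\kappa_2=(|\beta-\frac1\gamma|+L)^2$, $\kappa_3=Q^2$, $\tau=\min\left\{-\left[\frac{\beta+L}2-\frac1\gamma+\frac6\beta(\beta-\frac1\gamma)^2+\frac{3L^2}\beta\right],\min_{i\le N-1}\left[\frac{\sigma_{\min}(H_i)}2-\frac{3L^2}\beta\right]\right\}$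 and $K=\left\lceil\frac{2\max\{\kappa_1,\kappa_2,\kappa_3\}}{\tau\epsilon^2}\left(\Psi_G(x_1^1,\dots,x_N^1,\lambda^1,x_N^0)-\sum_{i=1}^{N-1}r_i^*-f^*\right)\right\rceil$, the point $(x_1^{k^*+1},\dots,x_N^{k^*+1})$ with multiplier $\lambda^{k^*+1}$ is an $\epsilon$-stationary solution of (P). (b) The same conclusion holds for a sequence generated by Algorithm 2, with $\beta,\gamma,\kappa_1,\kappa_2,\kappa_3$ and the formula for $K$ as in (a), but with $H_i\succ\left(\frac{6L^2}\beta+L\right)I$ and $\tau=\min\left\{-\left[\frac{\beta+L}2-\frac1\gamma+\frac6\beta(\beta-\frac1\gamma)^2+\frac{3L^2}\beta\right],\min_{i\le N-1}\left[\frac{\sigma_{\min}(H_i)}2-\frac{3L^2}\beta-\frac L2\right]\right\}$. (c) Let the sequence be generated by Algorithm 3, with $\Delta=17\beta^2-16(L+1)\beta-128L^2$, $\beta>\frac{8(L+1)+8\sqrt{(L+1)^2+34L^2}}{17}$, $\gamma\in\left(\frac{16}{17\beta+\sqrt\Delta},\frac{16}{17\beta-\sqrt\Delta}\right)$ and $H_i\succ\left(\frac{8L^2}\beta+L+1\right)I$. Let $\kappa_1=\frac4{\beta^2}[(\beta-\frac1\gamma)^2+L^2]$, $\kappa_2=3[(\beta-\frac1\gamma)^2+L^2]$, $\kappa_3=2Q^2$, $\tau=\min\left\{-\left[\frac{\beta+L}2-\frac1\gamma+\frac8\beta(\beta-\frac1\gamma)^2+\frac{4L^2}\beta+\frac12\right],\min_{i\le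 N-1}\left[\frac{\sigma_{\min}(H_i)}2-\frac{4L^2}\beta-\frac{L+1}2\right]\right\}$, $\kappa_4=\frac2\tau\left(\frac8\beta+\frac N2\right)$, $M\ge\frac{2\sigma^2}{\epsilon^2}\max\{\kappa_1\kappa_4+\frac8{\beta^2},\kappa_2\kappa_4+3,\kappa_3\kappa_4+2\}$ and $K=\left\lceil\frac{4\max\{\kappa_1,\kappa_2,\kappa_3\}}{\tau\epsilon^2}\left(\mathsf E[\Psi_S(x_1^1,\dots,x_N^1,\lambda^1,x_N^0)]-\sum_{i=1}^{N-1}r_i^*-f^*+\frac{2\sigma^2}\beta\right)\right\rceil$. Then $(x_1^{k^*+1},\dots,x_N^{k^*+1})$ with $\lambda^{k^*+1}$ is an $\epsilon$-stationary solution of (P) in expectation.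
   Context: Problem (P): minimize $f(x_1,\dots,x_N)+\sum_{i=1}^{N-1}r_i(x_i)$ subject to $\sum_{i=1}^N A_ix_i=b$ with $A_N=I$, $x_N\in\mathbb R^{n_N}$, and $x_i\in\mathcal M_i\cap X_i$ for $i=1,\dots,N-1$. Here $A_i\in\mathbb R^{m\times n_i}$, $b\in\mathbb R^m$, $n_N=m$; $f:\mathbb R^{n_1}\times\cdots\times\mathbb R^{n_N}\to\mathbb R$ is smooth (possibly nonconvex) with $L$-Lipschitz gradient, $L>0$; $\nabla_i f$ is the partial gradient in block $x_i$; $r_i:\mathbb R^{n_i}\to\mathbb R$ is locally Lipschitz, $r_N\equiv0$; $\mathcal M_i$ is a Riemannian submanifold embedded in $\mathbb R^{n_i}$ (Euclidean metric); $X_i\subset\mathbb R^{n_i}$ is closed and convex. Assume finiteness of $r_i^*=\min_{x_i\in\mathcal M_i\cap X_i}r_i(x_i)$ and $f^*=\min\{f(x): x_i\in\mathcal M_i\cap X_i\ (i\le N-1),\ x_N\in\mathbb R^{n_N}\}$. Notation: $\mathcal L_\beta(x_1,\dots,x_N,\lambda)=f(x)+\sum_{i=1}^{N-1}r_i(x_i)-\langle\sum_{i=1}^N A_ix_i-b,\lambda\rangle+\frac\beta2\|\sum_{i=1}^N A_ix_i-b\|^2$; $\|v\|_H^2=v^\top Hv$; $\Psi_G(x,\lambda,\bar x)=\mathcal L_\beta(x,\lambda)+\frac3\beta[(\beta-\frac1\gamma)^2+L^2]\|\bar x-x_N\|^2$; $\Psi_S(x,\lambda,\bar x)=\mathcal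 L_\beta(x,\lambda)+\frac4\beta[(\beta-\frac1\gamma)^2+L^2]\|\bar x-x_N\|^2$. Stochastic oracle (for Algorithm 3): for $i=1,\dots,N$, $\mathsf E[G_i(x,\xi_i)]=\nabla_if(x)$ and $\mathsf E[\|G_i(x,\xi_i)-\nabla_if(x)\|^2]\le\sigma^2$ for every $x$; $G_i^M(x)=\frac1M\sum_{j=1}^M G_i(x,\xi_i^j)$ with i.i.d. $\xi_i^j$, fresh samples independent of the past being drawn at every call. For a vector $d_i$, let $\Phi_i(x_i;\hat x,\lambda,d_i)=f(\hat x)+\langle d_i,x_i-\hat x_i\rangle+r_i(x_i)-\langle\sum_{j\ne i}A_j\hat x_j+A_ix_i-b,\lambda\rangle+\frac\beta2\|\sum_{j\ne i}A_j\hat x_j+A_ix_i-b\|^2$. Algorithms: given $x_i^0\in\mathcal M_i\cap X_i$ ($i\le N-1$), $x_N^0\in\mathbb R^{n_N}$, $\lambda^0\in\mathbb R^m$, $\beta,\gamma>0$, symmetric $H_i\succ0$ (and batch size $M$ for Algorithm 3); for $k=0,1,\dots$: Step 1: for $i=1,\dots,N-1$ in order, put $\hat x=(x_1^{k+1},\dots,x_{i-1}^{k+1},x_i^k,\dots,x_N^k)$ and let $x_i^{k+1}$ be a global minimizer (assumed to exist and be computable) over $x_i\in\mathcal M_i\cap X_i$ of $\frac12\|x_i-x_i^k\|_{H_i}^2$ plus: $\mathcal L_\beta(x_1^{k+1},\dots,x_{i-1}^{k+1},x_i,x_{i+1}^k,\dots,x_N^k,\lambda^k)$ in Algorithm 1;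 $\Phi_i(x_i;\hat x,\lambda^k,\nabla_if(\hat x))$ in Algorithm 2; $\Phi_i(x_i;\hat x,\lambda^k,G_i^M(\hat x))$ in Algorithm 3. Step 2: with $\hat x=(x_1^{k+1},\dots,x_{N-1}^{k+1},x_N^k)$, $x_N^{k+1}=x_N^k-\gamma\left[d-\lambda^k+\beta\left(\sum_{j=1}^{N-1}A_jx_j^{k+1}+x_N^k-b\right)\right]$, where $d=\nabla_Nf(\hat x)$ in Algorithms 1 and 2 and $d=G_N^M(\hat x)$ in Algorithm 3. Step 3: $\lambda^{k+1}=\lambda^k-\beta(\sum_{i=1}^N A_ix_i^{k+1}-b)$. Cones: for $C\subset\mathbb R^n$ and $x\in C$, the tangent cone $T_C(x)$ is the set of $w$ such that for all sequences $x_j\to x$ in $C$ and $t_j\downarrow0$ there are $w_j\to w$ with $x_j+t_jw_j\in C$ for all $j$. For a closed subset $S$ of $\mathcal M$, $x\in S$ and a chart $(U,\psi)$ of $\mathcal M$ at $x$: $\mathcal T_S(x)=[\mathbf D\psi(x)]^{-1}[T_{\psi(S\cap U)}(\psi(x))]$ and $\mathcal N_S(x)=\{u\in\mathcal T_x\mathcal M:\langle u,v\rangle\le0\ \forall v\in\mathcal T_S(x)\}$, where $\mathcal T_x\mathcal M$ is the tangent space. $\epsilon$-stationary solution: $x^*$ with multiplier $\lambda^*$ such that $\|\nabla_Nf(x^* )-A_N^\top\lambda^*\|\le\epsilon$, $\|\sum_{i=1}^N A_ix_i^*-b\|\le\epsilon$, and for $i=1,\dots,N-1$, $\operatorname{dist}\left(\operatorname{Proj}_{\mathcal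 T_{x_i^*}\mathcal M_i}\left(-\nabla_if(x^* )+A_i^\top\lambda^*-\partial r_i(x_i^* )\right),\mathcal N_{X_i\cap\mathcal M_i}(x_i^* )\right)\le\epsilon$. Here $\operatorname{dist}(A,B)=\inf_{a\in A,b\in B}\|a-b\|$, $\operatorname{Proj}$ is orthogonal projection (the identity when $\mathcal M_i=\mathbb R^{n_i}$), and $\partial r_i$ is the convex subdifferential for $i\in\mathcal I_1$ and the Clarke generalized subdifferential for $i\in\mathcal I_2$. $\epsilon$-stationary in expectation: $x^*,\lambda^*$ are random and the three quantities on the left-hand sides are replaced by their expectations.
   Formalization: In (c) the index k* is taken as a minimizer of E[θ_k] over 2≤k≤K+1 (a deterministic index), because with the pathwise argmin of the random θ_k the claim is false: the random index can select steps where the oracle noise cancels a large gradient. *)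

theory Defs
  imports "HOL-Probability.Probability"
begin

section \<open>Embedded submanifolds, tangent and normal cones\<close>

text \<open>Meaningful for open \<open>S\<close>: continuity of all iterated directional derivatives up to order \<open>k\<close>.\<close>

fun Ck_on :: "nat \<Rightarrow> 'a::real_normed_vector set \<Rightarrow> ('a \<Rightarrow> 'b::real_normed_vector) \<Rightarrow> bool" where
  "Ck_on 0 S f \<longleftrightarrow> continuous_on S f"
| "Ck_on (Suc k) S f \<longleftrightarrow> f differentiable_on S \<and>
     (\<forall>v. Ck_on k S (\<lambda>x. frechet_derivative f (at x) v))"

definition Cinf_on :: "'a::real_normed_vector set \<Rightarrow> ('a \<Rightarrow> 'b::real_normed_vector) \<Rightarrow> bool" where
  "Cinf_on S f \<longleftrightarrow> (\<forall>k. Ck_on k S f)"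

text \<open>
  Slice charts: a diffeomorphism \<open>\<phi>\<close> of an open set \<open>U\<close> of the ambient space onto an open set,
  straightening \<open>M\<close> to a linear subspace \<open>W\<close>. The chart of \<open>M\<close> itself is the restriction
  of \<open>\<phi>\<close> to \<open>M \<inter> U\<close>, with \<open>W\<close> as the model Euclidean space.
\<close>

definition slice_chart ::
  "'a::euclidean_space set \<Rightarrow> 'a set \<Rightarrow> ('a \<Rightarrow> 'a) \<Rightarrow> 'a set \<Rightarrow> bool" where
  "slice_chart M U \<phi> W \<longleftrightarrow>
     open U \<and> Cinf_on U \<phi> \<and> inj_on \<phi> U \<and> open (\<phi> ` U) \<and> Cinf_on (\<phi> ` U) (inv_into U \<phi>) \<and>
     subspace W \<and> \<phi> ` (M \<inter> U) = \<phi> ` U \<inter> W"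

definition embedded_submanifold :: "'a::euclidean_space set \<Rightarrow> bool" where
  "embedded_submanifold M \<longleftrightarrow>
     (\<exists>d. \<forall>x\<in>M. \<exists>U \<phi> W. x \<in> U \<and> slice_chart M U \<phi> W \<and> dim W = d)"

definition tangent_space :: "'a::euclidean_space set \<Rightarrow> 'a \<Rightarrow> 'a set" where
  "tangent_space M x = {v. \<exists>(c :: real \<Rightarrow> 'a) e. e > 0 \<and> Cinf_on {-e<..<e} c \<and>
     c ` {-e<..<e} \<subseteq> M \<and> c 0 = x \<and> (c has_vector_derivative v) (at 0)}"

definition tangent_cone :: "'a::euclidean_space set \<Rightarrow> 'a \<Rightarrow> 'a set" where
  "tangent_cone C x = {w. \<forall>(xs :: nat \<Rightarrow> 'a) (ts :: nat \<Rightarrow> real).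
     (\<forall>j. xs j \<in> C) \<and> xs \<longlonglongrightarrow> x \<and> (\<forall>j. ts j > 0) \<and> ts \<longlonglongrightarrow> 0 \<longrightarrow>
     (\<exists>ws. ws \<longlonglongrightarrow> w \<and> (\<forall>j. xs j + ts j *\<^sub>R ws j \<in> C))}"

text \<open>The cones below do not depend on the chart around \<open>x\<close>, so some chart is picked.\<close>

definition chart_at :: "'a::euclidean_space set \<Rightarrow> 'a \<Rightarrow> 'a set \<times> ('a \<Rightarrow> 'a)" where
  "chart_at M x = (SOME (U, \<phi>). x \<in> U \<and> (\<exists>W. slice_chart M U \<phi> W))"

definition manifold_tangent_cone :: "'a::euclidean_space set \<Rightarrow> 'a set \<Rightarrow> 'a \<Rightarrow> 'a set" where
  "manifold_tangent_cone M S x = (case chart_at M x of (U, \<phi>) \<Rightarrow>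
     {v \<in> tangent_space M x. frechet_derivative \<phi> (at x) v \<in> tangent_cone (\<phi> ` (S \<inter> U)) (\<phi> x)})"

definition manifold_normal_cone :: "'a::euclidean_space set \<Rightarrow> 'a set \<Rightarrow> 'a \<Rightarrow> 'a set" where
  "manifold_normal_cone M S x =
     {u \<in> tangent_space M x. \<forall>v \<in> manifold_tangent_cone M S x. u \<bullet> v \<le> 0}"


section \<open>Gradients and subdifferentials\<close>

definition grad :: "('a::euclidean_space \<Rightarrow> real) \<Rightarrow> 'a \<Rightarrow> 'a" where
  "grad f x = (THE D. GDERIV f x :> D)"

definition locally_lipschitz :: "('a::euclidean_space \<Rightarrow> real) \<Rightarrow> bool" where
  "locally_lipschitz r \<longleftrightarrow> (\<forall>x. \<exists>e>0. \<exists>C. C-lipschitz_on (ball x e) r)"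

definition convex_subdifferential :: "('a::euclidean_space \<Rightarrow> real) \<Rightarrow> 'a \<Rightarrow> 'a set" where
  "convex_subdifferential r x = {g. \<forall>y. r y \<ge> r x + g \<bullet> (y - x)}"

definition clarke_derivative :: "('a::euclidean_space \<Rightarrow> real) \<Rightarrow> 'a \<Rightarrow> 'a \<Rightarrow> ereal" where
  "clarke_derivative r x v =
     Limsup (nhds x \<times>\<^sub>F at_right (0::real)) (\<lambda>(y, t). ereal ((r (y + t *\<^sub>R v) - r y) / t))"

definition clarke_subdifferential :: "('a::euclidean_space \<Rightarrow> real) \<Rightarrow> 'a \<Rightarrow> 'a set" where
  "clarke_subdifferential r x = {g. \<forall>v. ereal (g \<bullet> v) \<le> clarke_derivative r x v}"

text \<open>With values in \<open>ennreal\<close>, the infimum over an empty set is \<open>\<infinity>\<close> (\<^const>\<open>setdist\<close> gives 0).\<close>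

definition set_distance :: "'a::euclidean_space set \<Rightarrow> 'a set \<Rightarrow> ennreal" where
  "set_distance A B = (INF a\<in>A. INF b\<in>B. ennreal (norm (a - b)))"


section \<open>The problem\<close>

text \<open>
  The blocks \<open>1, \<dots>, N-1\<close> are stacked into one vector of type \<open>real^'n\<close>, where \<open>blk p\<close> is the block
  to which coordinate \<open>p\<close> belongs, so that block \<open>i\<close> has \<open>card {p. blk p = i}\<close> coordinates. Its
  space is identified with the coordinate subspace \<open>blkspace\<close> of \<open>real^'n\<close>. The last block has
  type \<open>real^'m\<close>. Accordingly \<open>conmat\<close> is the matrix \<open>(A_1 ... A_{N-1})\<close>, and \<open>reg i\<close>, a function
  of block \<open>i\<close> only, is a function on \<open>real^'n\<close> that ignores all other coordinates.
\<close>

record ('n::finite, 'm::finite) problem =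
  nblocks :: nat
  blk :: "'n \<Rightarrow> nat"
  obj :: "(real^'n) \<times> (real^'m) \<Rightarrow> real"
  reg :: "nat \<Rightarrow> real^'n \<Rightarrow> real"
  conmat :: "real^'n^'m"
  rhs :: "real^'m"
  manifold :: "nat \<Rightarrow> (real^'n) set"
  cset :: "nat \<Rightarrow> (real^'n) set"

definition blkspace :: "('n::finite, 'm::finite) problem \<Rightarrow> nat \<Rightarrow> (real^'n) set" where
  "blkspace P i = {v. \<forall>p. blk P p \<noteq> i \<longrightarrow> v $ p = 0}"

definition part :: "('n::finite, 'm::finite) problem \<Rightarrow> nat \<Rightarrow> real^'n \<Rightarrow> real^'n" where
  "part P i u = (\<chi> p. if blk P p = i then u $ p else 0)"

definition colblock :: "('n::finite, 'm::finite) problem \<Rightarrow> nat \<Rightarrow> real^'n^'m" where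
  "colblock P i = (\<chi> q p. if blk P p = i then conmat P $ q $ p else 0)"

text \<open>Blocks before \<open>i\<close> taken from \<open>u\<close>, block \<open>i\<close> from \<open>z\<close>, later blocks from \<open>w\<close>.\<close>

definition splice ::
  "('n::finite, 'm::finite) problem \<Rightarrow> nat \<Rightarrow> real^'n \<Rightarrow> real^'n \<Rightarrow> real^'n \<Rightarrow> real^'n" where
  "splice P i u z w =
     (\<chi> p. if blk P p < i then u $ p else if blk P p = i then z $ p else w $ p)"

definition feasible_block :: "('n::finite, 'm::finite) problem \<Rightarrow> nat \<Rightarrow> (real^'n) set" where
  "feasible_block P i = manifold P i \<inter> cset P i"

definition reg_opt :: "('n::finite, 'm::finite) problem \<Rightarrow> nat \<Rightarrow> real" where
  "reg_opt P i = Inf (reg P i ` feasible_block P i)"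

definition obj_domain :: "('n::finite, 'm::finite) problem \<Rightarrow> ((real^'n) \<times> (real^'m)) set" where
  "obj_domain P = {(u, y). \<forall>i\<in>{1..<nblocks P}. part P i u \<in> feasible_block P i}"

definition obj_opt :: "('n::finite, 'm::finite) problem \<Rightarrow> real" where
  "obj_opt P = Inf (obj P ` obj_domain P)"

definition problem_assms :: "('n::finite, 'm::finite) problem \<Rightarrow> real \<Rightarrow> bool" where
  "problem_assms P L \<longleftrightarrow>
     nblocks P \<ge> 2 \<and> range (blk P) = {1..<nblocks P} \<and>
     L > 0 \<and> (\<forall>x. obj P differentiable (at x)) \<and> L-lipschitz_on UNIV (grad (obj P)) \<and>
     (\<forall>i\<in>{1..<nblocks P}.
        (\<forall>u. reg P i u = reg P i (part P i u)) \<and> locally_lipschitz (reg P i) \<and>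
        manifold P i \<subseteq> blkspace P i \<and> embedded_submanifold (manifold P i) \<and>
        cset P i \<subseteq> blkspace P i \<and> closed (cset P i) \<and> convex (cset P i) \<and>
        bdd_below (reg P i ` feasible_block P i)) \<and>
     bdd_below (obj P ` obj_domain P)"

text \<open>\<open>\<nabla>\<^sub>i f\<close> for \<open>i < N\<close>, and \<open>\<nabla>\<^sub>N f\<close>.\<close>

definition grad_block ::
  "('n::finite, 'm::finite) problem \<Rightarrow> nat \<Rightarrow> (real^'n) \<times> (real^'m) \<Rightarrow> real^'n" where
  "grad_block P i x = part P i (fst (grad (obj P) x))"

definition grad_last :: "('n::finite, 'm::finite) problem \<Rightarrow> (real^'n) \<times> (real^'m) \<Rightarrow> real^'m" where
  "grad_last P x = snd (grad (obj P) x)"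

definition residual ::
  "('n::finite, 'm::finite) problem \<Rightarrow> (real^'n) \<times> (real^'m) \<Rightarrow> real^'m" where
  "residual P x =
     (\<Sum>i\<in>{1..<nblocks P}. colblock P i *v part P i (fst x)) + snd x - rhs P"

definition aug_lagrangian ::
  "('n::finite, 'm::finite) problem \<Rightarrow> real \<Rightarrow> (real^'n) \<times> (real^'m) \<Rightarrow> real^'m \<Rightarrow> real" where
  "aug_lagrangian P \<beta> x lam =
     obj P x + (\<Sum>i\<in>{1..<nblocks P}. reg P i (part P i (fst x)))
     - residual P x \<bullet> lam + \<beta> / 2 * (norm (residual P x))\<^sup>2"

definition Psi_G ::
  "('n::finite, 'm::finite) problem \<Rightarrow> real \<Rightarrow> real \<Rightarrow> real \<Rightarrow>
   (real^'n) \<times> (real^'m) \<Rightarrow> real^'m \<Rightarrow> real^'m \<Rightarrow> real" where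
  "Psi_G P L \<beta> \<gamma> x lam xbar =
     aug_lagrangian P \<beta> x lam + 3 / \<beta> * ((\<beta> - 1 / \<gamma>)\<^sup>2 + L\<^sup>2) * (norm (xbar - snd x))\<^sup>2"

definition Psi_S ::
  "('n::finite, 'm::finite) problem \<Rightarrow> real \<Rightarrow> real \<Rightarrow> real \<Rightarrow>
   (real^'n) \<times> (real^'m) \<Rightarrow> real^'m \<Rightarrow> real^'m \<Rightarrow> real" where
  "Psi_S P L \<beta> \<gamma> x lam xbar =
     aug_lagrangian P \<beta> x lam + 4 / \<beta> * ((\<beta> - 1 / \<gamma>)\<^sup>2 + L\<^sup>2) * (norm (xbar - snd x))\<^sup>2"


section \<open>The matrices \<open>H_i\<close> and spectral quantities\<close>

text \<open>\<open>H_i\<close> is padded by zeros outside block \<open>i\<close>; this does not change its spectral norm.\<close>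

definition sym_block_matrix ::
  "('n::finite, 'm::finite) problem \<Rightarrow> nat \<Rightarrow> real^'n^'n \<Rightarrow> bool" where
  "sym_block_matrix P i B \<longleftrightarrow> transpose B = B \<and>
     (\<forall>p q. B $ p $ q \<noteq> 0 \<longrightarrow> blk P p = i \<and> blk P q = i)"

text \<open>\<open>B \<succ> c I\<close> on the space of block \<open>i\<close>.\<close>

definition block_succ ::
  "('n::finite, 'm::finite) problem \<Rightarrow> nat \<Rightarrow> real^'n^'n \<Rightarrow> real \<Rightarrow> bool" where
  "block_succ P i B c \<longleftrightarrow> (\<forall>v\<in>blkspace P i. v \<noteq> 0 \<longrightarrow> v \<bullet> (B *v v) > c * (v \<bullet> v))"

text \<open>
  Smallest singular value of the \<open>i\<close>-th diagonal block: square root of an eigenvalue of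
  \<open>B\<^sup>T B\<close> with eigenvector in the block space (the zero padding does not contribute).
\<close>

definition sigma_min ::
  "('n::finite, 'm::finite) problem \<Rightarrow> nat \<Rightarrow> real^'n^'n \<Rightarrow> real" where
  "sigma_min P i B =
     Inf {s. s \<ge> 0 \<and> (\<exists>v\<in>blkspace P i. v \<noteq> 0 \<and> transpose B *v (B *v v) = s\<^sup>2 *\<^sub>R v)}"

definition spec_norm :: "real^'a^'b \<Rightarrow> real" where
  "spec_norm B = onorm ((*v) B)"

text \<open>The inserted element of the first maximum is \<open>\<parallel>A_N\<parallel>\<close> with \<open>A_N = I\<close>.\<close>

definition Q_const ::
  "('n::finite, 'm::finite) problem \<Rightarrow> real \<Rightarrow> real \<Rightarrow> (nat \<Rightarrow> real^'n^'n) \<Rightarrow> real" where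
  "Q_const P L \<beta> H =
     L + \<beta> * sqrt (real (nblocks P)) *
       Max (insert ((spec_norm (mat 1 :: real^'m^'m))\<^sup>2)
             ((\<lambda>i. (spec_norm (colblock P i))\<^sup>2) ` {1..<nblocks P}))
     + Max ((\<lambda>i. spec_norm (H i)) ` {1..<nblocks P})"


section \<open>The algorithms\<close>

text \<open>
  A run of the common scheme: \<open>u k\<close> holds the blocks \<open>x_1^k, \<dots>, x_{N-1}^k\<close>, \<open>y k\<close> is \<open>x_N^k\<close>,
  \<open>model k i\<close> is the function added to the proximal term in Step 1, and \<open>d k\<close> is the
  (estimated) gradient of Step 2. Step 1 asserts that the minimum is attained.
\<close>

definition scheme ::
  "('n::finite, 'm::finite) problem \<Rightarrow> real \<Rightarrow> real \<Rightarrow> (nat \<Rightarrow> real^'n^'n) \<Rightarrow>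
   (nat \<Rightarrow> nat \<Rightarrow> real^'n \<Rightarrow> real) \<Rightarrow> (nat \<Rightarrow> real^'m) \<Rightarrow>
   (nat \<Rightarrow> real^'n) \<Rightarrow> (nat \<Rightarrow> real^'m) \<Rightarrow> (nat \<Rightarrow> real^'m) \<Rightarrow> bool" where
  "scheme P \<beta> \<gamma> H model d u y lam \<longleftrightarrow>
     (\<forall>i\<in>{1..<nblocks P}. part P i (u 0) \<in> feasible_block P i) \<and>
     (\<forall>k. \<forall>i\<in>{1..<nblocks P}.
        is_arg_min (\<lambda>z. model k i z
                        + 1/2 * ((z - part P i (u k)) \<bullet> (H i *v (z - part P i (u k)))))
          (\<lambda>z. z \<in> feasible_block P i) (part P i (u (Suc k)))) \<and>
     (\<forall>k. y (Suc k) = y k - \<gamma> *\<^sub>R (d k - lam k + \<beta> *\<^sub>R residual P (u (Suc k), y k))) \<and>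
     (\<forall>k. lam (Suc k) = lam k - \<beta> *\<^sub>R residual P (u (Suc k), y (Suc k)))"

text \<open>The point \<open>\<hat>x\<close> at which the model of block \<open>i\<close> is built.\<close>

definition query ::
  "('n::finite, 'm::finite) problem \<Rightarrow> (nat \<Rightarrow> real^'n) \<Rightarrow> (nat \<Rightarrow> real^'m) \<Rightarrow> nat \<Rightarrow> nat \<Rightarrow>
   (real^'n) \<times> (real^'m)" where
  "query P u y k i = (splice P i (u (Suc k)) (u k) (u k), y k)"

definition Phi ::
  "('n::finite, 'm::finite) problem \<Rightarrow> real \<Rightarrow> nat \<Rightarrow> real^'n \<Rightarrow>
   (real^'n) \<times> (real^'m) \<Rightarrow> real^'m \<Rightarrow> real^'n \<Rightarrow> real" where
  "Phi P \<beta> i z xhat lam d =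
     (let res = residual P (splice P i (fst xhat) z (fst xhat), snd xhat)
      in obj P xhat + d \<bullet> (z - part P i (fst xhat)) + reg P i z
         - res \<bullet> lam + \<beta> / 2 * (norm res)\<^sup>2)"

definition algorithm1 ::
  "('n::finite, 'm::finite) problem \<Rightarrow> real \<Rightarrow> real \<Rightarrow> (nat \<Rightarrow> real^'n^'n) \<Rightarrow>
   (nat \<Rightarrow> real^'n) \<Rightarrow> (nat \<Rightarrow> real^'m) \<Rightarrow> (nat \<Rightarrow> real^'m) \<Rightarrow> bool" where
  "algorithm1 P \<beta> \<gamma> H u y lam \<longleftrightarrow>
     scheme P \<beta> \<gamma> H
       (\<lambda>k i z. aug_lagrangian P \<beta> (splice P i (u (Suc k)) z (u k), y k) (lam k))
       (\<lambda>k. grad_last P (u (Suc k), y k)) u y lam"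

definition algorithm2 ::
  "('n::finite, 'm::finite) problem \<Rightarrow> real \<Rightarrow> real \<Rightarrow> (nat \<Rightarrow> real^'n^'n) \<Rightarrow>
   (nat \<Rightarrow> real^'n) \<Rightarrow> (nat \<Rightarrow> real^'m) \<Rightarrow> (nat \<Rightarrow> real^'m) \<Rightarrow> bool" where
  "algorithm2 P \<beta> \<gamma> H u y lam \<longleftrightarrow>
     scheme P \<beta> \<gamma> H
       (\<lambda>k i z. Phi P \<beta> i z (query P u y k i) (lam k) (grad_block P i (query P u y k i)))
       (\<lambda>k. grad_last P (u (Suc k), y k)) u y lam"

text \<open>
  \<open>D i\<close> is the law of \<open>\<xi>_i\<close>; \<open>G i\<close> (\<open>i < N\<close>) and \<open>GN\<close> are the oracles. Joint measurability
  makes the oracle evaluated at a random point a random variable.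
\<close>

definition oracle_assms ::
  "('n::finite, 'm::finite) problem \<Rightarrow> (nat \<Rightarrow> 's measure) \<Rightarrow>
   (nat \<Rightarrow> (real^'n) \<times> (real^'m) \<Rightarrow> 's \<Rightarrow> real^'n) \<Rightarrow>
   ((real^'n) \<times> (real^'m) \<Rightarrow> 's \<Rightarrow> real^'m) \<Rightarrow> real \<Rightarrow> bool" where
  "oracle_assms P D G GN \<sigma> \<longleftrightarrow>
     (\<forall>i\<in>{1..nblocks P}. prob_space (D i)) \<and>
     (\<forall>i\<in>{1..<nblocks P}.
        (\<lambda>(x, s). G i x s) \<in> borel_measurable (borel \<Otimes>\<^sub>M D i) \<and>
        (\<forall>x. \<forall>s\<in>space (D i). G i x s \<in> blkspace P i) \<and>
        (\<forall>x. integrable (D i) (G i x) \<and> integral\<^sup>L (D i) (G i x) = grad_block P i x \<and>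
             integrable (D i) (\<lambda>s. (norm (G i x s - grad_block P i x))\<^sup>2) \<and>
             integral\<^sup>L (D i) (\<lambda>s. (norm (G i x s - grad_block P i x))\<^sup>2) \<le> \<sigma>\<^sup>2)) \<and>
     (\<lambda>(x, s). GN x s) \<in> borel_measurable (borel \<Otimes>\<^sub>M D (nblocks P)) \<and>
     (\<forall>x. integrable (D (nblocks P)) (GN x) \<and> integral\<^sup>L (D (nblocks P)) (GN x) = grad_last P x \<and>
          integrable (D (nblocks P)) (\<lambda>s. (norm (GN x s - grad_last P x))\<^sup>2) \<and>
          integral\<^sup>L (D (nblocks P)) (\<lambda>s. (norm (GN x s - grad_last P x))\<^sup>2) \<le> \<sigma>\<^sup>2)"

definition batch_mean :: "nat \<Rightarrow> ('s \<Rightarrow> 'v::real_vector) \<Rightarrow> (nat \<Rightarrow> 's) \<Rightarrow> 'v" where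
  "batch_mean M g \<xi> = (1 / real M) *\<^sub>R (\<Sum>j\<in>{1..M}. g (\<xi> j))"

text \<open>
  \<open>\<xi> k i j\<close> is the \<open>j\<close>-th sample of the oracle call for block \<open>i\<close> in iteration \<open>k\<close>. The oracle calls
  are numbered \<open>t = k * N + (i - 1)\<close>, and \<open>F t\<close> is the information available just before call \<open>t\<close>:
  the batch of that call is i.i.d. and independent of \<open>F t\<close>, and it is known, together with the
  block it produces, from \<open>F (t + 1)\<close> on.
\<close>

definition fresh_sampling ::
  "('n::finite, 'm::finite) problem \<Rightarrow> 'w measure \<Rightarrow> (nat \<Rightarrow> 'w measure) \<Rightarrow> (nat \<Rightarrow> 's measure) \<Rightarrow>
   nat \<Rightarrow> (nat \<Rightarrow> nat \<Rightarrow> nat \<Rightarrow> 'w \<Rightarrow> 's) \<Rightarrow> bool" where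
  "fresh_sampling P Pr F D M \<xi> \<longleftrightarrow>
     prob_space Pr \<and> filtration (space Pr) F \<and> (\<forall>t. subalgebra Pr (F t)) \<and>
     (\<forall>k. \<forall>i\<in>{1..nblocks P}.
        (\<forall>j\<in>{1..M}. \<xi> k i j \<in> measurable (F (k * nblocks P + i)) (D i) \<and>
                     distr Pr (D i) (\<xi> k i j) = D i) \<and>
        prob_space.indep_vars Pr (\<lambda>_. D i) (\<xi> k i) {1..M} \<and>
        prob_space.indep_set Pr
          (sets (F (k * nblocks P + (i - 1))))
          (sets (vimage_algebra (space Pr) (\<lambda>\<omega>. \<lambda>j\<in>{1..M}. \<xi> k i j \<omega>) (PiM {1..M} (\<lambda>_. D i)))))"

definition adapted_iterates ::
  "('n::finite, 'm::finite) problem \<Rightarrow> 'w measure \<Rightarrow> (nat \<Rightarrow> 'w measure) \<Rightarrow>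
   ('w \<Rightarrow> nat \<Rightarrow> real^'n) \<Rightarrow> ('w \<Rightarrow> nat \<Rightarrow> real^'m) \<Rightarrow> ('w \<Rightarrow> nat \<Rightarrow> real^'m) \<Rightarrow> bool" where
  "adapted_iterates P Pr F u y lam \<longleftrightarrow>
     (\<exists>u0 y0 lam0. \<forall>\<omega>\<in>space Pr. u \<omega> 0 = u0 \<and> y \<omega> 0 = y0 \<and> lam \<omega> 0 = lam0) \<and>
     (\<forall>k. (\<forall>i\<in>{1..<nblocks P}.
             (\<lambda>\<omega>. part P i (u \<omega> (Suc k))) \<in> borel_measurable (F (k * nblocks P + i))) \<and>
          (\<lambda>\<omega>. y \<omega> (Suc k)) \<in> borel_measurable (F (Suc k * nblocks P)) \<and>
          (\<lambda>\<omega>. lam \<omega> (Suc k)) \<in> borel_measurable (F (Suc k * nblocks P)))"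

definition algorithm3 ::
  "('n::finite, 'm::finite) problem \<Rightarrow> 'w measure \<Rightarrow> (nat \<Rightarrow> 's measure) \<Rightarrow>
   (nat \<Rightarrow> (real^'n) \<times> (real^'m) \<Rightarrow> 's \<Rightarrow> real^'n) \<Rightarrow>
   ((real^'n) \<times> (real^'m) \<Rightarrow> 's \<Rightarrow> real^'m) \<Rightarrow>
   (nat \<Rightarrow> nat \<Rightarrow> nat \<Rightarrow> 'w \<Rightarrow> 's) \<Rightarrow> nat \<Rightarrow> real \<Rightarrow> real \<Rightarrow> (nat \<Rightarrow> real^'n^'n) \<Rightarrow>
   ('w \<Rightarrow> nat \<Rightarrow> real^'n) \<Rightarrow> ('w \<Rightarrow> nat \<Rightarrow> real^'m) \<Rightarrow> ('w \<Rightarrow> nat \<Rightarrow> real^'m) \<Rightarrow> bool" where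
  "algorithm3 P Pr D G GN \<xi> M \<beta> \<gamma> H u y lam \<longleftrightarrow>
     (\<exists>F. fresh_sampling P Pr F D M \<xi> \<and> adapted_iterates P Pr F u y lam) \<and>
     (\<forall>\<omega>\<in>space Pr.
        scheme P \<beta> \<gamma> H
          (\<lambda>k i z. Phi P \<beta> i z (query P (u \<omega>) (y \<omega>) k i) (lam \<omega> k)
                     (batch_mean M (G i (query P (u \<omega>) (y \<omega>) k i)) (\<lambda>j. \<xi> k i j \<omega>)))
          (\<lambda>k. batch_mean M (GN (u \<omega> (Suc k), y \<omega> k)) (\<lambda>j. \<xi> k (nblocks P) j \<omega>))
          (u \<omega>) (y \<omega>) (lam \<omega>))"

text \<open>
  Only used for \<open>k \<ge> 2\<close>, where the truncated subtraction is harmless. For the stochastic algorithm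
  the index \<open>k*\<close> minimizes the expectation of \<open>theta\<close>, hence is deterministic: a pathwise minimizer would
  be correlated with the oracle noise, and the noise at a random index is not controlled by \<open>\<sigma>\<^sup>2 / M\<close>.
\<close>

definition theta ::
  "('n::finite, 'm::finite) problem \<Rightarrow> (nat \<Rightarrow> real^'n) \<Rightarrow> (nat \<Rightarrow> real^'m) \<Rightarrow> nat \<Rightarrow> real" where
  "theta P u y k =
     (\<Sum>i\<in>{1..<nblocks P}. (norm (part P i (u k) - part P i (u (k + 1))))\<^sup>2
                         + (norm (part P i (u (k - 1)) - part P i (u k)))\<^sup>2)
     + ((norm (y k - y (k + 1)))\<^sup>2 + (norm (y (k - 1) - y k))\<^sup>2)"


section \<open>Approximate stationarity\<close>

definition subdiff ::
  "('n::finite, 'm::finite) problem \<Rightarrow> nat set \<Rightarrow> nat \<Rightarrow> real^'n \<Rightarrow> (real^'n) set" where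
  "subdiff P I1 i z =
     (if i \<in> I1 then convex_subdifferential (reg P i) z else clarke_subdifferential (reg P i) z)"

text \<open>
  \<^const>\<open>closest_point\<close> onto the tangent space is the orthogonal projection.
\<close>

definition block_gap ::
  "('n::finite, 'm::finite) problem \<Rightarrow> nat set \<Rightarrow> nat \<Rightarrow>
   (real^'n) \<times> (real^'m) \<Rightarrow> real^'m \<Rightarrow> ennreal" where
  "block_gap P I1 i x lam =
     (let xi = part P i (fst x) in
      set_distance
        ((\<lambda>g. closest_point (tangent_space (manifold P i) xi)
                (- grad_block P i x + transpose (colblock P i) *v lam - g)) ` subdiff P I1 i xi)
        (manifold_normal_cone (manifold P i) (feasible_block P i) xi))"

definition eps_stationary ::
  "('n::finite, 'm::finite) problem \<Rightarrow> nat set \<Rightarrow> real \<Rightarrow>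
   (real^'n) \<times> (real^'m) \<Rightarrow> real^'m \<Rightarrow> bool" where
  "eps_stationary P I1 \<epsilon> x lam \<longleftrightarrow>
     (\<forall>i\<in>{1..<nblocks P}. part P i (fst x) \<in> feasible_block P i) \<and>
     norm (grad_last P x - lam) \<le> \<epsilon> \<and>
     norm (residual P x) \<le> \<epsilon> \<and>
     (\<forall>i\<in>{1..<nblocks P}. block_gap P I1 i x lam \<le> ennreal \<epsilon>)"

text \<open>
  Expectation of a \<open>[0, \<infinity>]\<close>-valued function. For measurable functions this is the ordinary
  expectation (lemma below). Taking the upper integral makes a bound meaningful without settling
  beforehand whether the set distance in the stationarity measure is a measurable function of the
  random point; the library's integral would be a lower integral for a non-measurable function.
\<close>

definition upper_expectation :: "'w measure \<Rightarrow> ('w \<Rightarrow> ennreal) \<Rightarrow> ennreal" where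
  "upper_expectation Pr g =
     (INF h\<in>{h \<in> borel_measurable Pr. \<forall>\<omega>\<in>space Pr. g \<omega> \<le> h \<omega>}. \<integral>\<^sup>+ \<omega>. h \<omega> \<partial>Pr)"

lemma upper_expectation_measurable:
  assumes "g \<in> borel_measurable Pr"
  shows "upper_expectation Pr g = (\<integral>\<^sup>+ \<omega>. g \<omega> \<partial>Pr)"
  unfolding upper_expectation_def
proof (rule antisym)
  show "(INF h\<in>{h \<in> borel_measurable Pr. \<forall>\<omega>\<in>space Pr. g \<omega> \<le> h \<omega>}. \<integral>\<^sup>+ \<omega>. h \<omega> \<partial>Pr)
          \<le> (\<integral>\<^sup>+ \<omega>. g \<omega> \<partial>Pr)"
    using assms by (intro INF_lower) auto
  show "(\<integral>\<^sup>+ \<omega>. g \<omega> \<partial>Pr)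
          \<le> (INF h\<in>{h \<in> borel_measurable Pr. \<forall>\<omega>\<in>space Pr. g \<omega> \<le> h \<omega>}. \<integral>\<^sup>+ \<omega>. h \<omega> \<partial>Pr)"
    by (intro INF_greatest nn_integral_mono) auto
qed

definition eps_stationary_in_expectation ::
  "('n::finite, 'm::finite) problem \<Rightarrow> nat set \<Rightarrow> 'w measure \<Rightarrow> real \<Rightarrow>
   ('w \<Rightarrow> (real^'n) \<times> (real^'m)) \<Rightarrow> ('w \<Rightarrow> real^'m) \<Rightarrow> bool" where
  "eps_stationary_in_expectation P I1 Pr \<epsilon> x lam \<longleftrightarrow>
     x \<in> borel_measurable Pr \<and> lam \<in> borel_measurable Pr \<and>
     (\<forall>\<omega>\<in>space Pr. \<forall>i\<in>{1..<nblocks P}. part P i (fst (x \<omega>)) \<in> feasible_block P i) \<and>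
     upper_expectation Pr (\<lambda>\<omega>. ennreal (norm (grad_last P (x \<omega>) - lam \<omega>))) \<le> ennreal \<epsilon> \<and>
     upper_expectation Pr (\<lambda>\<omega>. ennreal (norm (residual P (x \<omega>)))) \<le> ennreal \<epsilon> \<and>
     (\<forall>i\<in>{1..<nblocks P}.
        upper_expectation Pr (\<lambda>\<omega>. block_gap P I1 i (x \<omega>) (lam \<omega>)) \<le> ennreal \<epsilon>)"

end

theory Submission
  imports Defs
begin

text \<open>
  The augmented Lagrangian, corrected by a multiple of \<open>\<parallel>x_N^{k-1} - x_N^k\<parallel>\<^sup>2\<close>, is an energy that drops by
  \<open>\<tau>\<close> times the squared step in every iteration: the block minimizations and the gradient step on
  \<open>x_N\<close> decrease the augmented Lagrangian, and the multiplier step increases it by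
  \<open>\<parallel>\<lambda>^{k+1} - \<lambda>^k\<parallel>\<^sup>2 / \<beta>\<close>, which is controlled by the steps because
  \<open>\<lambda>^{k+1} = \<nabla>_N f + (\<beta> - 1/\<gamma>)(x_N^k - x_N^{k+1})\<close>. The same formula bounds the energy from below, so
  some two consecutive steps among the first \<open>K\<close> are short. Short steps make all residuals small: for
  the blocks \<open>i < N\<close>, the first-order condition of the subproblem, which a minorant argument provides
  in terms of Clarke subgradients and the normal cone, differs from stationarity by at most \<open>Q\<close> times
  the step. With stochastic gradients the argument runs in expectation. The
  errors enter quadratically with variance \<open>\<sigma>\<^sup>2 / M\<close>, and consecutive errors are orthogonal.
\<close>

section \<open>Clarke subdifferentials and first-order optimality on a submanifold\<close>

text \<open>Some obstacles shape the proof. The initial multiplier is arbitrary and the formula for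
  \<lambda> holds only from index 1 on, so the energy starts at iterate 1 and the search for k* at
  2. In the lower bound the term <residual, \<lambda>> has no sign; evaluating f with x_N moved by
  minus the residual (A_N = I and x_N is free) replaces \<lambda> by \<lambda> - grad_N f, which is
  small. The constants have simple origins: 3 or 4 is the number of summands of \<lambda>^{k+1} -
  \<lambda>^k whose sum is squared, and the conditions on \<beta> and \<gamma> place 1/\<gamma>
  strictly between the real roots of a quadratic. Both kinds of regularizers share one optimality
  condition, since a Clarke subgradient of a convex function is a convex subgradient. For stochastic
  gradients every sample path is a deterministic run with errors, and only the resulting pathwise
  inequalities are averaged. This requires every term to be integrable, including the regularizers,
  for which no growth bound is given.\<close>

lemma sublinear_sandwich:
  fixes p :: "'a::euclidean_space \<Rightarrow> real"
  assumes add: "\<And>x y. p (x + y) \<le> p x + p y"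
    and scale: "\<And>c x. c > 0 \<Longrightarrow> p (c *\<^sub>R x) = c * p x"
    and T0: "0 \<in> T" and Tadd: "\<And>x y. x \<in> T \<Longrightarrow> y \<in> T \<Longrightarrow> x + y \<in> T"
    and Tscale: "\<And>c x. c > 0 \<Longrightarrow> x \<in> T \<Longrightarrow> c *\<^sub>R x \<in> T"
    and nonneg: "\<And>t. t \<in> T \<Longrightarrow> 0 \<le> p t"
  obtains g where "\<And>x. g \<bullet> x \<le> p x" "\<And>t. t \<in> T \<Longrightarrow> 0 \<le> g \<bullet> t"
proof -
  \<comment> \<open>Hahn-Banach by separation: the strict epigraph of \<open>p\<close> against
    \<open>T\<close> times the nonpositive half line. A separating hyperplane with normal (g,
    \<alpha>) yields the minorant -g / \<alpha>.\<close>
  define S where "S = {z :: 'a \<times> real. p (fst z) < snd z}"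
  define T' where "T' = {z :: 'a \<times> real. fst z \<in> T \<and> snd z \<le> 0}"
  have p0: "p 0 = 0" using scale[of 2 0] by simp
  have pscale: "p (c *\<^sub>R x) = c * p x" if "c \<ge> 0" for c x
    using scale[of c x] that p0 by (cases "c = 0") auto
  have Tsc: "c *\<^sub>R x \<in> T" if "c \<ge> 0" "x \<in> T" for c x
    using Tscale[of c x] that T0 by (cases "c = 0") auto
  have cS: "convex S"
  proof (rule convexI)
    fix x y :: "'a \<times> real" and u v :: real
    assume xy: "x \<in> S" "y \<in> S" and uv: "0 \<le> u" "0 \<le> v" "u + v = 1"
    have "p (u *\<^sub>R fst x + v *\<^sub>R fst y) \<le> u * p (fst x) + v * p (fst y)"
      using add[of "u *\<^sub>R fst x" "v *\<^sub>R fst y"] uv by (simp add: pscale)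
    also have "\<dots> < u * snd x + v * snd y"
    proof (cases "u > 0")
      case True
      then have "u * p (fst x) < u * snd x" using xy by (simp add: S_def)
      moreover have "v * p (fst y) \<le> v * snd y" using xy uv by (simp add: S_def mult_left_mono)
      ultimately show ?thesis by simp
    next
      case False
      then show ?thesis using xy uv by (simp add: S_def)
    qed
    finally show "u *\<^sub>R x + v *\<^sub>R y \<in> S" by (simp add: S_def)
  qed
  have cT: "convex T'"
    by (rule convexI) (auto simp: T'_def Tsc Tadd mult_nonneg_nonpos add_nonpos_nonpos)
  have "T' \<inter> S = {}" using nonneg by (force simp: S_def T'_def)
  moreover have "(0, 1) \<in> S" using p0 by (simp add: S_def)
  moreover have zT: "(0, 0) \<in> T'" using T0 by (simp add: T'_def)
  ultimately obtain a b where ab: "a \<noteq> 0" "\<forall>z\<in>T'. a \<bullet> z \<le> b" "\<forall>z\<in>S. b \<le> a \<bullet> z"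
    using separating_hyperplane_sets[OF cT cS] by blast
  obtain g \<alpha> where a: "a = (g, \<alpha>)" by fastforce
  have b0: "0 \<le> b" using ab(2) zT a by fastforce
  have S0: "0 \<le> g \<bullet> x + \<alpha> * s" if "p x < s" for x s
    using ab(3) that b0 a by (fastforce simp: S_def)
  \<comment> \<open>\<open>T\<close> is closed under positive scaling, so a positive value of
    \<open>g\<close> on it could be blown up beyond the bound \<open>b\<close>.\<close>
  have T1: "g \<bullet> t \<le> 0" if "t \<in> T" for t
  proof (rule ccontr)
    assume "\<not> g \<bullet> t \<le> 0"
    then have pos: "g \<bullet> t > 0" by simp
    have "(((b + 1) / (g \<bullet> t)) *\<^sub>R t, 0) \<in> T'"
      using that pos b0 by (simp add: T'_def Tsc)
    then have "a \<bullet> (((b + 1) / (g \<bullet> t)) *\<^sub>R t, 0) \<le> b" using ab(2) by blast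
    then show False using pos a by simp
  qed
  have a0: "\<alpha> \<ge> 0" using S0[of 0 1] p0 by simp
  \<comment> \<open>A vertical hyperplane is impossible: \<open>p\<close> is finite everywhere, so
    its epigraph lies over the whole space and \<open>g\<close> would vanish as well.\<close>
  have "\<alpha> \<noteq> 0"
  proof
    assume "\<alpha> = 0"
    then have "0 \<le> g \<bullet> (- g)" using S0[of "- g" "p (- g) + 1"] by simp
    then have "g = 0" by (metis inner_ge_zero inner_minus_right inner_eq_zero_iff neg_0_le_iff_le order_antisym)
    then show False using ab(1) a \<open>\<alpha> = 0\<close> by (simp add: zero_prod_def)
  qed
  with a0 have apos: "\<alpha> > 0" by simp
  have le: "(- g /\<^sub>R \<alpha>) \<bullet> x \<le> p x" for x
  proof (rule field_le_epsilon)
    fix e :: real assume "e > 0"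
    then show "(- g /\<^sub>R \<alpha>) \<bullet> x \<le> p x + e"
      using S0[of x "p x + e"] apos by (simp add: field_simps)
  qed
  show ?thesis
    by (rule that[of "- g /\<^sub>R \<alpha>"], rule le) (use T1 apos in \<open>simp add: field_simps\<close>)
qed

section \<open>Clarke's generalized directional derivative\<close>

definition diffquot :: "('a::euclidean_space \<Rightarrow> real) \<Rightarrow> 'a \<Rightarrow> 'a \<times> real \<Rightarrow> real" where
  "diffquot r v = (\<lambda>(y, t). (r (y + t *\<^sub>R v) - r y) / t)"

abbreviation clarke_filter :: "'a::euclidean_space \<Rightarrow> ('a \<times> real) filter" where
  "clarke_filter x \<equiv> nhds x \<times>\<^sub>F at_right (0::real)"

lemma clarke_filter_nontrivial: "clarke_filter x \<noteq> bot"
  by (simp add: prod_filter_eq_bot)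

lemma clarke_derivative_alt:
  "clarke_derivative r x v = Limsup (clarke_filter x) (\<lambda>z. ereal (diffquot r v z))"
  by (simp add: clarke_derivative_def diffquot_def case_prod_unfold)

lemma clarke_derivative_leI:
  assumes "eventually (\<lambda>z. diffquot r v z \<le> a) (clarke_filter x)"
  shows "clarke_derivative r x v \<le> ereal a"
  unfolding clarke_derivative_alt by (rule Limsup_bounded) (use assms in simp)

lemma clarke_derivative_lessD:
  assumes "clarke_derivative r x v < ereal a"
  shows "eventually (\<lambda>z. diffquot r v z < a) (clarke_filter x)"
  using Limsup_lessD[OF assms[unfolded clarke_derivative_alt]] by simp

lemma eventually_snd_pos: "eventually (\<lambda>z. snd z > 0) (clarke_filter x)"
proof -
  have "filterlim snd (at_right (0::real)) (clarke_filter x)" by (rule filterlim_snd)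
  then show ?thesis by (auto simp: filterlim_at elim: eventually_mono)
qed

text \<open>The base point of the difference quotient may drift with t. This freedom makes the
  Clarke derivative subadditive, which an ordinary directional derivative need not be.\<close>

lemma filterlim_clarke_shift:
  "filterlim (\<lambda>z. (fst z + snd z *\<^sub>R w, snd z)) (clarke_filter x) (clarke_filter x)"
proof (rule filterlim_Pair)
  have f: "filterlim fst (nhds x) (clarke_filter x)" by (rule filterlim_fst)
  have s: "filterlim snd (at_right 0) (clarke_filter x)" by (rule filterlim_snd)
  then have "filterlim snd (nhds 0) (clarke_filter x)"
    by (simp add: filterlim_at)
  then show "LIM z clarke_filter x. fst z + snd z *\<^sub>R w :> nhds x"
    using tendsto_add[OF f tendsto_scaleR[OF _ tendsto_const[of w]]] by force
  show "LIM z clarke_filter x. snd z :> at_right 0" by (rule s)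
qed

lemma filterlim_clarke_scale:
  assumes "c > 0"
  shows "filterlim (\<lambda>z. (fst z, c * snd z)) (clarke_filter x) (clarke_filter x)"
proof (rule filterlim_Pair)
  show "LIM z clarke_filter x. fst z :> nhds x" by (rule filterlim_fst)
  have s: "filterlim snd (at_right (0::real)) (clarke_filter x)" by (rule filterlim_snd)
  then have "filterlim snd (nhds (0::real)) (clarke_filter x)"
    by (simp add: filterlim_at)
  then have "((\<lambda>z. c * snd z) \<longlongrightarrow> 0) (clarke_filter x)"
    using tendsto_mult[OF tendsto_const[of c]] by force
  moreover have "eventually (\<lambda>z. c * snd z \<in> {0<..} \<and> c * snd z \<noteq> 0) (clarke_filter x)"
    using eventually_snd_pos[of x] by (rule eventually_mono) (use assms in auto)
  ultimately show "LIM z clarke_filter x. c * snd z :> at_right 0"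
    by (simp add: filterlim_at)
qed

text \<open>One Lipschitz constant near x serves all directions, since y and y + t v both end up in
  the Lipschitz ball. The upper limit is therefore finite.\<close>

lemma locally_lipschitz_diffquot:
  assumes "locally_lipschitz r"
  obtains C where "C \<ge> 0" "\<And>v. eventually (\<lambda>z. \<bar>diffquot r v z\<bar> \<le> C * norm v) (clarke_filter x)"
proof -
  obtain e C where e: "e > 0" and C: "C-lipschitz_on (ball x e) r"
    using assms unfolding locally_lipschitz_def by blast
  have C0: "C \<ge> 0" using C by (rule lipschitz_on_nonneg)
  have "eventually (\<lambda>z. \<bar>diffquot r v z\<bar> \<le> C * norm v) (clarke_filter x)" for v
  proof -
    have ev: "eventually (\<lambda>y. y \<in> ball x e) (nhds x)"
      using e by (intro eventually_nhds_in_open) auto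
    have "eventually (\<lambda>z. fst z \<in> ball x e) (clarke_filter x)"
      by (rule eventually_compose_filterlim[OF ev filterlim_fst])
    moreover have "eventually (\<lambda>z. fst z + snd z *\<^sub>R v \<in> ball x e) (clarke_filter x)"
      using eventually_compose_filterlim[OF calculation filterlim_clarke_shift] by simp
    ultimately show ?thesis using eventually_snd_pos
    proof eventually_elim
      case (elim z)
      have "\<bar>r (fst z + snd z *\<^sub>R v) - r (fst z)\<bar> \<le> C * norm (snd z *\<^sub>R v)"
        using lipschitz_onD[OF C elim(2,1)] by (simp add: dist_norm)
      then show ?case using elim by (simp add: diffquot_def case_prod_unfold field_simps)
    qed
  qed
  then show ?thesis using that C0 by blast
qed

text \<open>Lets sublinearity be stated over the reals; for locally Lipschitz \<open>r\<close> no
  information is lost, by \<open>clarke_derivative_real\<close>.\<close>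

definition clarke_real :: "('a::euclidean_space \<Rightarrow> real) \<Rightarrow> 'a \<Rightarrow> 'a \<Rightarrow> real" where
  "clarke_real r x v = real_of_ereal (clarke_derivative r x v)"

lemma clarke_derivative_real:
  assumes "locally_lipschitz r"
  shows "clarke_derivative r x v = ereal (clarke_real r x v)"
proof -
  obtain C where C: "C \<ge> 0" "\<And>v. eventually (\<lambda>z. \<bar>diffquot r v z\<bar> \<le> C * norm v) (clarke_filter x)"
    using locally_lipschitz_diffquot[OF assms, of x] by blast
  have "clarke_derivative r x v \<le> ereal (C * norm v)"
    by (rule clarke_derivative_leI) (use C(2)[of v] in \<open>auto elim!: eventually_mono\<close>)
  moreover have "ereal (- (C * norm v)) \<le> clarke_derivative r x v"
    unfolding clarke_derivative_alt
    by (rule order_trans[OF Liminf_bounded Liminf_le_Limsup[OF clarke_filter_nontrivial]])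
       (use C(2)[of v] in \<open>auto elim!: eventually_mono\<close>)
  ultimately have "\<bar>clarke_derivative r x v\<bar> \<noteq> \<infinity>" by auto
  then show ?thesis by (simp add: clarke_real_def ereal_real')
qed

lemma clarke_real_leI:
  assumes "locally_lipschitz r" "eventually (\<lambda>z. diffquot r v z \<le> a) (clarke_filter x)"
  shows "clarke_real r x v \<le> a"
  using clarke_derivative_leI[OF assms(2)] clarke_derivative_real[OF assms(1)] by simp

lemma clarke_real_lessD:
  assumes "locally_lipschitz r" "clarke_real r x v < a"
  shows "eventually (\<lambda>z. diffquot r v z < a) (clarke_filter x)"
  by (rule clarke_derivative_lessD) (use clarke_derivative_real[OF assms(1)] assms(2) in simp)

lemma clarke_real_add:
  assumes r: "locally_lipschitz r"
  shows "clarke_real r x (v + w) \<le> clarke_real r x v + clarke_real r x w"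
proof (rule field_le_epsilon)
  fix e :: real assume e: "e > 0"
  have "eventually (\<lambda>z. diffquot r v z < clarke_real r x v + e/2) (clarke_filter x)"
    using e by (intro clarke_real_lessD r) simp
  from eventually_compose_filterlim[OF this filterlim_clarke_shift]
  have "eventually (\<lambda>z. diffquot r v (fst z + snd z *\<^sub>R w, snd z) < clarke_real r x v + e/2) (clarke_filter x)" .
  moreover have "eventually (\<lambda>z. diffquot r w z < clarke_real r x w + e/2) (clarke_filter x)"
    using e by (intro clarke_real_lessD r) simp
  ultimately have "eventually (\<lambda>z. diffquot r (v + w) z \<le> clarke_real r x v + clarke_real r x w + e) (clarke_filter x)"
  proof eventually_elim
    case (elim z)
    \<comment> \<open>Split at the intermediate point y + t w: the quotient along v is taken there,
      and the shifted pair still converges to (x, 0) in the Clarke filter.\<close>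
    have "diffquot r (v + w) z = diffquot r v (fst z + snd z *\<^sub>R w, snd z) + diffquot r w z"
      by (simp add: diffquot_def case_prod_unfold algebra_simps flip: add_divide_distrib)
    then show ?case using elim by simp
  qed
  then show "clarke_real r x (v + w) \<le> clarke_real r x v + clarke_real r x w + e"
    by (rule clarke_real_leI[OF r])
qed

lemma clarke_real_scale_le:
  assumes r: "locally_lipschitz r" and c: "c > 0"
  shows "clarke_real r x (c *\<^sub>R v) \<le> c * clarke_real r x v"
proof (rule field_le_epsilon)
  fix e :: real assume e: "e > 0"
  have "eventually (\<lambda>z. diffquot r v z < clarke_real r x v + e/c) (clarke_filter x)"
    using e c by (intro clarke_real_lessD r) simp
  from eventually_compose_filterlim[OF this filterlim_clarke_scale[OF c]]
  have "eventually (\<lambda>z. diffquot r (c *\<^sub>R v) z \<le> c * clarke_real r x v + e) (clarke_filter x)"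
    using eventually_snd_pos
  proof eventually_elim
    case (elim z)
    have "diffquot r (c *\<^sub>R v) z = c * diffquot r v (fst z, c * snd z)"
      using c by (simp add: diffquot_def case_prod_unfold mult.commute)
    also have "\<dots> \<le> c * (clarke_real r x v + e/c)" using elim c by simp
    finally show ?case using c by (simp add: distrib_left)
  qed
  then show "clarke_real r x (c *\<^sub>R v) \<le> c * clarke_real r x v + e"
    by (rule clarke_real_leI[OF r])
qed

lemma clarke_real_scale:
  assumes r: "locally_lipschitz r" and c: "c > 0"
  shows "clarke_real r x (c *\<^sub>R v) = c * clarke_real r x v"
proof (rule antisym[OF clarke_real_scale_le[OF assms]])
  have "clarke_real r x v \<le> inverse c * clarke_real r x (c *\<^sub>R v)"
    using clarke_real_scale_le[OF r, of "inverse c" x "c *\<^sub>R v"] c by simp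
  then show "c * clarke_real r x v \<le> clarke_real r x (c *\<^sub>R v)" using c by (simp add: field_simps)
qed

lemma locally_lipschitz_isCont:
  assumes "locally_lipschitz r"
  shows "isCont r x"
proof -
  obtain e C where e: "e > 0" and C: "C-lipschitz_on (ball x e) r"
    using assms unfolding locally_lipschitz_def by blast
  then have "continuous_on (ball x e) r" by (intro lipschitz_on_continuous_on)
  then show ?thesis using e by (simp add: continuous_on_eq_continuous_at)
qed

text \<open>For t < 1 convexity bounds the difference quotient at y along w by r (y + w) - r y,
  which tends to r (x + w) - r x by continuity. Thus an optimality condition with Clarke
  subgradients also serves the blocks in \<open>I1\<close>.\<close>

lemma clarke_subdifferential_convex:
  assumes r: "locally_lipschitz r" and conv: "convex_on UNIV r"
  shows "clarke_subdifferential r x \<subseteq> convex_subdifferential r x"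
proof
  fix g assume g: "g \<in> clarke_subdifferential r x"
  have "g \<bullet> (y - x) \<le> r y - r x" for y
  proof -
    define w where "w = y - x"
    have "clarke_real r x w \<le> r y - r x"
    proof (rule field_le_epsilon)
      fix e :: real assume e: "e > 0"
      have "((\<lambda>z. r (fst z + w) - r (fst z)) \<longlongrightarrow> r (x + w) - r x) (clarke_filter x)"
      proof (intro tendsto_diff)
        have f: "(fst \<longlongrightarrow> x) (clarke_filter x)" by (rule filterlim_fst)
        show "((\<lambda>z. r (fst z)) \<longlongrightarrow> r x) (clarke_filter x)"
          by (rule isCont_tendsto_compose[OF locally_lipschitz_isCont[OF r] f])
        have "((\<lambda>z. fst z + w) \<longlongrightarrow> x + w) (clarke_filter x)" by (intro tendsto_add f tendsto_const)
        then show "((\<lambda>z. r (fst z + w)) \<longlongrightarrow> r (x + w)) (clarke_filter x)"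
          by (rule isCont_tendsto_compose[OF locally_lipschitz_isCont[OF r]])
      qed
      then have "eventually (\<lambda>z. r (fst z + w) - r (fst z) < r y - r x + e) (clarke_filter x)"
        using e by (intro order_tendstoD(2)) (auto simp: w_def)
      moreover have "eventually (\<lambda>z. snd z < 1) (clarke_filter x)"
      proof -
        have "filterlim snd (at_right (0::real)) (clarke_filter x)" by (rule filterlim_snd)
        then have "(snd \<longlongrightarrow> (0::real)) (clarke_filter x)" by (simp add: filterlim_at)
        then show ?thesis by (rule order_tendstoD) simp
      qed
      ultimately have "eventually (\<lambda>z. diffquot r w z \<le> r y - r x + e) (clarke_filter x)"
        using eventually_snd_pos
      proof eventually_elim
        case (elim z)
        define t where "t = snd z"
        have t: "0 < t" "t < 1" using elim t_def by auto
        have "r ((1 - t) *\<^sub>R fst z + t *\<^sub>R (fst z + w)) \<le> (1 - t) * r (fst z) + t * r (fst z + w)"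
          using convex_onD[OF conv, of t "fst z" "fst z + w"] t by simp
        moreover have "(1 - t) *\<^sub>R fst z + t *\<^sub>R (fst z + w) = fst z + t *\<^sub>R w"
          by (simp add: algebra_simps)
        ultimately have "(r (fst z + t *\<^sub>R w) - r (fst z)) / t \<le> r (fst z + w) - r (fst z)"
          using t by (simp add: field_simps)
        then show ?case using elim by (simp add: diffquot_def case_prod_unfold t_def)
      qed
      then show "clarke_real r x w \<le> r y - r x + e" by (rule clarke_real_leI[OF r])
    qed
    moreover have "g \<bullet> w \<le> clarke_real r x w"
      using g by (simp add: clarke_subdifferential_def clarke_derivative_real[OF r])
    ultimately show ?thesis by (simp add: w_def)
  qed
  then show "g \<in> convex_subdifferential r x"
    by (auto simp: convex_subdifferential_def algebra_simps)
qed

section \<open>Smooth maps, slice charts and the tangent space\<close>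

lemma Ck_on_cong:
  assumes "open S" "\<And>x. x \<in> S \<Longrightarrow> f x = g x" "Ck_on k S f"
  shows "Ck_on k S g"
  using assms(2,3)
proof (induction k arbitrary: f g)
  case 0
  then show ?case by (simp cong: continuous_on_cong)
next
  case (Suc k)
  have "f differentiable_on S" using Suc.prems by simp
  then have d: "g differentiable_on S"
    using Suc.prems(1) by (simp add: differentiable_on_def) (metis differentiable_transform_within zero_less_one)
  have fd: "frechet_derivative f (at x) = frechet_derivative g (at x)" if "x \<in> S" for x
  proof -
    have "(f has_derivative D) (at x) \<longleftrightarrow> (g has_derivative D) (at x)" for D
      using has_derivative_transform_within_open[OF _ assms(1) that, of f D UNIV g]
        has_derivative_transform_within_open[OF _ assms(1) that, of g D UNIV f] Suc.prems(1) by auto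
    then show ?thesis by (simp add: frechet_derivative_def)
  qed
  have "Ck_on k S (\<lambda>x. frechet_derivative g (at x) v)" for v
    by (rule Suc.IH[of "\<lambda>x. frechet_derivative f (at x) v"]) (use Suc.prems(2) fd in auto)
  with d show ?case by simp
qed

text \<open>Differentiating along a line gives a directional derivative of \<open>f\<close> along
  the same line, so the induction on the order closes. It supplies the smoothness of the curves that
  realize tangent vectors.\<close>

lemma Ck_on_affine:
  fixes f :: "'a::real_normed_vector \<Rightarrow> 'b::real_normed_vector" and I :: "real set"
  assumes S: "open S" and I: "open I" "\<And>t. t \<in> I \<Longrightarrow> a + t *\<^sub>R b \<in> S"
    and "Ck_on k S f"
  shows "Ck_on k I (\<lambda>t. f (a + t *\<^sub>R b))"
  using assms(4)
proof (induction k arbitrary: f)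
  case 0
  then have "continuous_on S f" by simp
  then show ?case
    using I by (auto intro!: continuous_on_compose2[where g = f and t = S] continuous_intros)
next
  case (Suc k)
  have fd: "(f has_derivative frechet_derivative f (at y)) (at y)" if "y \<in> S" for y
    using Suc.prems that S by (simp add: differentiable_on_eq_differentiable_at frechet_derivative_works)
  have der: "((\<lambda>t. f (a + t *\<^sub>R b)) has_derivative (\<lambda>s. frechet_derivative f (at (a + t *\<^sub>R b)) (s *\<^sub>R b))) (at t)"
    if "t \<in> I" for t
    by (rule has_derivative_compose[where f = "\<lambda>t. a + t *\<^sub>R b" and g = f, OF _ fd[OF I(2)[OF that]]])
       (auto intro!: derivative_eq_intros)
  have "Ck_on k I (\<lambda>t. frechet_derivative (\<lambda>t. f (a + t *\<^sub>R b)) (at t) s)" for s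
  proof (rule Ck_on_cong[OF I(1)])
    show "Ck_on k I (\<lambda>t. frechet_derivative f (at (a + t *\<^sub>R b)) (s *\<^sub>R b))"
      by (rule Suc.IH) (use Suc.prems in simp)
  qed (simp add: frechet_derivative_at[OF der, symmetric])
  moreover have "(\<lambda>t. f (a + t *\<^sub>R b)) differentiable_on I"
    using der by (auto simp: differentiable_on_def differentiable_def intro: has_derivative_at_withinI)
  ultimately show ?case by simp
qed

lemma Cinf_on_differentiable:
  assumes "Cinf_on S f" "open S" "x \<in> S"
  shows "(f has_derivative frechet_derivative f (at x)) (at x)"
proof -
  have "Ck_on (Suc 0) S f" using assms(1) unfolding Cinf_on_def by blast
  then show ?thesis
    using assms(2,3) by (simp add: differentiable_on_eq_differentiable_at frechet_derivative_works)
qed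

lemma slice_chart_inverse_derivative:
  assumes "slice_chart M U \<phi> W" "x \<in> U"
  shows "frechet_derivative (inv_into U \<phi>) (at (\<phi> x)) (frechet_derivative \<phi> (at x) v) = v"
proof -
  have ch: "open U" "Cinf_on U \<phi>" "inj_on \<phi> U" "open (\<phi> ` U)" "Cinf_on (\<phi> ` U) (inv_into U \<phi>)"
    using assms(1) by (auto simp: slice_chart_def)
  have "((\<lambda>z. inv_into U \<phi> (\<phi> z)) has_derivative
      (\<lambda>v. frechet_derivative (inv_into U \<phi>) (at (\<phi> x)) (frechet_derivative \<phi> (at x) v))) (at x)"
    by (rule has_derivative_compose[OF Cinf_on_differentiable[OF ch(2,1) assms(2)]
          Cinf_on_differentiable[OF ch(5,4)]]) (use assms(2) in auto)
  moreover have "((\<lambda>z. inv_into U \<phi> (\<phi> z)) has_derivative (\<lambda>v. v)) (at x)"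
    by (rule has_derivative_transform_within_open[OF has_derivative_ident ch(1) assms(2)])
       (use ch(3) in simp)
  ultimately show ?thesis by (metis has_derivative_unique)
qed

text \<open>A Frechet derivative is also a Hadamard derivative: the direction may vary with n as
  long as it converges. Tangent cone elements come with such varying directions.\<close>

lemma has_derivative_sequence_quotient:
  fixes f :: "'a::real_normed_vector \<Rightarrow> 'b::real_normed_vector" and t :: "nat \<Rightarrow> real"
  assumes f: "(f has_derivative D) (at a)"
    and t: "\<And>n. t n > 0" "t \<longlonglongrightarrow> 0" and w: "ws \<longlonglongrightarrow> w"
  shows "(\<lambda>n. (f (a + t n *\<^sub>R ws n) - f a) /\<^sub>R t n) \<longlonglongrightarrow> D w"
proof -
  have D: "bounded_linear D" using f by (rule has_derivative_bounded_linear)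
  \<comment> \<open>The normalized remainder. Its value at 0 is 0 because the inverse of 0 is 0, so
    \<open>R\<close> is continuous at 0 and steps with \<open>ws n = 0\<close> need no exclusion in
    the limit.\<close>
  define R where "R = (\<lambda>h. (f (a + h) - f a - D h) /\<^sub>R norm h)"
  have R: "(R \<longlongrightarrow> 0) (at 0)" 
  proof (rule tendsto_norm_zero_cancel)
    show "((\<lambda>h. norm (R h)) \<longlongrightarrow> 0) (at 0)"
      using f by (simp add: has_derivative_at R_def divide_inverse_commute)
  qed
  have R0: "isCont R 0" using R by (simp add: isCont_def R_def)
  have "(\<lambda>n. t n *\<^sub>R ws n) \<longlonglongrightarrow> 0" using tendsto_scaleR[OF t(2) w] by simp
  then have "(\<lambda>n. R (t n *\<^sub>R ws n)) \<longlonglongrightarrow> 0"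
    using isCont_tendsto_compose[OF R0] by (fastforce simp: R_def)
  then have "(\<lambda>n. D (ws n) + norm (ws n) *\<^sub>R R (t n *\<^sub>R ws n)) \<longlonglongrightarrow> D w + norm w *\<^sub>R 0"
    by (intro tendsto_intros w bounded_linear.tendsto[OF D])
  moreover have "D (ws n) + norm (ws n) *\<^sub>R R (t n *\<^sub>R ws n) = (f (a + t n *\<^sub>R ws n) - f a) /\<^sub>R t n" for n
  proof -
    have "D (t n *\<^sub>R ws n) = t n *\<^sub>R D (ws n)" by (rule linear_scale[OF bounded_linear.linear[OF D]])
    moreover have "D 0 = 0" by (rule linear_0[OF bounded_linear.linear[OF D]])
    ultimately show ?thesis
    proof (cases "ws n = 0")
      case False
      have "norm (ws n) * inverse (norm (t n *\<^sub>R ws n)) = inverse (t n)"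
        using False t(1)[of n] by (simp add: field_simps)
      then have "norm (ws n) *\<^sub>R R (t n *\<^sub>R ws n) =
          (f (a + t n *\<^sub>R ws n) - f a - D (t n *\<^sub>R ws n)) /\<^sub>R t n"
        by (simp only: R_def scaleR_scaleR)
      then show ?thesis
        using t(1)[of n] \<open>D (t n *\<^sub>R ws n) = t n *\<^sub>R D (ws n)\<close> by (simp add: scaleR_diff_right)
    qed simp
  qed
  ultimately show ?thesis by simp
qed

text \<open>In the chart a curve in \<open>M\<close> stays in the closed subspace \<open>W\<close>,
  hence so does its velocity. Conversely a straight segment in \<open>W\<close> is pulled back to a
  curve in \<open>M\<close>. This is what makes the tangent space a linear subspace.\<close>

lemma tangent_space_chart:
  assumes ch: "slice_chart M U \<phi> W" and x: "x \<in> U" "x \<in> M"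
  shows "tangent_space M x = {v. frechet_derivative \<phi> (at x) v \<in> W}"
proof (intro set_eqI iffI)
  have c: "open U" "Cinf_on U \<phi>" "inj_on \<phi> U" "open (\<phi> ` U)" "Cinf_on (\<phi> ` U) (inv_into U \<phi>)"
    "subspace W" "\<phi> ` (M \<inter> U) = \<phi> ` U \<inter> W"
    using ch by (auto simp: slice_chart_def)
  note d\<phi> = Cinf_on_differentiable[OF c(2,1) x(1)]
  fix v
  {
    assume "v \<in> tangent_space M x"
    then obtain cv :: "real \<Rightarrow> 'a" and e where cv: "e > 0" "cv ` {-e<..<e} \<subseteq> M" "cv 0 = x"
      "(cv has_vector_derivative v) (at 0)"
      unfolding tangent_space_def by blast
    define t :: "nat \<Rightarrow> real" where "t = (\<lambda>n. 1 / real (Suc n))"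
    have t: "t n > 0" "t \<longlonglongrightarrow> 0" for n
      using lim_1_over_n[THEN LIMSEQ_Suc] by (auto simp: t_def)
    have t0: "filterlim t (at 0) sequentially"
      unfolding filterlim_at using t by (auto simp: less_imp_neq[symmetric])
    have "((\<lambda>s. \<phi> (cv s)) has_derivative (\<lambda>s. frechet_derivative \<phi> (at x) (s *\<^sub>R v))) (at 0)"
      using has_derivative_compose[of cv _ 0 UNIV \<phi>] cv(3,4) d\<phi>
      by (simp add: has_vector_derivative_def)
    from has_derivative_sequence_quotient[OF this t tendsto_const[of 1]]
    have lim: "(\<lambda>n. (\<phi> (cv (t n)) - \<phi> x) /\<^sub>R t n) \<longlonglongrightarrow> frechet_derivative \<phi> (at x) v"
      using cv(3) by simp
    have "isCont cv 0" using cv(4) by (rule has_vector_derivative_continuous)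
    then have "(cv \<longlongrightarrow> x) (at 0)" using cv(3) by (simp add: isCont_def)
    then have ev: "eventually (\<lambda>t. cv t \<in> U) (at 0)" using c(1) x(1) by (rule topological_tendstoD)
    have "\<forall>\<^sub>F t in at 0. t \<in> {-e<..<e}"
      using cv(1) by (intro eventually_at_in_open') auto
    with ev have evW: "eventually (\<lambda>t. (\<phi> (cv t) - \<phi> x) /\<^sub>R t \<in> W) (at 0)"
    proof eventually_elim
      case (elim t)
      then have "cv t \<in> M \<inter> U" using cv(2) by auto
      then have "\<phi> (cv t) \<in> W" "\<phi> x \<in> W" using c(7) x by blast+
      then show ?case using c(6) by (intro subspace_scale subspace_diff)
    qed
    then have "frechet_derivative \<phi> (at x) v \<in> W"
      using Lim_in_closed_set[OF closed_subspace[OF c(6)] _ _ lim]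
        eventually_compose_filterlim[OF evW t0] by simp
    then show "v \<in> {v. frechet_derivative \<phi> (at x) v \<in> W}" by simp
  next
    assume "v \<in> {v. frechet_derivative \<phi> (at x) v \<in> W}"
    define w where "w = frechet_derivative \<phi> (at x) v"
    have wW: "w \<in> W" using \<open>v \<in> _\<close> w_def by simp
    obtain \<delta> where \<delta>: "\<delta> > 0" "ball (\<phi> x) \<delta> \<subseteq> \<phi> ` U"
      using c(4) x(1) by (meson image_eqI openE)
    \<comment> \<open>Short enough for the segment to stay in the ball around \<phi> x; the added 1
      covers the case w = 0.\<close>
    define e where "e = \<delta> / (norm w + 1)"
    have e: "e > 0" using \<delta> by (simp add: e_def add_nonneg_pos)
    have inU: "\<phi> x + t *\<^sub>R w \<in> \<phi> ` U" if "t \<in> {-e<..<e}" for t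
    proof -
      have "\<bar>t\<bar> < \<delta> / (norm w + 1)" using that by (auto simp: e_def)
      then have "\<bar>t\<bar> * (norm w + 1) < \<delta>" by (simp add: pos_less_divide_eq add_nonneg_pos)
      then have "norm (t *\<^sub>R w) < \<delta>" by (simp add: distrib_left)
      then show ?thesis using \<delta>(2) by (auto simp: dist_norm)
    qed
    define cv where "cv = (\<lambda>t. inv_into U \<phi> (\<phi> x + t *\<^sub>R w))"
    have "Cinf_on {-e<..<e} cv"
      using c(5) inU unfolding Cinf_on_def cv_def
      by (auto intro!: Ck_on_affine[OF c(4)])
    moreover have "cv ` {-e<..<e} \<subseteq> M"
    proof (clarify)
      fix t :: real assume t: "t \<in> {-e<..<e}"
      have "\<phi> x \<in> W" using c(7) x by blast
      then have "\<phi> x + t *\<^sub>R w \<in> \<phi> ` U \<inter> W"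
        using inU[OF t] wW c(6) by (simp add: subspace_add subspace_scale)
      then obtain m where "m \<in> M \<inter> U" "\<phi> m = \<phi> x + t *\<^sub>R w" using c(7) by (metis imageE)
      then show "cv t \<in> M" using c(3) by (metis IntD1 IntD2 cv_def inv_into_f_f)
    qed
    moreover have "cv 0 = x" using c(3) x(1) by (simp add: cv_def)
    moreover have "(cv has_vector_derivative v) (at 0)"
    proof -
      have "((\<lambda>t. \<phi> x + t *\<^sub>R w) has_derivative (\<lambda>s. s *\<^sub>R w)) (at 0)"
        by (auto intro!: derivative_eq_intros)
      moreover have "(inv_into U \<phi> has_derivative frechet_derivative (inv_into U \<phi>) (at (\<phi> x + 0 *\<^sub>R w)))
          (at (\<phi> x + 0 *\<^sub>R w))"
        by (rule Cinf_on_differentiable[OF c(5,4)]) (use x(1) in auto)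
      ultimately have "(cv has_derivative (\<lambda>s. frechet_derivative (inv_into U \<phi>) (at (\<phi> x + 0 *\<^sub>R w)) (s *\<^sub>R w))) (at 0)"
        unfolding cv_def by (rule has_derivative_compose)
      moreover have "frechet_derivative (inv_into U \<phi>) (at (\<phi> x + 0 *\<^sub>R w)) (s *\<^sub>R w) = s *\<^sub>R v" for s
      proof -
        have "s *\<^sub>R w = frechet_derivative \<phi> (at x) (s *\<^sub>R v)"
          unfolding w_def by (rule linear_scale[symmetric]) (rule has_derivative_linear[OF d\<phi>])
        then show ?thesis by (simp only: scale_zero_left add_0_right slice_chart_inverse_derivative[OF ch x(1)])
      qed
      ultimately show ?thesis by (simp add: has_vector_derivative_def)
    qed
    ultimately show "v \<in> tangent_space M x"
      unfolding tangent_space_def using e by (intro CollectI exI[of _ cv] exI[of _ e]) simp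
  }
qed

lemma chart_at_slice_chart:
  assumes "embedded_submanifold M" "x \<in> M"
  obtains U \<phi> W where "chart_at M x = (U, \<phi>)" "x \<in> U" "slice_chart M U \<phi> W"
proof -
  obtain U0 \<phi>0 W0 where "x \<in> U0" "slice_chart M U0 \<phi>0 W0"
    using assms unfolding embedded_submanifold_def by blast
  then have "\<exists>p. case p of (U, \<phi>) \<Rightarrow> x \<in> U \<and> (\<exists>W. slice_chart M U \<phi> W)"
    by (intro exI[of _ "(U0, \<phi>0)"]) auto
  from someI_ex[OF this] have "case chart_at M x of (U, \<phi>) \<Rightarrow> x \<in> U \<and> (\<exists>W. slice_chart M U \<phi> W)"
    by (simp add: chart_at_def)
  then show ?thesis using that by (cases "chart_at M x") auto
qed

lemma subspace_tangent_space:
  assumes "embedded_submanifold M" "x \<in> M"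
  shows "subspace (tangent_space M x)"
proof -
  obtain U \<phi> W where ch: "x \<in> U" "slice_chart M U \<phi> W"
    by (rule chart_at_slice_chart[OF assms])
  then have c: "open U" "Cinf_on U \<phi>" "subspace W" by (auto simp: slice_chart_def)
  have "linear (frechet_derivative \<phi> (at x))"
    by (rule has_derivative_linear[OF Cinf_on_differentiable[OF c(2,1) ch(1)]])
  then show ?thesis
    unfolding tangent_space_chart[OF ch(2,1) assms(2)]
    using c(3) by (auto simp: subspace_def linear_add linear_scale linear_0)
qed

section \<open>Tangent cones are convex cones\<close>

lemma tangent_cone_zero: "x \<in> C \<Longrightarrow> 0 \<in> tangent_cone C x"
  unfolding tangent_cone_def by (intro CollectI allI impI exI[of _ "\<lambda>_. 0"]) simp

lemma tangent_cone_scale: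
  assumes "c > 0" "w \<in> tangent_cone C x"
  shows "c *\<^sub>R w \<in> tangent_cone C x"
  unfolding tangent_cone_def
proof (intro CollectI allI impI, elim conjE)
  fix xs :: "nat \<Rightarrow> 'a" and ts :: "nat \<Rightarrow> real"
  assume a: "\<forall>j. xs j \<in> C" "xs \<longlonglongrightarrow> x" "\<forall>j. ts j > 0" "ts \<longlonglongrightarrow> 0"
  have "(\<lambda>j. c * ts j) \<longlonglongrightarrow> 0" using tendsto_mult_left[OF a(4), of c] by simp
  moreover have "\<forall>j. c * ts j > 0" using a(3) assms(1) by simp
  ultimately obtain ws where ws: "ws \<longlonglongrightarrow> w" "\<forall>j. xs j + (c * ts j) *\<^sub>R ws j \<in> C"
    using assms(2) a(1,2) unfolding tangent_cone_def by (auto dest!: spec[of _ xs] spec[of _ "\<lambda>j. c * ts j"])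
  then show "\<exists>ws. ws \<longlonglongrightarrow> c *\<^sub>R w \<and> (\<forall>j. xs j + ts j *\<^sub>R ws j \<in> C)"
    by (intro exI[of _ "\<lambda>j. c *\<^sub>R ws j"]) (auto simp: mult.commute intro: tendsto_scaleR)
qed

text \<open>The cone quantifies over all base sequences, so the sequence already displaced along v
  is an admissible base sequence for w. This is where convexity of the cone comes from.\<close>

lemma tangent_cone_add:
  assumes "v \<in> tangent_cone C x" "w \<in> tangent_cone C x"
  shows "v + w \<in> tangent_cone C x"
  unfolding tangent_cone_def
proof (intro CollectI allI impI, elim conjE)
  fix xs :: "nat \<Rightarrow> 'a" and ts :: "nat \<Rightarrow> real"
  assume a: "\<forall>j. xs j \<in> C" "xs \<longlonglongrightarrow> x" "\<forall>j. ts j > 0" "ts \<longlonglongrightarrow> 0"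
  obtain vs where vs: "vs \<longlonglongrightarrow> v" "\<forall>j. xs j + ts j *\<^sub>R vs j \<in> C"
    using assms(1) a unfolding tangent_cone_def by (auto dest!: spec[of _ xs] spec[of _ ts])
  have "(\<lambda>j. xs j + ts j *\<^sub>R vs j) \<longlonglongrightarrow> x"
    using tendsto_add[OF a(2) tendsto_scaleR[OF a(4) vs(1)]] by simp
  then obtain ws where ws: "ws \<longlonglongrightarrow> w" "\<forall>j. (xs j + ts j *\<^sub>R vs j) + ts j *\<^sub>R ws j \<in> C"
    using assms(2) a(3,4) vs(2) unfolding tangent_cone_def
    by (auto dest!: spec[of _ "\<lambda>j. xs j + ts j *\<^sub>R vs j"] spec[of _ ts])
  show "\<exists>ws. ws \<longlonglongrightarrow> v + w \<and> (\<forall>j. xs j + ts j *\<^sub>R ws j \<in> C)"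
    by (intro exI[of _ "\<lambda>j. vs j + ws j"] conjI tendsto_add vs ws)
       (use ws(2) in \<open>simp add: algebra_simps\<close>)
qed

text \<open>Inherited from the cone in the chart through the linear map D\<phi>. These are the
  closure properties that \<open>sublinear_sandwich\<close> asks of \<open>T\<close>.\<close>

lemma manifold_tangent_cone_convex_cone:
  assumes M: "embedded_submanifold M" and S: "S \<subseteq> M" "x \<in> S"
  shows "0 \<in> manifold_tangent_cone M S x"
    "\<And>v w. v \<in> manifold_tangent_cone M S x \<Longrightarrow> w \<in> manifold_tangent_cone M S x \<Longrightarrow>
        v + w \<in> manifold_tangent_cone M S x"
    "\<And>c v. c > 0 \<Longrightarrow> v \<in> manifold_tangent_cone M S x \<Longrightarrow> c *\<^sub>R v \<in> manifold_tangent_cone M S x"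
proof -
  have xM: "x \<in> M" using S by blast
  obtain U \<phi> W where ch: "chart_at M x = (U, \<phi>)" "x \<in> U" "slice_chart M U \<phi> W"
    by (rule chart_at_slice_chart[OF M xM])
  then have c: "open U" "Cinf_on U \<phi>" by (auto simp: slice_chart_def)
  have lin: "linear (frechet_derivative \<phi> (at x))"
    by (rule has_derivative_linear[OF Cinf_on_differentiable[OF c(2,1) ch(2)]])
  have x: "\<phi> x \<in> \<phi> ` (S \<inter> U)" using S ch(2) by blast
  note sub = subspace_tangent_space[OF M xM]
  show "0 \<in> manifold_tangent_cone M S x"
    using tangent_cone_zero[OF x] sub by (simp add: manifold_tangent_cone_def ch(1) linear_0[OF lin] subspace_0)
  show "v + w \<in> manifold_tangent_cone M S x"
    if "v \<in> manifold_tangent_cone M S x" "w \<in> manifold_tangent_cone M S x" for v w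
    using that sub by (simp add: manifold_tangent_cone_def ch(1) linear_add[OF lin] subspace_add tangent_cone_add)
  show "c *\<^sub>R v \<in> manifold_tangent_cone M S x" if "c > 0" "v \<in> manifold_tangent_cone M S x" for c v
    using that sub by (simp add: manifold_tangent_cone_def ch(1) linear_scale[OF lin] subspace_scale tangent_cone_scale)
qed

text \<open>The constant base sequence \<phi> x in the chart, pulled back by the inverse chart. The
  resulting points are feasible competitors approaching x in direction v.\<close>

lemma manifold_tangent_cone_sequence:
  assumes M: "embedded_submanifold M" and S: "S \<subseteq> M" "x \<in> S"
    and v: "v \<in> manifold_tangent_cone M S x"
    and t: "\<And>n. t n > (0::real)" "t \<longlonglongrightarrow> 0"
  obtains z where "\<And>n. z n \<in> S" "(\<lambda>n. (z n - x) /\<^sub>R t n) \<longlonglongrightarrow> v"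
proof -
  have xM: "x \<in> M" using S by blast
  obtain U \<phi> W where ch: "chart_at M x = (U, \<phi>)" "x \<in> U" "slice_chart M U \<phi> W"
    by (rule chart_at_slice_chart[OF M xM])
  then have c: "open U" "Cinf_on U \<phi>" "inj_on \<phi> U" "open (\<phi> ` U)" "Cinf_on (\<phi> ` U) (inv_into U \<phi>)"
    by (auto simp: slice_chart_def)
  define w where "w = frechet_derivative \<phi> (at x) v"
  define \<psi> where "\<psi> = inv_into U \<phi>"
  have "w \<in> tangent_cone (\<phi> ` (S \<inter> U)) (\<phi> x)"
    using v by (simp add: manifold_tangent_cone_def ch(1) w_def)
  moreover have "\<phi> x \<in> \<phi> ` (S \<inter> U)" using S ch(2) by blast
  ultimately obtain ws where ws: "ws \<longlonglongrightarrow> w" "\<forall>j. \<phi> x + t j *\<^sub>R ws j \<in> \<phi> ` (S \<inter> U)"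
    using t unfolding tangent_cone_def by (auto dest!: spec[of _ "\<lambda>_. \<phi> x"] spec[of _ t])
  define z where "z = (\<lambda>n. \<psi> (\<phi> x + t n *\<^sub>R ws n))"
  have zS: "z n \<in> S" for n
    using ws(2)[rule_format, of n] c(3) by (auto simp: z_def \<psi>_def)
  have "(\<psi> has_derivative frechet_derivative \<psi> (at (\<phi> x))) (at (\<phi> x))"
    unfolding \<psi>_def by (rule Cinf_on_differentiable[OF c(5,4)]) (use ch(2) in auto)
  moreover have "frechet_derivative \<psi> (at (\<phi> x)) w = v"
    unfolding w_def \<psi>_def by (rule slice_chart_inverse_derivative[OF ch(3,2)])
  moreover have "\<psi> (\<phi> x) = x" using c(3) ch(2) by (simp add: \<psi>_def)
  ultimately have "(\<lambda>n. (z n - x) /\<^sub>R t n) \<longlonglongrightarrow> v"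
    using has_derivative_sequence_quotient[of \<psi> "frechet_derivative \<psi> (at (\<phi> x))" "\<phi> x" t ws w] t ws(1)
    by (simp add: z_def)
  then show ?thesis using zS that by blast
qed

lemma closest_point_subspace:
  fixes T :: "'a::euclidean_space set"
  assumes "subspace T"
  shows "closest_point T a \<in> T" "w \<in> T \<Longrightarrow> closest_point T a \<bullet> w = a \<bullet> w"
proof -
  have T: "convex T" "closed T" "T \<noteq> {}"
    using assms subspace_0[OF assms] by (auto simp: subspace_imp_convex closed_subspace)
  show c: "closest_point T a \<in> T" using T by (intro closest_point_in_set)
  have le: "(a - closest_point T a) \<bullet> w \<le> 0" if "w \<in> T" for w
    using closest_point_dot[OF T(1,2), of "closest_point T a + w" a] c that assms by (simp add: subspace_add)
  show "closest_point T a \<bullet> w = a \<bullet> w" if "w \<in> T"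
    using le[OF that] le[of "- w"] that assms by (simp add: subspace_neg inner_diff_left)
qed

text \<open>
  At a minimizer the sublinear map given by the smooth gradient plus the Clarke derivative is
  nonnegative on the (convex) tangent cone; a linear minorant with the same property supplies the
  subgradient.
\<close>

lemma first_order_condition:
  fixes h r :: "'a::euclidean_space \<Rightarrow> real"
  assumes M: "embedded_submanifold M" and S: "S \<subseteq> M" "x \<in> S"
    and r: "locally_lipschitz r"
    and h: "GDERIV h x :> c"
    and min: "\<And>z. z \<in> S \<Longrightarrow> h x + r x \<le> h z + r z"
  obtains g where "g \<in> clarke_subdifferential r x"
    "closest_point (tangent_space M x) (- c - g) \<in> manifold_normal_cone M S x"
proof -
  define p where "p v = c \<bullet> v + clarke_real r x v" for v
  let ?T = "manifold_tangent_cone M S x"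
  have nonneg: "0 \<le> p v" if v: "v \<in> ?T" for v
  proof (rule field_le_epsilon)
    fix e :: real assume e: "e > 0"
    define t :: "nat \<Rightarrow> real" where "t = (\<lambda>n. 1 / real (Suc n))"
    have t: "t n > 0" "t \<longlonglongrightarrow> 0" for n
      using lim_1_over_n[THEN LIMSEQ_Suc] by (auto simp: t_def)
    obtain z where z: "\<And>n. z n \<in> S" "(\<lambda>n. (z n - x) /\<^sub>R t n) \<longlonglongrightarrow> v"
      using manifold_tangent_cone_sequence[OF M S v t] by blast
    define vs where "vs = (\<lambda>n. (z n - x) /\<^sub>R t n)"
    have zeq: "z n = x + t n *\<^sub>R vs n" for n using t(1)[of n] by (simp add: vs_def)
    have vs: "vs \<longlonglongrightarrow> v" using z(2) by (simp add: vs_def)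
    have "(h has_derivative (\<lambda>w. c \<bullet> w)) (at x)"
      using h by (simp add: gderiv_def inner_commute)
    from has_derivative_sequence_quotient[OF this t vs]
    have lh: "(\<lambda>n. (h (z n) - h x) /\<^sub>R t n) \<longlonglongrightarrow> c \<bullet> v" by (simp add: zeq)
    obtain \<delta> C where \<delta>: "\<delta> > 0" and C: "C-lipschitz_on (ball x \<delta>) r"
      using r unfolding locally_lipschitz_def by blast
    have tv: "(\<lambda>n. x + t n *\<^sub>R v) \<longlonglongrightarrow> x" "(\<lambda>n. x + t n *\<^sub>R vs n) \<longlonglongrightarrow> x"
      using tendsto_add[OF tendsto_const[of x] tendsto_scaleR[OF t(2) tendsto_const[of v]]]
        tendsto_add[OF tendsto_const[of x] tendsto_scaleR[OF t(2) vs]] by simp_all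
    have ev1: "eventually (\<lambda>n. x + t n *\<^sub>R v \<in> ball x \<delta>) sequentially"
      "eventually (\<lambda>n. x + t n *\<^sub>R vs n \<in> ball x \<delta>) sequentially"
      using tv[THEN topological_tendstoD, of "ball x \<delta>"] \<delta> by auto
    \<comment> \<open>The upper limit over moving base points also controls the quotients at the
      fixed base point x along the direction v.\<close>
    have "filterlim t (at_right 0) sequentially"
      unfolding filterlim_at using t by (auto simp: less_imp_neq[symmetric])
    then have "filterlim (\<lambda>n. (x, t n)) (clarke_filter x) sequentially"
      by (intro filterlim_Pair) auto
    moreover have "eventually (\<lambda>z. diffquot r v z < clarke_real r x v + e/3) (clarke_filter x)"
      using e by (intro clarke_real_lessD r) simp
    ultimately have ev2: "eventually (\<lambda>n. diffquot r v (x, t n) < clarke_real r x v + e/3) sequentially"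
      by (rule eventually_compose_filterlim[rotated])
    have "(\<lambda>n. C * norm (vs n - v)) \<longlonglongrightarrow> C * norm (v - v)"
      by (intro tendsto_intros vs)
    then have ev3: "eventually (\<lambda>n. C * norm (vs n - v) < e/3) sequentially"
      using e by (intro order_tendstoD) auto
    have ev4: "eventually (\<lambda>n. (h (z n) - h x) /\<^sub>R t n < c \<bullet> v + e/3) sequentially"
      using e by (intro order_tendstoD[OF lh]) simp
    from ev1 ev2 ev3 ev4 have "eventually (\<lambda>n. 0 \<le> p v + e) sequentially"
    proof eventually_elim
      case (elim n)
      \<comment> \<open>Feasible points have direction \<open>vs n\<close>, while the Clarke bound
        is for v. Local Lipschitz continuity pays for the change with one of the three shares
        e/3.\<close>
      have "\<bar>r (x + t n *\<^sub>R vs n) - r (x + t n *\<^sub>R v)\<bar> \<le> C * norm (t n *\<^sub>R (vs n - v))"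
        using lipschitz_onD[OF C elim(2,1)] unfolding dist_norm real_norm_def
        by (simp only: add_diff_cancel_left scaleR_diff_right)
      then have "r (z n) - r (x + t n *\<^sub>R v) \<le> t n * (C * norm (vs n - v))"
        using t(1)[of n] by (simp add: zeq mult.left_commute)
      also have "\<dots> \<le> t n * (e/3)" using elim(4) t(1)[of n] by simp
      finally have a: "r (z n) - r (x + t n *\<^sub>R v) \<le> t n * (e/3)" .
      have b: "r (x + t n *\<^sub>R v) - r x \<le> t n * (clarke_real r x v + e/3)"
        using elim(3) t(1)[of n] by (simp add: diffquot_def field_simps)
      have d: "h (z n) - h x \<le> t n * (c \<bullet> v + e/3)"
        using elim(5) t(1)[of n] by (simp add: field_simps)
      have "0 \<le> (h (z n) - h x) + (r (z n) - r x)" using min[OF z(1)[of n]] by simp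
      also have "\<dots> \<le> t n * (p v + e)" using a b d by (simp add: p_def algebra_simps)
      finally show ?case using t(1)[of n] by (simp add: zero_le_mult_iff)
    qed
    then show "0 \<le> p v + e" by simp
  qed
  obtain \<xi> where \<xi>: "\<And>v. \<xi> \<bullet> v \<le> p v" "\<And>v. v \<in> ?T \<Longrightarrow> 0 \<le> \<xi> \<bullet> v"
  proof (rule sublinear_sandwich[of p ?T])
    show "p (v + w) \<le> p v + p w" for v w
      using clarke_real_add[OF r, of x v w] by (simp add: p_def inner_add_right)
    show "p (a *\<^sub>R v) = a * p v" if "a > 0" for a v
      using clarke_real_scale[OF r that] by (simp add: p_def algebra_simps)
  qed (use manifold_tangent_cone_convex_cone[OF M S] nonneg in auto)
  \<comment> \<open>Subtracting the smooth gradient from the minorant leaves a functional below the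
    Clarke derivative, hence a Clarke subgradient.\<close>
  define g where "g = \<xi> - c"
  have "g \<in> clarke_subdifferential r x"
    using \<xi>(1) by (simp add: clarke_subdifferential_def clarke_derivative_real[OF r] g_def p_def
        inner_diff_left algebra_simps)
  moreover have "closest_point (tangent_space M x) (- c - g) \<in> manifold_normal_cone M S x"
  proof -
    have sub: "subspace (tangent_space M x)" using subspace_tangent_space[OF M] S by blast
    \<comment> \<open>The cone lies in the tangent space, so projecting - c - g = - \<xi> does not
      change its inner products with cone vectors.\<close>
    have "v \<in> tangent_space M x" if "v \<in> ?T" for v
      using that by (auto simp: manifold_tangent_cone_def split: prod.splits)
    then show ?thesis
      using closest_point_subspace[OF sub] \<xi>(2) by (auto simp: manifold_normal_cone_def g_def)
  qed
  ultimately show ?thesis using that by blast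
qed

text \<open>Take the same subgradient g in both arguments: projection onto a subspace is
  nonexpansive and g cancels, leaving the mismatch between the two smooth parts.\<close>

lemma set_distance_projection_le:
  assumes M: "embedded_submanifold M" "x \<in> M" and "g \<in> A"
    and "closest_point (tangent_space M x) (- c - g) \<in> B"
  shows "set_distance ((\<lambda>g. closest_point (tangent_space M x) (q - g)) ` A) B \<le> ennreal (norm (q + c))"
proof -
  let ?P = "closest_point (tangent_space M x)"
  have sub: "subspace (tangent_space M x)" by (rule subspace_tangent_space[OF M])
  have "dist (?P (q - g)) (?P (- c - g)) \<le> dist (q - g) (- c - g)"
    using sub subspace_0[OF sub] by (intro closest_point_lipschitz)
      (auto simp: subspace_imp_convex closed_subspace)
  then have "norm (?P (q - g) - ?P (- c - g)) \<le> norm (q + c)" by (simp add: dist_norm)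
  moreover have "set_distance ((\<lambda>g. ?P (q - g)) ` A) B \<le> ennreal (norm (?P (q - g) - ?P (- c - g)))"
    unfolding set_distance_def
    by (rule INF_lower2[of "?P (q - g)"], use assms(3) in blast, rule INF_lower, rule assms(4))
  ultimately show ?thesis by (meson ennreal_leI order_trans)
qed

section \<open>Block structure and spectral bounds\<close>

declare One_nat_def [simp del]

lemma descent_lemma:
  fixes f :: "'a::euclidean_space \<Rightarrow> real"
  assumes f: "\<And>x. GDERIV f x :> g x" and g: "L-lipschitz_on UNIV g"
  shows "f y \<le> f x + g x \<bullet> (y - x) + L / 2 * (norm (y - x))\<^sup>2"
proof -
  define d where "d = y - x"
  \<comment> \<open>f along the segment minus its quadratic upper model at x; the Lipschitz bound on
    the gradient makes its derivative nonpositive.\<close>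
  define \<phi> where "\<phi> t = f (x + t *\<^sub>R d) - t * (g x \<bullet> d) - L / 2 * t\<^sup>2 * (norm d)\<^sup>2" for t
  have "\<phi> 1 \<le> \<phi> 0"
  proof (rule DERIV_nonpos_imp_nonincreasing[of 0 1 \<phi>])
    show "\<exists>D. (\<phi> has_real_derivative D) (at t) \<and> D \<le> 0" if t: "0 \<le> t" "t \<le> 1" for t
    proof (intro exI conjI)
      have "(f has_derivative (\<lambda>h. g (x + t *\<^sub>R d) \<bullet> h)) (at (x + t *\<^sub>R d))"
        using f[of "x + t *\<^sub>R d"] by (simp add: gderiv_def inner_commute)
      then have "((\<lambda>s. f (x + s *\<^sub>R d)) has_derivative (\<lambda>s. g (x + t *\<^sub>R d) \<bullet> (s *\<^sub>R d))) (at t)"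
        by (rule has_derivative_compose[where f = "\<lambda>s. x + s *\<^sub>R d", rotated])
           (auto intro!: derivative_eq_intros)
      then have "((\<lambda>s. f (x + s *\<^sub>R d)) has_real_derivative g (x + t *\<^sub>R d) \<bullet> d) (at t)"
        by (simp add: has_field_derivative_def mult_commute_abs)
      then show "(\<phi> has_real_derivative (g (x + t *\<^sub>R d) - g x) \<bullet> d - L * t * (norm d)\<^sup>2) (at t)"
        unfolding \<phi>_def inner_diff_left
        by (intro DERIV_diff) (auto intro!: derivative_eq_intros)
      have "(g (x + t *\<^sub>R d) - g x) \<bullet> d \<le> norm (g (x + t *\<^sub>R d) - g x) * norm d"
        by (rule norm_cauchy_schwarz)
      also have "norm (g (x + t *\<^sub>R d) - g x) \<le> L * (t * norm d)"
        using lipschitz_onD[OF g, of "x + t *\<^sub>R d" x] t by (simp add: dist_norm)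
      finally show "(g (x + t *\<^sub>R d) - g x) \<bullet> d - L * t * (norm d)\<^sup>2 \<le> 0"
        by (simp add: mult_right_mono power2_eq_square mult.assoc mult.left_commute)
    qed
  qed simp
  then show ?thesis by (simp add: \<phi>_def d_def)
qed

text \<open>Near 0 the linear term dominates; t = -a / s with s > |b| is small enough to show it.
  Needed as the first-order condition of a Rayleigh quotient minimizer.\<close>

lemma nonneg_quadratic_imp_linear_zero:
  fixes a b :: real
  assumes "\<And>t. 0 \<le> a * t + b * t\<^sup>2"
  shows "a = 0"
proof (rule ccontr)
  assume a: "a \<noteq> 0"
  define s where "s = \<bar>b\<bar> + 1"
  have s: "s > 0" "b < s" by (auto simp: s_def)
  have "0 \<le> a * (- a / s) + b * (- a / s)\<^sup>2" by (rule assms)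
  also have "\<dots> = a\<^sup>2 / s\<^sup>2 * (b - s)" using s by (simp add: field_simps power2_eq_square)
  also have "\<dots> < 0" using s a by (intro mult_pos_neg) auto
  finally show False by simp
qed

section \<open>Spectral norms, block projections and the smallest singular value\<close>

lemma spec_norm_le: "norm (B *v w) \<le> spec_norm B * norm w"
  unfolding spec_norm_def by (rule onorm) simp

lemma spec_norm_nonneg: "0 \<le> spec_norm B"
  unfolding spec_norm_def by (rule onorm_pos_le) simp

text \<open>The squared norm of B^T w equals <B B^T w, w>; Cauchy-Schwarz and division by the norm
  of B^T w give the bound.\<close>

lemma spec_norm_transpose_le: "norm (transpose B *v w) \<le> spec_norm B * norm w"
proof (cases "transpose B *v w = 0")
  case False
  have "(norm (transpose B *v w))\<^sup>2 = (B *v (transpose B *v w)) \<bullet> w"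
    by (simp add: power2_norm_eq_inner dot_lmul_matrix inner_commute)
  also have "\<dots> \<le> norm (B *v (transpose B *v w)) * norm w" by (rule norm_cauchy_schwarz)
  also have "\<dots> \<le> (spec_norm B * norm (transpose B *v w)) * norm w"
    by (intro mult_right_mono spec_norm_le) simp
  finally have "norm (transpose B *v w) * norm (transpose B *v w)
      \<le> norm (transpose B *v w) * (spec_norm B * norm w)"
    by (simp add: power2_eq_square algebra_simps)
  then show ?thesis using False by simp
qed (simp add: spec_norm_nonneg)

lemma spec_norm_mat_1: "spec_norm (mat 1 :: real^'m^'m) = 1"
proof -
  have "(*v) (mat 1 :: real^'m^'m) = (\<lambda>x. x)" by (auto simp: matrix_vector_mul_lid)
  then show ?thesis unfolding spec_norm_def by (simp add: onorm_id)
qed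

lemma part_add: "part P i (u + v) = part P i u + part P i v"
  and part_diff: "part P i (u - v) = part P i u - part P i v"
  and part_scaleR: "part P i (c *\<^sub>R u) = c *\<^sub>R part P i u"
  and part_part: "part P i (part P j u) = (if i = j then part P i u else 0)"
  by (auto simp: part_def vec_eq_iff)

lemma part_in_blkspace: "part P i u \<in> blkspace P i"
  by (simp add: part_def blkspace_def)

lemma subspace_blkspace: "subspace (blkspace P i)"
  by (auto simp: subspace_def blkspace_def)

lemma part_inner: "part P i u \<bullet> v = u \<bullet> part P i v"
  by (simp add: inner_vec_def part_def if_distrib if_distribR cong: if_cong)

lemma inner_part_same: "part P i u \<bullet> part P i v = u \<bullet> part P i v"
  by (simp add: part_inner part_part)

lemma norm_part_le: "norm (part P i u) \<le> norm u"
proof -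
  have "(norm (part P i u))\<^sup>2 \<le> norm u * norm (part P i u)"
    using norm_cauchy_schwarz[of u "part P i u"] by (simp add: power2_norm_eq_inner inner_part_same)
  then show ?thesis
    by (cases "part P i u = 0") (auto simp: power2_eq_square)
qed

lemma colblock_mult: "colblock P i *v z = conmat P *v part P i z"
  by (auto simp: vec_eq_iff colblock_def part_def matrix_vector_mult_def intro!: sum.cong)

text \<open>The Rayleigh quotient attains its minimum \<mu> on the compact unit sphere of the block
  space, at an eigenvector. Since \<mu> > c \<ge> 0, this \<mu> is itself a singular value, and it
  is the smallest one. Attainment also preserves the strict inequality with c.\<close>

lemma sigma_min_bounds:
  assumes B: "sym_block_matrix P i B" "block_succ P i B c" and c: "c \<ge> 0"
    and i: "i \<in> range (blk P)"
  shows "c < sigma_min P i B"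
    and "v \<in> blkspace P i \<Longrightarrow> sigma_min P i B * (v \<bullet> v) \<le> v \<bullet> (B *v v)"
proof -
  let ?V = "blkspace P i"
  define S where "S = sphere 0 1 \<inter> ?V"
  obtain p where p: "blk P p = i" using i by auto
  have "axis p 1 \<in> S" using p by (auto simp: S_def blkspace_def axis_def norm_axis_1[unfolded axis_def])
  then have "S \<noteq> {}" by blast
  moreover have "compact S"
    unfolding S_def by (intro compact_Int_closed compact_sphere closed_subspace subspace_blkspace)
  moreover have "continuous_on S (\<lambda>v. v \<bullet> (B *v v))"
    by (intro continuous_intros matrix_vector_mult_linear_continuous_on)
  ultimately obtain v0 where v0: "v0 \<in> S" and min: "\<And>v. v \<in> S \<Longrightarrow> v0 \<bullet> (B *v v0) \<le> v \<bullet> (B *v v)"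
    using continuous_attains_inf[of S] by blast
  define \<mu> where "\<mu> = v0 \<bullet> (B *v v0)"
  have v0V: "v0 \<in> ?V" and n0: "v0 \<bullet> v0 = 1"
    using v0 by (auto simp: S_def norm_eq_1)
  have Rq: "\<mu> * (v \<bullet> v) \<le> v \<bullet> (B *v v)" if "v \<in> ?V" for v
  proof (cases "v = 0")
    case False
    have "v /\<^sub>R norm v \<in> S"
      using that False by (auto simp: S_def intro: subspace_scale[OF subspace_blkspace])
    from min[OF this] have "\<mu> \<le> (v \<bullet> (B *v v)) / (norm v)\<^sup>2"
      by (simp add: \<mu>_def matrix_vector_mult_scaleR power2_eq_square divide_inverse algebra_simps)
    then show ?thesis using False by (simp add: pos_le_divide_eq power2_norm_eq_inner)
  qed simp
  have sym: "x \<bullet> (B *v y) = y \<bullet> (B *v x)" for x y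
  proof -
    have "transpose B = B" using B(1) by (simp add: sym_block_matrix_def)
    then show ?thesis by (metis dot_lmul_matrix inner_commute transpose_matrix_vector)
  qed
  have BV: "B *v x \<in> ?V" for x
  proof -
    have "B $ p $ q = 0" if "blk P p \<noteq> i" for p q
      using B(1) that unfolding sym_block_matrix_def by blast
    then show ?thesis by (simp add: blkspace_def matrix_vector_mult_def)
  qed
  have eig: "B *v v0 = \<mu> *\<^sub>R v0"
  proof -
    \<comment> \<open>Perturbing the minimizer along its eigenvector residual \<open>w\<close> gives
      a nonnegative quadratic in t with linear coefficient 2 <w, w>, so \<open>w\<close>
      vanishes.\<close>
    define w where "w = B *v v0 - \<mu> *\<^sub>R v0"
    have wV: "w \<in> ?V" unfolding w_def
      by (intro subspace_diff subspace_scale subspace_blkspace BV v0V)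
    have "0 \<le> (2 * (w \<bullet> w)) * t + (w \<bullet> (B *v w) - \<mu> * (w \<bullet> w)) * t\<^sup>2" for t
    proof -
      have "v0 + t *\<^sub>R w \<in> ?V" by (intro subspace_add subspace_scale subspace_blkspace wV v0V)
      from Rq[OF this]
      have "0 \<le> 2 * t * (w \<bullet> (B *v v0) - \<mu> * (w \<bullet> v0)) + (w \<bullet> (B *v w) - \<mu> * (w \<bullet> w)) * t\<^sup>2"
        by (simp add: matrix_vector_right_distrib matrix_vector_mult_scaleR inner_add_left inner_add_right
            \<mu>_def[symmetric] n0 sym[of v0 w] inner_commute[of v0 w] power2_eq_square algebra_simps)
      moreover have "w \<bullet> (B *v v0) - \<mu> * (w \<bullet> v0) = w \<bullet> w"
        by (simp add: w_def inner_diff_right)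
      ultimately show ?thesis by (simp add: algebra_simps)
    qed
    then have "2 * (w \<bullet> w) = 0" by (rule nonneg_quadratic_imp_linear_zero)
    then show ?thesis by (simp add: w_def)
  qed
  let ?A = "{s. s \<ge> 0 \<and> (\<exists>v\<in>?V. v \<noteq> 0 \<and> transpose B *v (B *v v) = s\<^sup>2 *\<^sub>R v)}"
  have v00: "v0 \<noteq> 0" using n0 by auto
  have \<mu>c: "\<mu> > c" using B(2) v0V v00 n0 by (auto simp: block_succ_def \<mu>_def dest!: bspec[of _ _ v0])
  have tr: "transpose B = B" using B(1) by (simp add: sym_block_matrix_def)
  have mem: "\<mu> \<in> ?A"
    using \<mu>c c v0V v00 by (auto simp: tr eig matrix_vector_mult_scaleR power2_eq_square intro!: bexI[of _ v0])
  \<comment> \<open>For symmetric \<open>B\<close> the equation B^T B v = s^2 v gives norm (B v) = s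
    norm v, and Cauchy-Schwarz bounds the Rayleigh quotient of v by s.\<close>
  have low: "\<mu> \<le> s" if s: "s \<in> ?A" for s
  proof -
    obtain v where v: "v \<in> ?V" "v \<noteq> 0" "transpose B *v (B *v v) = s\<^sup>2 *\<^sub>R v" and s0: "s \<ge> 0"
      using s by blast
    have "(norm (B *v v))\<^sup>2 = v \<bullet> (B *v (B *v v))"
      by (simp add: power2_norm_eq_inner sym[of v "B *v v"])
    also have "\<dots> = (s * norm v)\<^sup>2" using v(3) by (simp add: tr power_mult_distrib power2_norm_eq_inner)
    finally have nB: "norm (B *v v) = s * norm v"
      using s0 by (simp add: power2_eq_iff_nonneg)
    have "\<mu> * (norm v * norm v) \<le> v \<bullet> (B *v v)" using Rq[OF v(1)] by (simp add: power2_norm_eq_inner[symmetric] power2_eq_square)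
    also have "\<dots> \<le> norm v * (s * norm v)" using norm_cauchy_schwarz[of v "B *v v"] nB by simp
    finally have "\<mu> * (norm v * norm v) \<le> s * (norm v * norm v)" by (simp add: algebra_simps)
    then show ?thesis using v(2) by simp
  qed
  have "sigma_min P i B = \<mu>"
    unfolding sigma_min_def using mem low by (intro cInf_eq_minimum) auto
  then show "c < sigma_min P i B"
    and "v \<in> blkspace P i \<Longrightarrow> sigma_min P i B * (v \<bullet> v) \<le> v \<bullet> (B *v v)"
    using \<mu>c Rq by auto
qed

text \<open>The state of a sweep after i block updates: index i - 1 is the query point of block i,
  and index i is the point at which its optimality condition lives.\<close>

definition hybrid :: "('n::finite, 'm::finite) problem \<Rightarrow> nat \<Rightarrow> real^'n \<Rightarrow> real^'n \<Rightarrow> real^'n" where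
  "hybrid P i v w = (\<chi> p. if blk P p \<le> i then v $ p else w $ p)"

lemma splice_hybrid:
  shows "splice P i v v w = hybrid P i v w"
    and "splice P i v (part P i v) w = hybrid P i v w"
    and "i \<ge> 1 \<Longrightarrow> splice P i v w w = hybrid P (i - 1) v w"
    and "i \<ge> 1 \<Longrightarrow> splice P i v (part P i w) w = hybrid P (i - 1) v w"
  by (auto simp: splice_def hybrid_def part_def vec_eq_iff)

lemma splice_affine: "splice P i a z b = splice P i a 0 b + part P i z"
  by (auto simp: splice_def part_def vec_eq_iff)

lemma splice_splice: "splice P i (splice P i a b b) z (splice P i a b b) = splice P i a z b"
  by (auto simp: splice_def vec_eq_iff)

lemma hybrid_diff: "i \<ge> 1 \<Longrightarrow> hybrid P i v w = hybrid P (i - 1) v w + part P i (v - w)"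
  by (auto simp: hybrid_def part_def vec_eq_iff)

lemma part_hybrid: "part P i (hybrid P j v w) = (if i \<le> j then part P i v else part P i w)"
  by (auto simp: hybrid_def part_def vec_eq_iff)

lemma part_splice:
  "part P j (splice P i a z b) = (if j < i then part P j a else if j = i then part P j z else part P j b)"
  by (auto simp: splice_def part_def vec_eq_iff)

lemma norm_hybrid_diff_le: "norm (v - hybrid P i v w) \<le> norm (v - w)"
  by (intro norm_le_componentwise_cart) (simp add: hybrid_def)

locale block_problem =
  fixes P :: "('n::finite, 'm::finite) problem" and L :: real
  assumes assms_P: "problem_assms P L"
begin

abbreviation N where "N \<equiv> nblocks P"
abbreviation blocks where "blocks \<equiv> {1..<nblocks P}"

lemma N_ge_2: "N \<ge> 2" and range_blk: "range (blk P) = blocks" and L_pos: "L > 0"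
  and grad_lipschitz: "L-lipschitz_on UNIV (grad (obj P))"
  using assms_P unfolding problem_assms_def by blast+

lemma block_assms:
  assumes "i \<in> blocks"
  shows "reg P i u = reg P i (part P i u)" "locally_lipschitz (reg P i)"
    "manifold P i \<subseteq> blkspace P i" "embedded_submanifold (manifold P i)"
    "bdd_below (reg P i ` feasible_block P i)"
proof -
  have *: "(\<forall>u. reg P i u = reg P i (part P i u)) \<and> locally_lipschitz (reg P i) \<and>
      manifold P i \<subseteq> blkspace P i \<and> embedded_submanifold (manifold P i) \<and>
      bdd_below (reg P i ` feasible_block P i)"
    using assms_P assms unfolding problem_assms_def by (elim conjE) (drule (1) bspec, elim conjE, intro conjI)
  then show "reg P i u = reg P i (part P i u)" "locally_lipschitz (reg P i)"
    "manifold P i \<subseteq> blkspace P i" "embedded_submanifold (manifold P i)"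
    by blast+
  show "bdd_below (reg P i ` feasible_block P i)" using * by (elim conjE)
qed

lemma blk_in: "blk P p \<in> blocks"
  using range_blk by auto

lemma sum_part: "(\<Sum>i\<in>blocks. part P i v) = v"
  using blk_in by (auto simp: vec_eq_iff part_def sum.delta)

lemma sum_norm_part: "(\<Sum>i\<in>blocks. (norm (part P i v))\<^sup>2) = (norm v)\<^sup>2"
proof -
  have "(\<Sum>i\<in>blocks. (norm (part P i v))\<^sup>2) = v \<bullet> (\<Sum>i\<in>blocks. part P i v)"
    by (simp add: inner_sum_right power2_norm_eq_inner inner_part_same)
  then show ?thesis by (simp add: sum_part power2_norm_eq_inner)
qed

lemma sum_colblock: "(\<Sum>i\<in>blocks. colblock P i *v part P i v) = conmat P *v v"
proof -
  have "(\<Sum>i\<in>blocks. colblock P i *v part P i v) = conmat P *v (\<Sum>i\<in>blocks. part P i v)"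
    by (simp add: colblock_mult part_part linear_sum[OF matrix_vector_mul_linear])
  then show ?thesis by (simp add: sum_part)
qed

lemma residual_eq: "residual P (u, y) = conmat P *v u + y - rhs P"
  by (simp add: residual_def sum_colblock)

lemma residual_diff: "residual P (u, y) - residual P (v, z) = conmat P *v (u - v) + (y - z)"
  by (simp add: residual_eq matrix_vector_mult_diff_distrib)

lemma hybrid_last: "hybrid P (N - 1) v w = v"
  and hybrid_first: "hybrid P 0 v w = w"
proof -
  have "blk P p \<le> N - 1" "\<not> blk P p \<le> 0" for p using blk_in[of p] by auto
  then show "hybrid P (N - 1) v w = v" "hybrid P 0 v w = w"
    by (simp_all add: hybrid_def vec_eq_iff) (metis less_irrefl)
qed

definition step_sq :: "(nat \<Rightarrow> real^'n) \<Rightarrow> (nat \<Rightarrow> real^'m) \<Rightarrow> nat \<Rightarrow> real" where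
  "step_sq u y k = (norm (u (Suc k) - u k))\<^sup>2 + (norm (y (Suc k) - y k))\<^sup>2"

lemma theta_eq: "k \<ge> 1 \<Longrightarrow> theta P u y k = step_sq u y k + step_sq u y (k - 1)"
  by (simp add: theta_def step_sq_def sum.distrib sum_norm_part norm_minus_commute Suc_eq_plus1 flip: part_diff)

text \<open>The adjoint of the derivative applied to 1 is the Riesz representative; uniqueness makes
  the definite description in \<open>grad\<close> denote it.\<close>

lemma obj_gderiv: "GDERIV (obj P) x :> grad (obj P) x"
proof -
  have "obj P differentiable (at x)" using assms_P unfolding problem_assms_def by blast
  then obtain D where D: "(obj P has_derivative D) (at x)" unfolding differentiable_def by blast
  then have lin: "linear D" by (rule has_derivative_linear)
  have "D h = h \<bullet> adjoint D 1" for h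
    using adjoint_works[OF lin, of h 1] by (simp add: inner_commute)
  then have "GDERIV (obj P) x :> adjoint D 1"
    using D unfolding gderiv_def by (metis (no_types, lifting) ext)
  then show ?thesis
    unfolding grad_def
  proof (rule theI)
    fix g assume "GDERIV (obj P) x :> g"
    with \<open>GDERIV (obj P) x :> adjoint D 1\<close> have "(\<lambda>h. h \<bullet> g) = (\<lambda>h. h \<bullet> adjoint D 1)"
      unfolding gderiv_def by (rule has_derivative_unique[rotated])
    then show "g = adjoint D 1" by (metis vector_eq_ldot)
  qed
qed

lemma grad_norm_le: "norm (grad (obj P) x - grad (obj P) x') \<le> L * norm (x - x')"
  using lipschitz_onD[OF grad_lipschitz, of x x'] by (simp add: dist_norm)

lemma grad_block_norm_le: "norm (grad_block P i x - grad_block P i x') \<le> L * norm (x - x')"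
proof -
  have "norm (grad_block P i x - grad_block P i x') \<le> norm (fst (grad (obj P) x - grad (obj P) x'))"
    by (simp add: grad_block_def part_diff[symmetric] norm_part_le)
  also have "\<dots> \<le> norm (grad (obj P) x - grad (obj P) x')" 
    using norm_fst_le[of "fst z" "snd z" for z] by (metis prod.collapse)
  finally show ?thesis using grad_norm_le order_trans by blast
qed

lemma grad_last_norm_le: "norm (grad_last P x - grad_last P x') \<le> L * norm (x - x')"
proof -
  have "norm (grad_last P x - grad_last P x') \<le> norm (grad (obj P) x - grad (obj P) x')"
    unfolding grad_last_def using norm_snd_le by (metis prod.collapse snd_diff)
  then show ?thesis using grad_norm_le order_trans by blast
qed

lemma obj_descent_last:
  "obj P (u, y') \<le> obj P (u, y) + grad_last P (u, y) \<bullet> (y' - y) + L / 2 * (norm (y' - y))\<^sup>2"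
  using descent_lemma[OF obj_gderiv grad_lipschitz, of "(u, y')" "(u, y)"]
  by (simp add: grad_last_def norm_prod_def inner_prod_def)

lemma obj_descent_block:
  "obj P (u + part P i d, y) \<le> obj P (u, y) + grad_block P i (u, y) \<bullet> part P i d + L / 2 * (norm (part P i d))\<^sup>2"
  using descent_lemma[OF obj_gderiv grad_lipschitz, of "(u + part P i d, y)" "(u, y)"]
  by (simp add: grad_block_def inner_prod_def norm_prod_def inner_part_same)

end

section \<open>Iterations of the scheme\<close>

lemma sum_telescope_from_1:
  fixes a :: "nat \<Rightarrow> real"
  assumes "n \<ge> 1"
  shows "(\<Sum>i\<in>{1..<n}. a i - a (i - 1)) = a (n - 1) - a 0"
  using assms by (induction n rule: dec_induct) auto

context block_problem
begin

text \<open>The smooth part common to the exact and the linearized subproblems: multiplier term,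
  penalty and proximal term. Only the treatment of f differs between the algorithms.\<close>

lemma gderiv_coupling:
  assumes H: "transpose B = B"
  shows "GDERIV (\<lambda>z. - (residual P (splice P i a z b, y) \<bullet> lam)
      + \<beta> / 2 * (norm (residual P (splice P i a z b, y)))\<^sup>2 + 1/2 * ((z - w) \<bullet> (B *v (z - w)))) z
    :> transpose (colblock P i) *v (\<beta> *\<^sub>R residual P (splice P i a z b, y) - lam) + B *v (z - w)"
proof -
  define r0 where "r0 = residual P (splice P i a 0 b, y)"
  have res: "residual P (splice P i a z b, y) = r0 + colblock P i *v z" for z
    by (subst splice_affine) (simp add: residual_eq r0_def colblock_mult matrix_vector_right_distrib)
  have sym: "u \<bullet> (B *v v) = v \<bullet> (B *v u)" for u v
    using H by (metis dot_lmul_matrix inner_commute transpose_matrix_vector)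
  have dA: "((\<lambda>z. colblock P i *v z) has_derivative (\<lambda>h. colblock P i *v h)) (at z)"
    by (rule bounded_linear_imp_has_derivative) simp
  have dB: "((\<lambda>z. B *v (z - w)) has_derivative (\<lambda>h. B *v h)) (at z)"
    by (rule bounded_linear.has_derivative[of "(*v) B"]) (auto intro!: derivative_eq_intros)
  let ?A = "colblock P i" and ?r = "r0 + colblock P i *v z"
  have dr: "((\<lambda>z. r0 + ?A *v z) has_derivative (\<lambda>h. ?A *v h)) (at z)"
    using dA by (auto intro!: derivative_eq_intros)
  have dL: "((\<lambda>z. (r0 + ?A *v z) \<bullet> lam) has_derivative (\<lambda>h. (?A *v h) \<bullet> lam)) (at z)"
    by (rule has_derivative_inner_left[OF dr])
  have dR: "((\<lambda>z. (r0 + ?A *v z) \<bullet> (r0 + ?A *v z)) has_derivative (\<lambda>h. 2 * ((?A *v h) \<bullet> ?r))) (at z)"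
    by (rule has_derivative_eq_rhs[OF has_derivative_inner[OF dr dr]]) (simp add: fun_eq_iff inner_commute)
  have dw: "((\<lambda>z. z - w) has_derivative (\<lambda>h. h)) (at z)"
    by (auto intro!: derivative_eq_intros)
  have dQ: "((\<lambda>z. (z - w) \<bullet> (B *v (z - w))) has_derivative (\<lambda>h. 2 * (h \<bullet> (B *v (z - w))))) (at z)"
    by (rule has_derivative_eq_rhs[OF has_derivative_inner[OF dw dB]]) (simp only: fun_eq_iff sym[of "z - w"] mult_2 simp_thms)
  have "h \<bullet> (transpose ?A *v (\<beta> *\<^sub>R ?r - lam) + B *v (z - w)) =
      - ((?A *v h) \<bullet> lam) + \<beta> / 2 * (2 * ((?A *v h) \<bullet> ?r)) + 1/2 * (2 * (h \<bullet> (B *v (z - w))))" for h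
  proof -
    have "h \<bullet> (transpose ?A *v v) = (?A *v h) \<bullet> v" for v
      by (simp add: dot_lmul_matrix inner_commute[of h] inner_commute[of _ v])
    then show ?thesis by (simp add: inner_add_right inner_diff_right del: transpose_matrix_vector)
  qed
  then show ?thesis
    unfolding gderiv_def res power2_norm_eq_inner
    by (simp only:) (intro has_derivative_add has_derivative_minus has_derivative_mult_right dL dR dQ)
qed

lemma gderiv_obj_splice:
  "GDERIV (\<lambda>z. obj P (splice P i a z b, y)) z :> grad_block P i (splice P i a z b, y)"
proof -
  let ?x = "(splice P i a z b, y)"
  have dp: "((\<lambda>z. part P i z) has_derivative part P i) (at z)"
    by (intro linear_imp_has_derivative linearI) (simp_all add: part_add part_scaleR)
  have d: "((\<lambda>z. (splice P i a z b, y)) has_derivative (\<lambda>h. (part P i h, 0))) (at z)"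
    by (subst splice_affine) (auto intro!: derivative_eq_intros dp)
  have "(obj P has_derivative (\<lambda>h. h \<bullet> grad (obj P) ?x)) (at ?x)"
    using obj_gderiv by (simp add: gderiv_def)
  from has_derivative_compose[OF d this] show ?thesis
    by (simp add: gderiv_def grad_block_def inner_prod_def part_inner)
qed

text \<open>Isolates the summands independent of z, which cancel when two candidates for block i are
  compared.\<close>

lemma reg_splice:
  assumes "i \<in> blocks"
  shows "(\<Sum>j\<in>blocks. reg P j (part P j (splice P i a z b))) =
    reg P i z + (\<Sum>j\<in>blocks - {i}. reg P j (part P j (if j < i then a else b)))"
proof -
  have "(\<Sum>j\<in>blocks. reg P j (part P j (splice P i a z b))) =
      reg P i (part P i (splice P i a z b)) + (\<Sum>j\<in>blocks - {i}. reg P j (part P j (splice P i a z b)))"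
    using assms by (intro sum.remove) auto
  moreover have "(\<Sum>j\<in>blocks - {i}. reg P j (part P j (splice P i a z b))) =
      (\<Sum>j\<in>blocks - {i}. reg P j (part P j (if j < i then a else b)))"
    by (rule sum.cong) (auto simp: part_splice)
  ultimately show ?thesis using block_assms(1)[OF assms, of z] by (simp add: part_splice)
qed

text \<open>\<open>h\<close> is the smooth part of a subproblem and \<open>c\<close> its gradient at
  the minimizer. The point and multiplier of the stationarity test may differ from those of the
  subproblem; the gap is bounded by the mismatch of the gradients.\<close>

lemma block_gap_le:
  assumes i: "i \<in> blocks" and I1: "i \<in> I1 \<Longrightarrow> convex_on UNIV (reg P i)"
    and feas: "part P i u' \<in> feasible_block P i"
    and h: "GDERIV h (part P i u') :> c"
    and min: "\<And>z. z \<in> feasible_block P i \<Longrightarrow> h (part P i u') + reg P i (part P i u') \<le> h z + reg P i z"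
  shows "block_gap P I1 i (u', y') lam'
    \<le> ennreal (norm (- grad_block P i (u', y') + transpose (colblock P i) *v lam' + c))"
proof -
  let ?z = "part P i u'"
  have S: "feasible_block P i \<subseteq> manifold P i" by (simp add: feasible_block_def)
  note B = block_assms[OF i]
  obtain g where g: "g \<in> clarke_subdifferential (reg P i) ?z"
    and n: "closest_point (tangent_space (manifold P i) ?z) (- c - g)
      \<in> manifold_normal_cone (manifold P i) (feasible_block P i) ?z"
    by (rule first_order_condition[OF B(4) S feas B(2) h min])
  have "g \<in> subdiff P I1 i ?z"
    using g clarke_subdifferential_convex[OF B(2) I1, of ?z] by (auto simp: subdiff_def)
  from set_distance_projection_le[OF B(4) _ this n] show ?thesis
    using S feas by (auto simp: block_gap_def Let_def)
qed

definition Amax :: real where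
  "Amax = Max (insert ((spec_norm (mat 1 :: real^'m^'m))\<^sup>2) ((\<lambda>i. (spec_norm (colblock P i))\<^sup>2) ` blocks))"

lemma Amax_ge: "i \<in> blocks \<Longrightarrow> (spec_norm (colblock P i))\<^sup>2 \<le> Amax"
  unfolding Amax_def by (rule Max_ge) auto

text \<open>The contribution of A_N = I. It allows the change of x_N to carry the same factor
  \<open>sqrt Amax\<close> as the other blocks.\<close>

lemma Amax_ge_1: "Amax \<ge> 1"
proof -
  have "(spec_norm (mat 1 :: real^'m^'m))\<^sup>2 \<le> Amax"
    unfolding Amax_def by (rule Max_ge) auto
  then show ?thesis by (simp add: spec_norm_mat_1)
qed

lemma Hmax_ge: "i \<in> blocks \<Longrightarrow> spec_norm (H i) \<le> Max ((\<lambda>i. spec_norm (H i)) ` blocks)"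
  by (auto intro!: Max_ge)

lemma Q_const_eq:
  "Q_const P L \<beta> H = L + \<beta> * sqrt (real N) * Amax + Max ((\<lambda>i. spec_norm (H i)) ` blocks)"
  by (simp add: Q_const_def Amax_def)

lemma Q_const_pos:
  assumes "\<beta> > 0" shows "Q_const P L \<beta> H > 0"
proof -
  have "1 \<in> blocks" using N_ge_2 by simp
  then have "0 \<le> Max ((\<lambda>i. spec_norm (H i)) ` blocks)"
    using Hmax_ge[of 1 H] spec_norm_nonneg[of "H 1"] by linarith
  moreover have "0 \<le> \<beta> * sqrt (real N) * Amax" using assms Amax_ge_1 by simp
  ultimately show ?thesis using L_pos by (simp add: Q_const_eq)
qed

text \<open>Cauchy-Schwarz over the N blocks, with x_N as the last one. This is the origin of the
  factor sqrt N in \<open>Q_const\<close>.\<close>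

lemma sum_norm_part_le:
  "(\<Sum>j\<in>blocks. norm (part P j v)) + norm (w :: real^'m) \<le> sqrt (real N) * sqrt ((norm v)\<^sup>2 + (norm w)\<^sup>2)"
proof -
  define f where "f j = (if j = N then norm w else norm (part P j v))" for j
  have spl: "{1..N} = insert N blocks" using N_ge_2 by auto
  have s1: "(\<Sum>j\<in>{1..N}. f j) = (\<Sum>j\<in>blocks. norm (part P j v)) + norm w"
    unfolding spl by (simp add: f_def)
  have s2: "(\<Sum>j\<in>{1..N}. (f j)\<^sup>2) = (norm v)\<^sup>2 + (norm w)\<^sup>2"
    unfolding spl by (simp add: f_def sum_norm_part)
  have "(\<Sum>j\<in>{1..N}. f j)\<^sup>2 \<le> (\<Sum>j\<in>{1..N}. (f j)\<^sup>2) * real N"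
    using sum_squared_le_sum_of_squares[of f "{1..N}"] by simp
  then have "(\<Sum>j\<in>{1..N}. f j) \<le> sqrt (real N * ((norm v)\<^sup>2 + (norm w)\<^sup>2))"
    by (intro real_le_rsqrt) (simp add: s2 mult.commute)
  then show ?thesis by (simp add: s1 real_sqrt_mult)
qed

text \<open>One factor \<open>sqrt Amax\<close> comes from the transposed A_i, a second from the
  residual difference. Together with the proximal term they make up \<open>Q_const\<close> except
  for its summand L, which is reserved for the gradient of f.\<close>

lemma coupling_norm_le:
  assumes i: "i \<in> blocks" and \<beta>: "\<beta> > 0"
  shows "norm (transpose (colblock P i) *v (\<beta> *\<^sub>R (residual P (hybrid P i u' u, y) - residual P (u', y')))
      + H i *v (part P i u' - part P i u))
    \<le> (Q_const P L \<beta> H - L) * sqrt ((norm (u' - u))\<^sup>2 + (norm (y' - y))\<^sup>2)"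
proof -
  let ?D = "(norm (u' - u))\<^sup>2 + (norm (y' - y))\<^sup>2"
  have A0: "Amax \<ge> 0" using Amax_ge_1 by simp
  have a: "spec_norm (colblock P j) \<le> sqrt Amax" if "j \<in> blocks" for j
    using Amax_ge[OF that] by (rule real_le_rsqrt)
  have s1: "1 \<le> sqrt Amax" using Amax_ge_1 by simp
  \<comment> \<open>Its blocks up to i vanish and the later ones are negated steps, so each block is
    bounded by the corresponding block of the full step.\<close>
  define v where "v = hybrid P i u' u - u'"
  have v: "norm (part P j v) \<le> norm (part P j (u' - u))" for j
    by (auto simp: v_def part_diff part_hybrid norm_minus_commute)
  have "residual P (hybrid P i u' u, y) - residual P (u', y') = (\<Sum>j\<in>blocks. colblock P j *v part P j v) + (y - y')"
    by (simp add: residual_diff sum_colblock v_def)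
  also have "norm \<dots> \<le> (\<Sum>j\<in>blocks. norm (colblock P j *v part P j v)) + norm (y - y')"
    by (intro norm_triangle_le add_right_mono norm_sum)
  also have "\<dots> \<le> (\<Sum>j\<in>blocks. sqrt Amax * norm (part P j (u' - u))) + sqrt Amax * norm (y' - y)"
  proof (intro add_mono sum_mono)
    fix j assume j: "j \<in> blocks"
    have "norm (colblock P j *v part P j v) \<le> spec_norm (colblock P j) * norm (part P j v)"
      by (rule spec_norm_le)
    also have "\<dots> \<le> sqrt Amax * norm (part P j (u' - u))"
      by (intro mult_mono a j v) (use A0 in auto)
    finally show "norm (colblock P j *v part P j v) \<le> sqrt Amax * norm (part P j (u' - u))" .
  next
    show "norm (y - y') \<le> sqrt Amax * norm (y' - y)"
      using mult_right_mono[OF s1, of "norm (y' - y)"] by (simp add: norm_minus_commute)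
  qed
  also have "\<dots> = sqrt Amax * ((\<Sum>j\<in>blocks. norm (part P j (u' - u))) + norm (y' - y))"
    by (simp add: sum_distrib_left distrib_left)
  also have "\<dots> \<le> sqrt Amax * (sqrt (real N) * sqrt ?D)"
    by (intro mult_left_mono sum_norm_part_le) (use A0 in simp)
  finally have r: "norm (residual P (hybrid P i u' u, y) - residual P (u', y')) \<le> sqrt Amax * (sqrt (real N) * sqrt ?D)" .
  have "norm (transpose (colblock P i) *v (\<beta> *\<^sub>R (residual P (hybrid P i u' u, y) - residual P (u', y'))))
      \<le> spec_norm (colblock P i) * (\<beta> * norm (residual P (hybrid P i u' u, y) - residual P (u', y')))"
    using spec_norm_transpose_le[of "colblock P i" "\<beta> *\<^sub>R (residual P (hybrid P i u' u, y) - residual P (u', y'))"] \<beta> by simp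
  also have "\<dots> \<le> sqrt Amax * (\<beta> * (sqrt Amax * (sqrt (real N) * sqrt ?D)))"
    by (intro mult_mono a i r order.refl) (use \<beta> A0 in auto)
  also have "\<dots> = \<beta> * sqrt (real N) * Amax * sqrt ?D"
    using A0 by (simp add: algebra_simps flip: real_sqrt_mult_self power2_eq_square)
  finally have t1: "norm (transpose (colblock P i) *v (\<beta> *\<^sub>R (residual P (hybrid P i u' u, y) - residual P (u', y'))))
      \<le> \<beta> * sqrt (real N) * Amax * sqrt ?D" .
  have "norm (H i *v (part P i u' - part P i u)) \<le> spec_norm (H i) * norm (part P i u' - part P i u)"
    by (rule spec_norm_le)
  also have "\<dots> \<le> Max ((\<lambda>i. spec_norm (H i)) ` blocks) * sqrt ?D"
  proof (intro mult_mono Hmax_ge i)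
    have "norm (part P i u' - part P i u) \<le> norm (u' - u)" by (simp add: norm_part_le flip: part_diff)
    also have "\<dots> \<le> sqrt ?D" by (rule real_le_rsqrt) simp
    finally show "norm (part P i u' - part P i u) \<le> sqrt ?D" .
    show "0 \<le> Max ((\<lambda>i. spec_norm (H i)) ` blocks)"
      using Hmax_ge[OF i, of H] spec_norm_nonneg[of "H i"] by linarith
  qed simp
  finally have t2: "norm (H i *v (part P i u' - part P i u)) \<le> Max ((\<lambda>i. spec_norm (H i)) ` blocks) * sqrt ?D" .
  show ?thesis
    using norm_triangle_le[OF add_mono[OF t1 t2]] by (simp add: Q_const_eq algebra_simps)
qed

lemma hybrid_dist_le: "norm ((hybrid P i u' u, y) - (u', y')) \<le> sqrt ((norm (u' - u))\<^sup>2 + (norm (y' - y))\<^sup>2)"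
proof -
  have "norm (hybrid P i u' u - u') \<le> norm (u' - u)"
    using norm_hybrid_diff_le[of u' P i u] by (simp add: norm_minus_commute)
  then show ?thesis by (simp add: norm_prod_def norm_minus_commute power_mono)
qed

end

text \<open>
  \<open>\<l>\<close> is 0 for exact block minimization and \<open>L\<close> for the linearized models; \<open>e\<close> and \<open>eN\<close> are the errors
  of the gradients used for the blocks and for \<open>x_N\<close>.
\<close>

locale admm_run = block_problem P L for P :: "('n::finite, 'm::finite) problem" and L +
  fixes I1 :: "nat set" and \<beta> \<gamma> \<l> :: real and H :: "nat \<Rightarrow> real^'n^'n"
    and e :: "nat \<Rightarrow> nat \<Rightarrow> real^'n" and eN :: "nat \<Rightarrow> real^'m"
    and u :: "nat \<Rightarrow> real^'n" and y lam :: "nat \<Rightarrow> real^'m"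
  assumes \<beta>_pos: "\<beta> > 0" and \<gamma>_pos: "\<gamma> > 0"
    and feasible: "\<And>k i. i \<in> blocks \<Longrightarrow> part P i (u k) \<in> feasible_block P i"
    and block_descent: "\<And>k. aug_lagrangian P \<beta> (u (Suc k), y k) (lam k) \<le>
      aug_lagrangian P \<beta> (u k, y k) (lam k) +
      (\<Sum>i\<in>blocks. \<l> / 2 * (norm (part P i (u (Suc k) - u k)))\<^sup>2
         + norm (e k i) * norm (part P i (u (Suc k) - u k))
         - 1/2 * (part P i (u (Suc k) - u k) \<bullet> (H i *v part P i (u (Suc k) - u k))))"
    and y_step: "\<And>k. y (Suc k) =
      y k - \<gamma> *\<^sub>R (grad_last P (u (Suc k), y k) + eN k - lam k + \<beta> *\<^sub>R residual P (u (Suc k), y k))"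
    and lam_step: "\<And>k. lam (Suc k) = lam k - \<beta> *\<^sub>R residual P (u (Suc k), y (Suc k))"
    and block_gap_bound: "\<And>k i. i \<in> blocks \<Longrightarrow>
      block_gap P I1 i (u (Suc k), y (Suc k)) (lam (Suc k))
        \<le> ennreal (Q_const P L \<beta> H * sqrt (step_sq u y k) + norm (e k i))"

section \<open>Each algorithm as an instance of the abstract run\<close>

context block_problem
begin

lemma scheme_feasible:
  assumes "scheme P \<beta> \<gamma> H model d u y lam" "i \<in> blocks"
  shows "part P i (u k) \<in> feasible_block P i"
proof (cases k)
  case (Suc k')
  then show ?thesis using assms unfolding scheme_def is_arg_min_def by blast
qed (use assms in \<open>auto simp: scheme_def\<close>)

lemma scheme_minimizer:
  assumes "scheme P \<beta> \<gamma> H model d u y lam" "i \<in> blocks" "z \<in> feasible_block P i"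
  shows "model k i (part P i (u (Suc k)))
      + 1/2 * ((part P i (u (Suc k)) - part P i (u k)) \<bullet> (H i *v (part P i (u (Suc k)) - part P i (u k))))
    \<le> model k i z + 1/2 * ((z - part P i (u k)) \<bullet> (H i *v (z - part P i (u k))))"
  using assms unfolding scheme_def is_arg_min_linorder by blast

text \<open>Testing the minimality of block i against its old value compares hybrids i and i - 1, so
  the N - 1 inequalities telescope. As the model contains f itself, there is neither a linearization
  loss nor a gradient error.\<close>

lemma admm_run_algorithm1:
  assumes \<beta>: "\<beta> > 0" and \<gamma>: "\<gamma> > 0" and I1: "\<And>i. i \<in> I1 \<Longrightarrow> convex_on UNIV (reg P i)"
    and H: "\<And>i. i \<in> blocks \<Longrightarrow> transpose (H i) = H i"
    and alg: "algorithm1 P \<beta> \<gamma> H u y lam"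
  shows "admm_run P L I1 \<beta> \<gamma> 0 H (\<lambda>_ _. 0) (\<lambda>_. 0) u y lam"
proof
  note sch = alg[unfolded algorithm1_def]
  note min = scheme_minimizer[OF sch]
  show feas: "part P i (u k) \<in> feasible_block P i" if "i \<in> blocks" for k i
    by (rule scheme_feasible[OF sch that])
  show "y (Suc k) = y k - \<gamma> *\<^sub>R (grad_last P (u (Suc k), y k) + 0 - lam k + \<beta> *\<^sub>R residual P (u (Suc k), y k))"
    and lam: "lam (Suc k) = lam k - \<beta> *\<^sub>R residual P (u (Suc k), y (Suc k))" for k
    using sch unfolding scheme_def by simp_all
  show "aug_lagrangian P \<beta> (u (Suc k), y k) (lam k) \<le> aug_lagrangian P \<beta> (u k, y k) (lam k) +
      (\<Sum>i\<in>blocks. 0 / 2 * (norm (part P i (u (Suc k) - u k)))\<^sup>2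
         + norm (0 :: real^'n) * norm (part P i (u (Suc k) - u k))
         - 1/2 * (part P i (u (Suc k) - u k) \<bullet> (H i *v part P i (u (Suc k) - u k))))" for k
  proof -
    define a where "a i = aug_lagrangian P \<beta> (hybrid P i (u (Suc k)) (u k), y k) (lam k)" for i
    have "a i - a (i - 1) \<le> - 1/2 * (part P i (u (Suc k) - u k) \<bullet> (H i *v part P i (u (Suc k) - u k)))"
      if i: "i \<in> blocks" for i
      using min[OF i feas[OF i, of k], of k] i by (simp add: splice_hybrid a_def part_diff)
    then have "(\<Sum>i\<in>blocks. a i - a (i - 1)) \<le>
        (\<Sum>i\<in>blocks. - 1/2 * (part P i (u (Suc k) - u k) \<bullet> (H i *v part P i (u (Suc k) - u k))))"
      by (rule sum_mono)
    then show ?thesis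
      using sum_telescope_from_1[of N a] N_ge_2 by (simp add: a_def hybrid_last hybrid_first)
  qed
  show "block_gap P I1 i (u (Suc k), y (Suc k)) (lam (Suc k))
      \<le> ennreal (Q_const P L \<beta> H * sqrt (step_sq u y k) + norm (0 :: real^'n))" if i: "i \<in> blocks" for k i
  proof -
    let ?u' = "u (Suc k)" and ?y' = "y (Suc k)"
    \<comment> \<open>The optimality condition is evaluated after the update of block i, with all
      later blocks and x_N still old.\<close>
    define x where "x = (hybrid P i ?u' (u k), y k)"
    define h where "h = (\<lambda>z. obj P (splice P i ?u' z (u k), y k) +
      (- (residual P (splice P i ?u' z (u k), y k) \<bullet> lam k)
      + \<beta> / 2 * (norm (residual P (splice P i ?u' z (u k), y k)))\<^sup>2
      + 1/2 * ((z - part P i (u k)) \<bullet> (H i *v (z - part P i (u k))))))"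
    have deriv: "GDERIV h (part P i ?u') :> grad_block P i x +
        (transpose (colblock P i) *v (\<beta> *\<^sub>R residual P x - lam k) + H i *v (part P i ?u' - part P i (u k)))"
      unfolding h_def x_def splice_hybrid(2)[symmetric]
      by (rule GDERIV_add[OF gderiv_obj_splice gderiv_coupling[OF H[OF i]]])
    have "block_gap P I1 i (?u', ?y') (lam (Suc k))
      \<le> ennreal (norm (- grad_block P i (?u', ?y') + transpose (colblock P i) *v lam (Suc k) + (grad_block P i x +
        (transpose (colblock P i) *v (\<beta> *\<^sub>R residual P x - lam k) + H i *v (part P i ?u' - part P i (u k))))))"
    proof (rule block_gap_le[OF i _ feas[OF i] deriv])
      show "convex_on UNIV (reg P i)" if "i \<in> I1" using that by (rule I1)
    next
      fix z assume z: "z \<in> feasible_block P i"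
      show "h (part P i ?u') + reg P i (part P i ?u') \<le> h z + reg P i z"
        using min[OF i z, of k] by (simp add: aug_lagrangian_def h_def reg_splice[OF i] del: part_diff)
    qed
    \<comment> \<open>The multiplier update turns \<lambda>^{k+1} - \<lambda>^k into - \<beta> times
      the new residual, so only a difference of residuals remains.\<close>
    also have "- grad_block P i (?u', ?y') + transpose (colblock P i) *v lam (Suc k) + (grad_block P i x +
        (transpose (colblock P i) *v (\<beta> *\<^sub>R residual P x - lam k) + H i *v (part P i ?u' - part P i (u k))))
      = (grad_block P i x - grad_block P i (?u', ?y')) +
        (transpose (colblock P i) *v (\<beta> *\<^sub>R (residual P x - residual P (?u', ?y'))) + H i *v (part P i ?u' - part P i (u k)))"
      by (simp add: lam matrix_vector_mult_diff_distrib scaleR_diff_right del: transpose_matrix_vector)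
    also have "norm \<dots> \<le> L * sqrt (step_sq u y k) + (Q_const P L \<beta> H - L) * sqrt (step_sq u y k)"
      unfolding x_def step_sq_def
      by (intro norm_triangle_le add_mono coupling_norm_le[OF i \<beta>]
            order_trans[OF grad_block_norm_le mult_left_mono[OF hybrid_dist_le]]) (use L_pos in simp)
    finally show ?thesis by (simp add: algebra_simps ennreal_leI)
  qed
qed (use \<beta> \<gamma> in auto)

text \<open>Serves Algorithm 2 with zero errors and Algorithm 3 along one sample path.\<close>

lemma admm_run_Phi:
  assumes \<beta>: "\<beta> > 0" and \<gamma>: "\<gamma> > 0" and I1: "\<And>i. i \<in> I1 \<Longrightarrow> convex_on UNIV (reg P i)"
    and H: "\<And>i. i \<in> blocks \<Longrightarrow> transpose (H i) = H i"
    and sch: "scheme P \<beta> \<gamma> H (\<lambda>k i z. Phi P \<beta> i z (query P u y k i) (lam k) (d k i)) dN u y lam"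
    and d: "\<And>k i. i \<in> blocks \<Longrightarrow> d k i = grad_block P i (query P u y k i) + e k i"
    and dN: "\<And>k. dN k = grad_last P (u (Suc k), y k) + eN k"
  shows "admm_run P L I1 \<beta> \<gamma> L H e eN u y lam"
proof
  note min = scheme_minimizer[OF sch]
  show feas: "part P i (u k) \<in> feasible_block P i" if "i \<in> blocks" for k i
    by (rule scheme_feasible[OF sch that])
  show "y (Suc k) = y k - \<gamma> *\<^sub>R (grad_last P (u (Suc k), y k) + eN k - lam k + \<beta> *\<^sub>R residual P (u (Suc k), y k))"
    and lam: "lam (Suc k) = lam k - \<beta> *\<^sub>R residual P (u (Suc k), y (Suc k))" for k
    using sch dN unfolding scheme_def by simp_all
  define x where "x k i = (hybrid P (i - 1) (u (Suc k)) (u k), y k)" for k i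
  have query: "query P u y k i = x k i" if "i \<in> blocks" for k i
    using that by (simp add: query_def splice_hybrid x_def)
  have part_x: "part P i (fst (x k i)) = part P i (u k)" if "i \<in> blocks" for k i
  proof -
    have "\<not> i \<le> i - 1" using that by (simp; linarith)
    then show ?thesis by (simp add: x_def part_hybrid)
  qed
  have splice_x: "splice P i (fst (x k i)) z (fst (x k i)) = splice P i (u (Suc k)) z (u k)"
    if "i \<in> blocks" for k i z
    using that splice_splice[of P i "u (Suc k)" "u k" z] by (simp add: x_def splice_hybrid)
  have snd_x: "snd (x k i) = y k" for k i by (simp add: x_def)
  define g where "g k i z = - (residual P (splice P i (u (Suc k)) z (u k), y k) \<bullet> lam k)
      + \<beta> / 2 * (norm (residual P (splice P i (u (Suc k)) z (u k), y k)))\<^sup>2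
      + 1/2 * ((z - part P i (u k)) \<bullet> (H i *v (z - part P i (u k))))" for k i z
  have min': "d k i \<bullet> part P i (u (Suc k)) + reg P i (part P i (u (Suc k))) + g k i (part P i (u (Suc k)))
      \<le> d k i \<bullet> z + reg P i z + g k i z" if "i \<in> blocks" "z \<in> feasible_block P i" for k i z
    using min[OF that, of k]
    by (simp add: query[OF that(1)] Phi_def Let_def splice_x[OF that(1)] part_x[OF that(1)] snd_x g_def inner_diff_right)
  show "aug_lagrangian P \<beta> (u (Suc k), y k) (lam k) \<le> aug_lagrangian P \<beta> (u k, y k) (lam k) +
      (\<Sum>i\<in>blocks. L / 2 * (norm (part P i (u (Suc k) - u k)))\<^sup>2
         + norm (e k i) * norm (part P i (u (Suc k) - u k))
         - 1/2 * (part P i (u (Suc k) - u k) \<bullet> (H i *v part P i (u (Suc k) - u k))))" for k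
  proof -
    define a where "a i = aug_lagrangian P \<beta> (hybrid P i (u (Suc k)) (u k), y k) (lam k)" for i
    have "a i - a (i - 1) \<le> L / 2 * (norm (part P i (u (Suc k) - u k)))\<^sup>2
         + norm (e k i) * norm (part P i (u (Suc k) - u k))
         - 1/2 * (part P i (u (Suc k) - u k) \<bullet> (H i *v part P i (u (Suc k) - u k)))"
      if i: "i \<in> blocks" for i
    proof -
      have i1: "i \<ge> 1" using i by simp
      let ?d = "part P i (u (Suc k) - u k)"
      have a1: "a i = obj P (hybrid P i (u (Suc k)) (u k), y k) + reg P i (part P i (u (Suc k)))
          + (\<Sum>j\<in>blocks - {i}. reg P j (part P j (if j < i then u (Suc k) else u k)))
          + g k i (part P i (u (Suc k))) - 1/2 * (?d \<bullet> (H i *v ?d))"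
        unfolding a_def aug_lagrangian_def splice_hybrid(2)[symmetric] fst_conv reg_splice[OF i] g_def
        by (simp add: part_diff)
      have a2: "a (i - 1) = obj P (x k i) + reg P i (part P i (u k))
          + (\<Sum>j\<in>blocks - {i}. reg P j (part P j (if j < i then u (Suc k) else u k)))
          + g k i (part P i (u k))"
        unfolding a_def aug_lagrangian_def splice_hybrid(4)[OF i1, symmetric] fst_conv reg_splice[OF i] g_def x_def
        by simp
      \<comment> \<open>The linear model is exchanged for f itself at the price of L/2 times the
        squared block step; this is the linearization loss L of the run.\<close>
      have o: "obj P (hybrid P i (u (Suc k)) (u k), y k) \<le> obj P (x k i) + grad_block P i (x k i) \<bullet> ?d + L / 2 * (norm ?d)\<^sup>2"
        unfolding x_def hybrid_diff[OF i1] by (rule obj_descent_block)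
      have "grad_block P i (x k i) = d k i - e k i" using d[OF i] by (simp add: query[OF i])
      then have "grad_block P i (x k i) \<bullet> ?d = d k i \<bullet> part P i (u (Suc k)) - d k i \<bullet> part P i (u k) + (- e k i) \<bullet> ?d"
        by (simp add: part_diff inner_diff_left inner_diff_right)
      moreover have "(- e k i) \<bullet> ?d \<le> norm (e k i) * norm ?d"
        using norm_cauchy_schwarz[of "- e k i" ?d] by simp
      ultimately show ?thesis using a1 a2 o min'[OF i feas[OF i, of k], of k] by linarith
    qed
    then have "(\<Sum>i\<in>blocks. a i - a (i - 1)) \<le>
        (\<Sum>i\<in>blocks. L / 2 * (norm (part P i (u (Suc k) - u k)))\<^sup>2
         + norm (e k i) * norm (part P i (u (Suc k) - u k))
         - 1/2 * (part P i (u (Suc k) - u k) \<bullet> (H i *v part P i (u (Suc k) - u k))))"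
      by (rule sum_mono)
    then show ?thesis
      using sum_telescope_from_1[of N a] N_ge_2 by (simp add: a_def hybrid_last hybrid_first)
  qed
  show "block_gap P I1 i (u (Suc k), y (Suc k)) (lam (Suc k))
      \<le> ennreal (Q_const P L \<beta> H * sqrt (step_sq u y k) + norm (e k i))" if i: "i \<in> blocks" for k i
  proof -
    let ?u' = "u (Suc k)" and ?y' = "y (Suc k)" and ?A = "colblock P i"
    \<comment> \<open>Two points occur: the gradient of f was taken before the update of block i, at
      \<open>x k i\<close>, but the residual is differentiated at the updated point.\<close>
    define x' where "x' = (hybrid P i ?u' (u k), y k)"
    define q where "q = (\<beta> *\<^sub>R residual P x' - lam k)"
    have "GDERIV (g k i) (part P i ?u') :> (transpose ?A *v q + H i *v (part P i ?u' - part P i (u k)))"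
      unfolding g_def q_def x'_def splice_hybrid(2)[symmetric] by (rule gderiv_coupling[OF H[OF i]])
    moreover have "GDERIV (\<lambda>z. d k i \<bullet> z) (part P i ?u') :> d k i"
      by (auto simp: gderiv_def inner_commute intro!: derivative_eq_intros)
    ultimately have deriv: "GDERIV (\<lambda>z. d k i \<bullet> z + g k i z) (part P i ?u') :>
        d k i + (transpose ?A *v q + H i *v (part P i ?u' - part P i (u k)))"
      by (intro GDERIV_add)
    have "block_gap P I1 i (?u', ?y') (lam (Suc k))
      \<le> ennreal (norm (- grad_block P i (?u', ?y') + transpose ?A *v lam (Suc k) + (d k i +
        (transpose ?A *v q + H i *v (part P i ?u' - part P i (u k))))))"
    proof (rule block_gap_le[OF i _ feas[OF i] deriv])
      show "convex_on UNIV (reg P i)" if "i \<in> I1" using that by (rule I1)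
    next
      fix z assume z: "z \<in> feasible_block P i"
      show "d k i \<bullet> part P i ?u' + g k i (part P i ?u') + reg P i (part P i ?u') \<le> d k i \<bullet> z + g k i z + reg P i z"
        using min'[OF i z, of k] by linarith
    qed
    also have "- grad_block P i (?u', ?y') + transpose ?A *v lam (Suc k) + (d k i +
        (transpose ?A *v q + H i *v (part P i ?u' - part P i (u k))))
      = ((grad_block P i (x k i) - grad_block P i (?u', ?y')) +
        (transpose ?A *v (\<beta> *\<^sub>R (residual P x' - residual P (?u', ?y'))) + H i *v (part P i ?u' - part P i (u k))))
        + e k i"
      by (simp add: lam q_def d[OF i] query[OF i] matrix_vector_mult_diff_distrib scaleR_diff_right del: transpose_matrix_vector)
    also have "norm \<dots> \<le> (L * sqrt (step_sq u y k) + (Q_const P L \<beta> H - L) * sqrt (step_sq u y k)) + norm (e k i)"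
      unfolding x_def x'_def step_sq_def
      by (intro norm_triangle_le add_mono coupling_norm_le[OF i \<beta>] order.refl
            order_trans[OF grad_block_norm_le mult_left_mono[OF hybrid_dist_le]]) (use L_pos in simp)
    finally show ?thesis by (simp add: algebra_simps ennreal_leI)
  qed
qed (use \<beta> \<gamma> in auto)

end

section \<open>The energy inequality\<close>

lemma square_sum3_le: "(a + b + c)\<^sup>2 \<le> 3 * (a\<^sup>2 + b\<^sup>2 + (c::real)\<^sup>2)"
proof -
  have "0 \<le> (a - b)\<^sup>2 + (a - c)\<^sup>2 + (b - c)\<^sup>2" by simp
  then show ?thesis by (simp add: power2_eq_square algebra_simps)
qed

lemma square_sum4_le: "(a + b + c + d)\<^sup>2 \<le> 4 * (a\<^sup>2 + b\<^sup>2 + c\<^sup>2 + (d::real)\<^sup>2)"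
proof -
  have "0 \<le> (a - b)\<^sup>2 + (a - c)\<^sup>2 + (b - c)\<^sup>2 + (a - d)\<^sup>2 + (b - d)\<^sup>2 + (c - d)\<^sup>2" by simp
  then show ?thesis by (simp add: power2_eq_square algebra_simps)
qed

lemma weighted_am_gm:
  fixes a b w :: real
  assumes "w > 0"
  shows "a * b \<le> w / 4 * a\<^sup>2 + b\<^sup>2 / w"
proof -
  have "0 \<le> (w / 2 * a - b)\<^sup>2 / w" using assms by simp
  also have "\<dots> = w / 4 * a\<^sup>2 + b\<^sup>2 / w - a * b"
    using assms by (simp add: power2_eq_square field_simps)
  finally show ?thesis by simp
qed

text \<open>
  Averaging only over the disjoint pairs \<open>(2j, 2j - 1)\<close> counts every step once, so that the noise
  term comes out as \<open>2\<nu>\<close> without a correction of order \<open>1/K\<close>.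
\<close>

lemma min_consecutive_pair_le:
  fixes D :: "nat \<Rightarrow> real"
  assumes sum: "\<And>n. \<tau> * (\<Sum>k\<in>{1..n}. D k) \<le> C + real n * \<nu>"
    and min: "\<And>k. k \<in> {2..K + 1} \<Longrightarrow> D ks + D (ks - 1) \<le> D k + D (k - 1)"
    and K: "K \<ge> 1" and C: "C \<ge> 0" and \<tau>: "\<tau> > 0"
  shows "\<tau> * (D ks + D (ks - 1)) \<le> 2 * C / real K + 2 * \<nu>"
proof -
  define m where "m = (K + 1) div 2"
  have m: "m \<ge> 1" "2 * m \<le> K + 1" "real K \<le> 2 * real m" using K by (auto simp: m_def)
  have pairs: "(\<Sum>j\<in>{1..n}. D (2 * j) + D (2 * j - 1)) = (\<Sum>k\<in>{1..2 * n}. D k)" for n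
    by (induction n) (simp_all add: algebra_simps)
  have "real m * (D ks + D (ks - 1)) = (\<Sum>j\<in>{1..m}. D ks + D (ks - 1))" by simp
  also have "\<dots> \<le> (\<Sum>j\<in>{1..m}. D (2 * j) + D (2 * j - 1))"
    using m by (intro sum_mono min) auto
  also have "\<dots> = (\<Sum>k\<in>{1..2 * m}. D k)" by (rule pairs)
  finally have "\<tau> * (real m * (D ks + D (ks - 1))) \<le> \<tau> * (\<Sum>k\<in>{1..2 * m}. D k)"
    using \<tau> by simp
  also have "\<dots> \<le> C + real (2 * m) * \<nu>" by (rule sum)
  finally have "\<tau> * (D ks + D (ks - 1)) \<le> C / real m + 2 * \<nu>"
    using m(1) by (simp add: field_simps)
  moreover have "C / real m \<le> 2 * C / real K"
    using mult_right_mono[OF m(3) C] m(1) K by (simp add: field_simps)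
  ultimately show ?thesis by simp
qed

text \<open>Taking reciprocals, the interval for \<gamma> says that q / \<gamma> is within sqrt
  \<Delta> of A. The assumption \<Delta> < A^2 keeps the denominator A - sqrt \<Delta>
  positive.\<close>

lemma quadratic_from_interval:
  fixes A q \<Delta> \<gamma> :: real
  assumes "0 \<le> \<Delta>" "\<Delta> < A\<^sup>2" "0 < A" "0 < q" "q / (A + sqrt \<Delta>) < \<gamma>" "\<gamma> < q / (A - sqrt \<Delta>)"
  shows "\<gamma> > 0" "(q / \<gamma> - A)\<^sup>2 < \<Delta>"
proof -
  have lt: "sqrt \<Delta> < A" using assms(1-3) by (simp add: real_less_lsqrt)
  have pos: "A + sqrt \<Delta> > 0" using assms by (simp add: add_pos_nonneg)
  then have "0 < q / (A + sqrt \<Delta>)" using assms(4) by simp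
  with assms(5) show g: "\<gamma> > 0" by linarith
  have "q / \<gamma> - A < sqrt \<Delta>" "- (sqrt \<Delta>) < q / \<gamma> - A"
    using assms(5,6) g pos lt by (simp_all add: field_simps)
  then have "\<bar>q / \<gamma> - A\<bar> < \<bar>sqrt \<Delta>\<bar>" by linarith
  then show "(q / \<gamma> - A)\<^sup>2 < \<Delta>"
    using assms(1) by (metis abs_le_square_iff linorder_not_less real_sqrt_pow2)
qed

context admm_run
begin

abbreviation s where "s \<equiv> \<beta> - 1 / \<gamma>"

lemma lam_eq: "lam (Suc k) = grad_last P (u (Suc k), y k) + eN k + s *\<^sub>R (y k - y (Suc k))"
proof -
  have r: "residual P (u (Suc k), y (Suc k)) = residual P (u (Suc k), y k) + (y (Suc k) - y k)"
    by (simp add: residual_eq)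
  have "(1 / \<gamma>) *\<^sub>R (y k - y (Suc k)) = grad_last P (u (Suc k), y k) + eN k - lam k + \<beta> *\<^sub>R residual P (u (Suc k), y k)"
    using y_step[of k] \<gamma>_pos by simp
  then have lam_k: "lam k = grad_last P (u (Suc k), y k) + eN k + \<beta> *\<^sub>R residual P (u (Suc k), y k) - (1 / \<gamma>) *\<^sub>R (y k - y (Suc k))"
    by simp
  show ?thesis unfolding lam_step[of k] r by (subst lam_k) (simp add: algebra_simps)
qed

lemma residual_lam: "residual P (u (Suc k), y (Suc k)) = (1 / \<beta>) *\<^sub>R (lam k - lam (Suc k))"
  using lam_step[of k] \<beta>_pos by simp

text \<open>Two consecutive instances of \<open>lam_eq\<close> are subtracted. As that formula says
  nothing about \<lambda> at index 0, the indices start at \<open>Suc j\<close>.\<close>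

lemma lam_diff_norm_le:
  "norm (lam (Suc (Suc j)) - lam (Suc j)) \<le>
    \<bar>s\<bar> * norm (y (Suc (Suc j)) - y (Suc j)) + \<bar>s\<bar> * norm (y (Suc j) - y j)
    + L * sqrt ((norm (u (Suc (Suc j)) - u (Suc j)))\<^sup>2 + (norm (y (Suc j) - y j))\<^sup>2)
    + norm (eN (Suc j) - eN j)"
proof -
  let ?g = "grad_last P (u (Suc (Suc j)), y (Suc j)) - grad_last P (u (Suc j), y j)"
  have "lam (Suc (Suc j)) - lam (Suc j) = (- s) *\<^sub>R (y (Suc (Suc j)) - y (Suc j)) + s *\<^sub>R (y (Suc j) - y j)
      + ?g + (eN (Suc j) - eN j)"
    by (simp add: lam_eq algebra_simps)
  also have "norm \<dots> \<le> norm ((- s) *\<^sub>R (y (Suc (Suc j)) - y (Suc j))) + norm (s *\<^sub>R (y (Suc j) - y j))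
      + norm ?g + norm (eN (Suc j) - eN j)"
    by (intro norm_triangle_le add_mono order.refl)
  also have "norm ?g \<le> L * sqrt ((norm (u (Suc (Suc j)) - u (Suc j)))\<^sup>2 + (norm (y (Suc j) - y j))\<^sup>2)"
    using grad_last_norm_le[of "(u (Suc (Suc j)), y (Suc j))" "(u (Suc j), y j)"] by (simp add: norm_prod_def)
  finally show ?thesis by (simp only: norm_scaleR abs_minus_cancel)
qed

text \<open>The coefficient collects \<beta>/2 from the penalty, L/2 from the descent lemma and
  -1/\<gamma> from the gradient step, whose equation is paired with the increment of x_N. The
  multiplier and mixed residual terms cancel.\<close>

lemma last_descent:
  "aug_lagrangian P \<beta> (u (Suc k), y (Suc k)) (lam k) \<le> aug_lagrangian P \<beta> (u (Suc k), y k) (lam k)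
    + ((\<beta> + L) / 2 - 1 / \<gamma>) * (norm (y (Suc k) - y k))\<^sup>2 - eN k \<bullet> (y (Suc k) - y k)"
proof -
  define dy where "dy = y (Suc k) - y k"
  define r where "r = residual P (u (Suc k), y k)"
  have r': "residual P (u (Suc k), y (Suc k)) = r + dy"
    by (simp add: residual_eq r_def dy_def)
  have "grad_last P (u (Suc k), y k) + eN k - lam k + \<beta> *\<^sub>R r = (- (1 / \<gamma>)) *\<^sub>R dy"
    using y_step[of k] \<gamma>_pos by (simp add: dy_def r_def)
  then have "grad_last P (u (Suc k), y k) = (- (1 / \<gamma>)) *\<^sub>R dy - eN k + lam k - \<beta> *\<^sub>R r" by (simp add: algebra_simps)
  then have g: "grad_last P (u (Suc k), y k) \<bullet> dy = - (1 / \<gamma>) * (norm dy)\<^sup>2 - eN k \<bullet> dy + lam k \<bullet> dy - \<beta> * (r \<bullet> dy)"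
    by (simp add: inner_diff_left inner_add_left power2_norm_eq_inner)
  have "(norm (r + dy))\<^sup>2 = (norm r)\<^sup>2 + 2 * (r \<bullet> dy) + (norm dy)\<^sup>2"
    by (simp add: power2_norm_eq_inner inner_add_left inner_add_right inner_commute)
  then have n: "\<beta> / 2 * (norm (r + dy))\<^sup>2 = \<beta> / 2 * (norm r)\<^sup>2 + \<beta> * (r \<bullet> dy) + \<beta> / 2 * (norm dy)\<^sup>2"
    by (simp add: algebra_simps)
  have o: "obj P (u (Suc k), y (Suc k)) \<le> obj P (u (Suc k), y k) + grad_last P (u (Suc k), y k) \<bullet> dy + L / 2 * (norm dy)\<^sup>2"
    unfolding dy_def by (rule obj_descent_last)
  show ?thesis
    unfolding aug_lagrangian_def fst_conv r' r_def[symmetric] dy_def[symmetric] n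
    using o g by (simp add: inner_add_left inner_commute[of _ "lam k"] algebra_simps add_divide_distrib)
qed

lemma lam_ascent:
  "aug_lagrangian P \<beta> (u (Suc k), y (Suc k)) (lam (Suc k)) =
   aug_lagrangian P \<beta> (u (Suc k), y (Suc k)) (lam k) + 1 / \<beta> * (norm (lam (Suc k) - lam k))\<^sup>2"
proof -
  have "residual P (u (Suc k), y (Suc k)) \<bullet> (lam k - lam (Suc k)) = 1 / \<beta> * (norm (lam (Suc k) - lam k))\<^sup>2"
    by (simp add: residual_lam power2_norm_eq_inner inner_diff_left inner_diff_right algebra_simps)
  then show ?thesis by (simp add: aug_lagrangian_def inner_diff_right)
qed

lemma grad_last_gap_le:
  "norm (grad_last P (u (Suc k), y (Suc k)) - lam (Suc k)) \<le>
    L * norm (y (Suc k) - y k) + \<bar>s\<bar> * norm (y (Suc k) - y k) + norm (eN k)"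
proof -
  let ?g = "grad_last P (u (Suc k), y (Suc k)) - grad_last P (u (Suc k), y k)"
  have "grad_last P (u (Suc k), y (Suc k)) - lam (Suc k) = ?g + s *\<^sub>R (y (Suc k) - y k) + (- eN k)"
    by (simp add: lam_eq algebra_simps)
  also have "norm \<dots> \<le> norm ?g + norm (s *\<^sub>R (y (Suc k) - y k)) + norm (- eN k)"
    by (intro norm_triangle_le add_mono order.refl)
  also have "norm ?g \<le> L * norm (y (Suc k) - y k)"
    using grad_last_norm_le[of "(u (Suc k), y (Suc k))" "(u (Suc k), y k)"] by (simp add: norm_prod_def)
  finally show ?thesis by simp
qed

lemma obj_opt_le: "obj_opt P \<le> obj P (u k, z)"
proof -
  have "(u k, z) \<in> obj_domain P" using feasible by (auto simp: obj_domain_def)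
  moreover have "bdd_below (obj P ` obj_domain P)" using assms_P by (simp add: problem_assms_def)
  ultimately show ?thesis unfolding obj_opt_def by (intro cInf_lower) auto
qed

lemma reg_opt_le: "i \<in> blocks \<Longrightarrow> reg_opt P i \<le> reg P i (part P i (u k))"
  unfolding reg_opt_def using feasible block_assms(5) by (intro cInf_lower) auto

text \<open>f is bounded below at x_N - r rather than at x_N. The descent lemma then produces
  <grad_N f, r>, which combines with - <\<lambda>, r> to the small quantity <grad_N f - \<lambda>,
  r>. The descent lemma costs L/2 of the penalty coefficient \<beta>/2.\<close>

lemma aug_lagrangian_lower:
  "obj_opt P + (\<Sum>i\<in>blocks. reg_opt P i) + (\<beta> - L) / 2 * (norm (residual P (u (Suc j), y (Suc j))))\<^sup>2
    - norm (residual P (u (Suc j), y (Suc j))) * (L * norm (y (Suc j) - y j))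
    - norm (residual P (u (Suc j), y (Suc j))) * (\<bar>s\<bar> * norm (y (Suc j) - y j))
    - norm (residual P (u (Suc j), y (Suc j))) * norm (eN j)
   \<le> aug_lagrangian P \<beta> (u (Suc j), y (Suc j)) (lam (Suc j))"
proof -
  let ?x = "(u (Suc j), y (Suc j))"
  define r where "r = residual P ?x"
  define g where "g = grad_last P ?x - lam (Suc j)"
  have "obj_opt P \<le> obj P (u (Suc j), y (Suc j) - r)" by (rule obj_opt_le)
  also have "\<dots> \<le> obj P ?x - grad_last P ?x \<bullet> r + L / 2 * (norm r)\<^sup>2"
    using obj_descent_last[of "u (Suc j)" "y (Suc j) - r" "y (Suc j)"] by simp
  finally have o: "obj_opt P + grad_last P ?x \<bullet> r - L / 2 * (norm r)\<^sup>2 \<le> obj P ?x" by simp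
  have R: "(\<Sum>i\<in>blocks. reg_opt P i) \<le> (\<Sum>i\<in>blocks. reg P i (part P i (u (Suc j))))"
    by (intro sum_mono reg_opt_le)
  have "- (g \<bullet> r) \<le> norm g * norm r" using norm_cauchy_schwarz[of "- g" r] by simp
  also have "\<dots> \<le> (L * norm (y (Suc j) - y j) + \<bar>s\<bar> * norm (y (Suc j) - y j) + norm (eN j)) * norm r"
    unfolding g_def by (intro mult_right_mono grad_last_gap_le) simp
  finally have "- (grad_last P ?x \<bullet> r - lam (Suc j) \<bullet> r) \<le> \<dots>" by (simp add: g_def inner_diff_left)
  then show ?thesis
    using o R by (simp add: aug_lagrangian_def r_def[symmetric] inner_commute algebra_simps diff_divide_distrib)
qed

text \<open>Completing the square in the residual. Unlike the sharper bound it admits any multiplier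
  and any x_N, so it applies in the middle of an iteration and at iteration 0; it supplies
  integrable lower bounds.\<close>

lemma aug_lagrangian_lower_crude:
  "obj_opt P + (\<Sum>i\<in>blocks. reg_opt P i) - (norm l)\<^sup>2 / (2 * \<beta>) \<le> aug_lagrangian P \<beta> (u j, z) l"
proof -
  define r where "r = residual P (u j, z)"
  have R: "(\<Sum>i\<in>blocks. reg_opt P i) \<le> (\<Sum>i\<in>blocks. reg P i (part P i (u j)))"
    by (intro sum_mono reg_opt_le)
  have "r \<bullet> l \<le> norm r * norm l" by (rule norm_cauchy_schwarz)
  also have "\<dots> \<le> \<beta> / 2 * (norm r)\<^sup>2 + (norm l)\<^sup>2 / (2 * \<beta>)"
    using weighted_am_gm[of "2 * \<beta>" "norm r" "norm l"] \<beta>_pos by simp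
  finally show ?thesis
    using obj_opt_le[of j z] R by (simp add: aug_lagrangian_def r_def[symmetric])
qed

end

text \<open>
  \<open>c = 3\<close>, \<open>\<omega> = 0\<close> is the deterministic setting, \<open>c = 4\<close>, \<open>\<omega> = 1\<close> the one with gradient errors.
\<close>

locale admm_energy = admm_run P L I1 \<beta> \<gamma> \<l> H e eN u y lam
  for P :: "('n::finite, 'm::finite) problem" and L I1 \<beta> \<gamma> \<l> H e eN u y lam +
  fixes c \<omega> \<tau> :: real
  assumes mode: "(c = 3 \<and> \<omega> = 0 \<and> (\<forall>k i. e k i = 0) \<and> (\<forall>k. eN k = 0)) \<or> (c = 4 \<and> \<omega> = 1)"
    and H_lower: "\<And>i v. i \<in> {1..<nblocks P} \<Longrightarrow> v \<in> blkspace P i \<Longrightarrow>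
        (\<tau> + c * L\<^sup>2 / \<beta> + (\<l> + \<omega>) / 2) * (v \<bullet> v) \<le> 1/2 * (v \<bullet> (H i *v v))"
    and \<tau>_le: "\<tau> \<le> - ((\<beta> + L) / 2 - 1 / \<gamma> + 2 * c / \<beta> * (\<beta> - 1 / \<gamma>)\<^sup>2 + c * L\<^sup>2 / \<beta> + \<omega> / 2)"
    and \<tau>_pos: "\<tau> > 0" and \<beta>_ge: "\<beta> \<ge> 2 * L"
begin

abbreviation dist_y where "dist_y k \<equiv> (norm (y (Suc k) - y k))\<^sup>2"
abbreviation dist_u where "dist_u k \<equiv> (norm (u (Suc k) - u k))\<^sup>2"

text \<open>\<open>Psi_G\<close> for c = 3 and \<open>Psi_S\<close> for c = 4, with the previous x_N
  as third argument; used for k \<ge> 1.\<close>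

definition energy :: "nat \<Rightarrow> real" where
  "energy k = aug_lagrangian P \<beta> (u k, y k) (lam k) + c / \<beta> * (s\<^sup>2 + L\<^sup>2) * (norm (y (k - 1) - y k))\<^sup>2"

text \<open>The terms with \<omega> / 2 arise from separating errors and steps by Young's
  inequality, the last one from the multiplier difference.\<close>

definition energy_noise :: "nat \<Rightarrow> real" where
  "energy_noise k = \<omega> / 2 * ((\<Sum>i\<in>blocks. (norm (e k i))\<^sup>2) + (norm (eN k))\<^sup>2)
     + c / \<beta> * (norm (eN k - eN (k - 1)))\<^sup>2"

definition opt_value :: real where
  "opt_value = obj_opt P + (\<Sum>i\<in>blocks. reg_opt P i)"

lemma c_pos: "c > 0" using mode by auto

lemma lam_diff_sq_le:
  "(norm (lam (Suc (Suc j)) - lam (Suc j)))\<^sup>2 \<le>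
    c * (s\<^sup>2 * dist_y (Suc j) + (s\<^sup>2 + L\<^sup>2) * dist_y j + L\<^sup>2 * dist_u (Suc j) + (norm (eN (Suc j) - eN j))\<^sup>2)"
proof -
  define p q r t where "p = \<bar>s\<bar> * norm (y (Suc (Suc j)) - y (Suc j))" and "q = \<bar>s\<bar> * norm (y (Suc j) - y j)"
    and "r = L * sqrt (dist_u (Suc j) + dist_y j)" and "t = norm (eN (Suc j) - eN j)"
  have sq: "p\<^sup>2 = s\<^sup>2 * dist_y (Suc j)" "q\<^sup>2 = s\<^sup>2 * dist_y j" "r\<^sup>2 = L\<^sup>2 * (dist_u (Suc j) + dist_y j)"
    by (simp_all add: p_def q_def r_def power_mult_distrib)
  have "norm (lam (Suc (Suc j)) - lam (Suc j)) \<le> p + q + r + t"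
    using lam_diff_norm_le[of j] by (simp add: p_def q_def r_def t_def)
  then have "(norm (lam (Suc (Suc j)) - lam (Suc j)))\<^sup>2 \<le> (p + q + r + t)\<^sup>2"
    by (intro power_mono) auto
  \<comment> \<open>The factor c is the number of nonzero summands: without gradient errors
    \<open>t\<close> is 0 and three remain.\<close>
  also have "\<dots> \<le> c * (p\<^sup>2 + q\<^sup>2 + r\<^sup>2 + t\<^sup>2)"
    using mode square_sum3_le[of p q r] square_sum4_le[of p q r t] by (auto simp: t_def)
  finally show ?thesis by (simp add: sq t_def algebra_simps)
qed

text \<open>Half of the squared step from Young's inequality and the linearization loss are both
  absorbed by \<open>H_lower\<close>. The surplus c L^2 / \<beta> is kept to pay for the multiplier
  step.\<close>

lemma block_descent_rate:
  "aug_lagrangian P \<beta> (u (Suc k), y k) (lam k) \<le> aug_lagrangian P \<beta> (u k, y k) (lam k)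
     + \<omega> / 2 * (\<Sum>i\<in>blocks. (norm (e k i))\<^sup>2) - (\<tau> + c * L\<^sup>2 / \<beta>) * dist_u k"
proof -
  have "(\<Sum>i\<in>blocks. \<l> / 2 * (norm (part P i (u (Suc k) - u k)))\<^sup>2
         + norm (e k i) * norm (part P i (u (Suc k) - u k))
         - 1/2 * (part P i (u (Suc k) - u k) \<bullet> (H i *v part P i (u (Suc k) - u k))))
      \<le> \<omega> / 2 * (\<Sum>i\<in>blocks. (norm (e k i))\<^sup>2) - (\<tau> + c * L\<^sup>2 / \<beta>) * dist_u k"
  proof -
    have "(\<Sum>i\<in>blocks. \<l> / 2 * (norm (part P i (u (Suc k) - u k)))\<^sup>2
         + norm (e k i) * norm (part P i (u (Suc k) - u k))
         - 1/2 * (part P i (u (Suc k) - u k) \<bullet> (H i *v part P i (u (Suc k) - u k))))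
      \<le> (\<Sum>i\<in>blocks. \<omega> / 2 * (norm (e k i))\<^sup>2 - (\<tau> + c * L\<^sup>2 / \<beta>) * (norm (part P i (u (Suc k) - u k)))\<^sup>2)"
    proof (rule sum_mono)
      fix i assume i: "i \<in> blocks"
      define d where "d = part P i (u (Suc k) - u k)"
      have h: "(\<tau> + c * L\<^sup>2 / \<beta> + (\<l> + \<omega>) / 2) * (norm d)\<^sup>2 \<le> 1/2 * (d \<bullet> (H i *v d))"
        using H_lower[OF i, of d] by (simp add: d_def part_in_blkspace power2_norm_eq_inner)
      have "0 \<le> (norm (e k i) - norm d)\<^sup>2" by simp
      then have "norm (e k i) * norm d \<le> 1/2 * (norm (e k i))\<^sup>2 + 1/2 * (norm d)\<^sup>2"
        by (simp add: power2_eq_square algebra_simps)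
      then have "norm (e k i) * norm d \<le> \<omega> / 2 * (norm (e k i))\<^sup>2 + \<omega> / 2 * (norm d)\<^sup>2"
        using mode by auto
      with h show "\<l> / 2 * (norm d)\<^sup>2 + norm (e k i) * norm d - 1/2 * (d \<bullet> (H i *v d))
          \<le> \<omega> / 2 * (norm (e k i))\<^sup>2 - (\<tau> + c * L\<^sup>2 / \<beta>) * (norm d)\<^sup>2"
        by (simp add: algebra_simps add_divide_distrib)
    qed
    also have "\<dots> = \<omega> / 2 * (\<Sum>i\<in>blocks. (norm (e k i))\<^sup>2) - (\<tau> + c * L\<^sup>2 / \<beta>) * dist_u k"
      by (simp only: sum_subtractf sum_norm_part sum_distrib_left[symmetric])
    finally show ?thesis .
  qed
  then show ?thesis using block_descent[of k] by linarith
qed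

text \<open>Bookkeeping of the multiplier increase: its part in the previous step of x_N cancels the
  old correction term, and its part in the block step uses the surplus of
  \<open>block_descent_rate\<close>. The current step of x_N bears both the multiplier increase and
  the new correction, hence the coefficient 2c / \<beta> in \<open>\<tau>_le\<close>.\<close>

lemma energy_descent:
  assumes "k \<ge> 1"
  shows "energy (Suc k) \<le> energy k - \<tau> * step_sq u y k + energy_noise k"
proof -
  obtain j where k: "k = Suc j" using assms by (cases k) auto
  define E where "E = (\<Sum>i\<in>blocks. (norm (e k i))\<^sup>2)"
  define \<Lambda> where "\<Lambda> = (norm (lam (Suc k) - lam k))\<^sup>2"
  have noise: "- (eN k \<bullet> (y (Suc k) - y k)) \<le> \<omega> / 2 * (norm (eN k))\<^sup>2 + \<omega> / 2 * dist_y k"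
  proof -
    have "0 \<le> (norm (eN k + (y (Suc k) - y k)))\<^sup>2" by simp
    then have "- (eN k \<bullet> (y (Suc k) - y k)) \<le> 1 / 2 * (norm (eN k))\<^sup>2 + 1 / 2 * dist_y k"
      unfolding power2_norm_eq_inner by (simp add: inner_add_left inner_add_right inner_commute)
    then show ?thesis using mode by auto
  qed
  have \<Lambda>: "1 / \<beta> * \<Lambda> \<le> c / \<beta> * (s\<^sup>2 * dist_y k + (s\<^sup>2 + L\<^sup>2) * dist_y j + L\<^sup>2 * dist_u k + (norm (eN k - eN j))\<^sup>2)"
    using mult_left_mono[OF lam_diff_sq_le[of j], of "1 / \<beta>"] \<beta>_pos by (simp add: \<Lambda>_def k)
  have t: "\<tau> * dist_y k \<le> - ((\<beta> + L) / 2 - 1 / \<gamma> + 2 * c / \<beta> * s\<^sup>2 + c * L\<^sup>2 / \<beta> + \<omega> / 2) * dist_y k"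
    by (intro mult_right_mono \<tau>_le) simp
  have "aug_lagrangian P \<beta> (u (Suc k), y (Suc k)) (lam (Suc k)) \<le> aug_lagrangian P \<beta> (u k, y k) (lam k)
     + (\<omega> / 2 * E - (\<tau> + c * L\<^sup>2 / \<beta>) * dist_u k)
     + ((\<beta> + L) / 2 - 1 / \<gamma>) * dist_y k + (\<omega> / 2 * (norm (eN k))\<^sup>2 + \<omega> / 2 * dist_y k) + 1 / \<beta> * \<Lambda>"
    using lam_ascent[of k] last_descent[of k] block_descent_rate[of k] noise by (simp add: \<Lambda>_def E_def)
  then show ?thesis
    using \<Lambda> t unfolding energy_def energy_noise_def step_sq_def E_def[symmetric]
    by (simp add: k norm_minus_commute[of "y (Suc j)" "y (Suc (Suc j))"] norm_minus_commute[of "y j" "y (Suc j)"] algebra_simps add_divide_distrib)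
qed

text \<open>Young's inequality with weights chosen so that the correction term pays exactly for the
  two products with the step of x_N. The squared residual needed is at most \<beta>/4, which
  (\<beta> - L)/2 covers because \<beta> \<ge> 2 L. The error term left over is the source of 2
  \<sigma>^2 / \<beta> in the stochastic iteration count.\<close>

lemma energy_lower:
  assumes "k \<ge> 1"
  shows "opt_value - \<omega> * (2 / \<beta>) * (norm (eN (k - 1)))\<^sup>2 \<le> energy k"
proof -
  obtain j where k: "k = Suc j" using assms by (cases k) auto
  define r d where "r = norm (residual P (u k, y k))" and "d = norm (y k - y j)"
  have w: "4 * (\<beta> / (4 * c)) / 4 = \<beta> / (4 * c)" by simp
  have r0: "r \<ge> 0" by (simp add: r_def)
  have 1: "r * (L * d) \<le> \<beta> / (4 * c) * r\<^sup>2 + c / \<beta> * (L\<^sup>2 * d\<^sup>2)"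
    using weighted_am_gm[of "\<beta> / c" r "L * d"] \<beta>_pos c_pos by (simp add: power_mult_distrib field_simps)
  have 2: "r * (\<bar>s\<bar> * d) \<le> \<beta> / (4 * c) * r\<^sup>2 + c / \<beta> * (s\<^sup>2 * d\<^sup>2)"
    using weighted_am_gm[of "\<beta> / c" r "\<bar>s\<bar> * d"] \<beta>_pos c_pos by (simp add: power_mult_distrib mult.commute)
  have 3: "r * norm (eN j) \<le> \<beta> / 8 * r\<^sup>2 + 2 / \<beta> * (norm (eN j))\<^sup>2"
    using weighted_am_gm[of "\<beta> / 2" r "norm (eN j)"] \<beta>_pos by (simp add: mult.commute)
  have 4: "r * norm (eN j) \<le> \<omega> * (\<beta> / 8 * r\<^sup>2) + \<omega> * (2 / \<beta>) * (norm (eN j))\<^sup>2"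
    using mode 3 by auto
  have "\<beta> / (4 * c) + \<beta> / (4 * c) + \<omega> * (\<beta> / 8) \<le> (\<beta> - L) / 2"
    using mode \<beta>_ge \<beta>_pos by auto
  then have 5: "(\<beta> / (4 * c) + \<beta> / (4 * c) + \<omega> * (\<beta> / 8)) * r\<^sup>2 \<le> (\<beta> - L) / 2 * r\<^sup>2"
    by (rule mult_right_mono) simp
  have 6: "opt_value + (\<beta> - L) / 2 * r\<^sup>2 - r * (L * d) - r * (\<bar>s\<bar> * d) - r * norm (eN j)
      \<le> aug_lagrangian P \<beta> (u k, y k) (lam k)"
    using aug_lagrangian_lower[of j] by (simp add: k r_def d_def opt_value_def)
  have 7: "energy k = aug_lagrangian P \<beta> (u k, y k) (lam k) + (c / \<beta> * (s\<^sup>2 * d\<^sup>2) + c / \<beta> * (L\<^sup>2 * d\<^sup>2))"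
    by (simp add: energy_def k d_def norm_minus_commute algebra_simps)
  have 8: "(\<beta> / (4 * c) + \<beta> / (4 * c) + \<omega> * (\<beta> / 8)) * r\<^sup>2
      = \<beta> / (4 * c) * r\<^sup>2 + \<beta> / (4 * c) * r\<^sup>2 + \<omega> * (\<beta> / 8 * r\<^sup>2)" by (simp only: distrib_right mult.assoc)
  have j: "k - 1 = j" using k by simp
  show ?thesis unfolding j using 1 2 4 5[unfolded 8] 6 7 by linarith
qed

text \<open>The residual is a multiplier difference divided by \<beta>, so it involves two
  consecutive steps. This is why \<open>theta\<close> pairs them, and it is the origin of the
  constant \<kappa>_1.\<close>

lemma residual_sq_le:
  assumes "k \<ge> 1"
  shows "(norm (residual P (u (Suc k), y (Suc k))))\<^sup>2 \<le>
    c / \<beta>\<^sup>2 * (s\<^sup>2 + L\<^sup>2) * theta P u y k + c / \<beta>\<^sup>2 * (norm (eN k - eN (k - 1)))\<^sup>2"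
proof -
  obtain j where k: "k = Suc j" using assms by (cases k) auto
  have th: "theta P u y k = dist_u k + dist_y k + (dist_u j + dist_y j)"
    using theta_eq[OF assms, of u y] by (simp add: step_sq_def k)
  have "(norm (residual P (u (Suc k), y (Suc k))))\<^sup>2 = (norm (lam (Suc k) - lam k))\<^sup>2 / \<beta>\<^sup>2"
    using \<beta>_pos by (simp add: residual_lam power_mult_distrib norm_minus_commute power_divide)
  also have "\<dots> \<le> c * (s\<^sup>2 * dist_y k + (s\<^sup>2 + L\<^sup>2) * dist_y j + L\<^sup>2 * dist_u k + (norm (eN k - eN j))\<^sup>2) / \<beta>\<^sup>2"
    using lam_diff_sq_le[of j] by (intro divide_right_mono) (auto simp: k)
  also have "\<dots> \<le> c * ((s\<^sup>2 + L\<^sup>2) * theta P u y k + (norm (eN k - eN j))\<^sup>2) / \<beta>\<^sup>2"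
  proof (intro divide_right_mono mult_left_mono add_right_mono)
    have "0 \<le> L\<^sup>2 * dist_y k + s\<^sup>2 * dist_u k + (s\<^sup>2 + L\<^sup>2) * dist_u j" by simp
    then show "s\<^sup>2 * dist_y k + (s\<^sup>2 + L\<^sup>2) * dist_y j + L\<^sup>2 * dist_u k \<le> (s\<^sup>2 + L\<^sup>2) * theta P u y k"
      by (simp add: th algebra_simps)
  qed (use c_pos in auto)
  finally show ?thesis by (simp add: k algebra_simps add_divide_distrib)
qed

lemma step_sq_le_theta: "k \<ge> 1 \<Longrightarrow> step_sq u y k \<le> theta P u y k"
  by (simp add: theta_eq) (simp add: step_sq_def)

lemma dist_y_le_theta:
  assumes "k \<ge> 1" shows "dist_y k \<le> theta P u y k"
  using step_sq_le_theta[OF assms] zero_le_power2[of "norm (u (Suc k) - u k)"]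
  unfolding step_sq_def by linarith

lemma theta_nonneg:
  assumes "k \<ge> 1" shows "0 \<le> theta P u y k"
  using dist_y_le_theta[OF assms] zero_le_power2[of "norm (y (Suc k) - y k)"] by linarith

end

section \<open>The deterministic algorithms\<close>

text \<open>With t = 1/\<gamma>, multiplying the claimed inequality by 24 \<beta> turns it into (12
  t - 13 \<beta>)^2 < \<Delta>. The threshold for \<beta> is the positive root of \<Delta>, because
  13 \<Delta> = (13 \<beta> - 6 L)^2 - 972 L^2 and 972 is the square of 18 sqrt 3.\<close>

lemma stepsize_deterministic:
  fixes L \<beta> \<gamma> :: real
  assumes L: "L > 0" and \<beta>: "\<beta> > (6 + 18 * sqrt 3) / 13 * L"
    and \<gamma>: "12 / (13 * \<beta> + sqrt (13 * \<beta>\<^sup>2 - 12 * \<beta> * L - 72 * L\<^sup>2)) < \<gamma>"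
      "\<gamma> < 12 / (13 * \<beta> - sqrt (13 * \<beta>\<^sup>2 - 12 * \<beta> * L - 72 * L\<^sup>2))"
  shows "\<beta> \<ge> 2 * L" "\<gamma> > 0"
    "- ((\<beta> + L) / 2 - 1 / \<gamma> + 6 / \<beta> * (\<beta> - 1 / \<gamma>)\<^sup>2 + 3 * L\<^sup>2 / \<beta>) > 0"
proof -
  define \<Delta> where "\<Delta> = 13 * \<beta>\<^sup>2 - 12 * \<beta> * L - 72 * L\<^sup>2"
  \<comment> \<open>The value 10/9 makes 6 + 18 * 10/9 equal to 26, that is 2 * 13.\<close>
  have "10 / 9 \<le> sqrt 3" by (rule real_le_rsqrt) (simp add: power2_eq_square)
  then have "2 * L \<le> (6 + 18 * sqrt 3) / 13 * L" using L by (intro mult_right_mono) auto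
  with \<beta> show ge: "\<beta> \<ge> 2 * L" by simp
  have \<beta>0: "\<beta> > 0" using ge L by linarith
  have "18 * sqrt 3 * L < 13 * \<beta> - 6 * L" using \<beta> by (simp add: field_simps)
  then have "(18 * sqrt 3 * L)\<^sup>2 < (13 * \<beta> - 6 * L)\<^sup>2" using L by (intro power_strict_mono) auto
  moreover have sq: "(18 * sqrt 3 * L)\<^sup>2 = 972 * L\<^sup>2" by (simp add: power_mult_distrib)
  ultimately have "972 * L\<^sup>2 < (13 * \<beta> - 6 * L)\<^sup>2" by (simp only: sq)
  then have "13 * \<Delta> > 0" by (simp add: \<Delta>_def power2_eq_square algebra_simps)
  then have \<Delta>0: "\<Delta> \<ge> 0" by simp
  have "0 < 156 * \<beta>\<^sup>2 + 12 * \<beta> * L + 72 * L\<^sup>2" using \<beta>0 L by (intro add_pos_pos) auto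
  then have \<Delta>lt: "\<Delta> < (13 * \<beta>)\<^sup>2" by (simp add: \<Delta>_def power_mult_distrib)
  note q = quadratic_from_interval[OF \<Delta>0 \<Delta>lt _ _ \<gamma>[folded \<Delta>_def]]
  show g: "\<gamma> > 0" using q(1) \<beta>0 by simp
  define t where "t = 1 / \<gamma>"
  have "(12 * t - 13 * \<beta>)\<^sup>2 < \<Delta>" using q(2) \<beta>0 by (simp add: t_def)
  then have "((\<beta> + L) / 2 - t) * \<beta> + 6 * (\<beta> - t)\<^sup>2 + 3 * L\<^sup>2 < 0"
    by (simp add: \<Delta>_def power2_eq_square algebra_simps add_divide_distrib)
  then have "(((\<beta> + L) / 2 - t) * \<beta> + 6 * (\<beta> - t)\<^sup>2 + 3 * L\<^sup>2) / \<beta> < 0"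
    using \<beta>0 by (simp add: divide_less_0_iff)
  then show "- ((\<beta> + L) / 2 - 1 / \<gamma> + 6 / \<beta> * (\<beta> - 1 / \<gamma>)\<^sup>2 + 3 * L\<^sup>2 / \<beta>) > 0"
    using \<beta>0 by (simp add: t_def add_divide_distrib)
qed

text \<open>The same computation: multiplication by 32 \<beta> gives (16 t - 17 \<beta>)^2 <
  \<Delta>, and 17 \<Delta> = (17 \<beta> - 8 (L + 1))^2 - 64 ((L + 1)^2 + 34 L^2).\<close>

lemma stepsize_stochastic:
  fixes L \<beta> \<gamma> \<Delta> :: real
  assumes L: "L > 0" and \<Delta>: "\<Delta> = 17 * \<beta>\<^sup>2 - 16 * (L + 1) * \<beta> - 128 * L\<^sup>2"
    and \<beta>: "\<beta> > (8 * (L + 1) + 8 * sqrt ((L + 1)\<^sup>2 + 34 * L\<^sup>2)) / 17"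
    and \<gamma>: "16 / (17 * \<beta> + sqrt \<Delta>) < \<gamma>" "\<gamma> < 16 / (17 * \<beta> - sqrt \<Delta>)"
  shows "\<beta> \<ge> 2 * L" "\<gamma> > 0"
    "- ((\<beta> + L) / 2 - 1 / \<gamma> + 8 / \<beta> * (\<beta> - 1 / \<gamma>)\<^sup>2 + 4 * L\<^sup>2 / \<beta> + 1 / 2) > 0"
proof -
  define S where "S = sqrt ((L + 1)\<^sup>2 + 34 * L\<^sup>2)"
  have "5 * L \<le> S" unfolding S_def
    by (rule real_le_rsqrt) (use L in \<open>simp add: power2_eq_square algebra_simps\<close>)
  have \<beta>S: "\<beta> > (8 * (L + 1) + 8 * S) / 17" using \<beta> unfolding S_def .
  with \<open>5 * L \<le> S\<close> L show ge: "\<beta> \<ge> 2 * L" by simp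
  have \<beta>0: "\<beta> > 0" using ge L by linarith
  have S0: "S \<ge> 0" and S2: "S\<^sup>2 = (L + 1)\<^sup>2 + 34 * L\<^sup>2" by (simp_all add: S_def)
  have "8 * S < 17 * \<beta> - 8 * (L + 1)" using \<beta>S by simp
  then have "(8 * S)\<^sup>2 < (17 * \<beta> - 8 * (L + 1))\<^sup>2" using S0 by (intro power_strict_mono) auto
  then have "17 * \<Delta> > 0"
    by (simp only: power_mult_distrib S2) (simp add: \<Delta> power2_eq_square algebra_simps)
  then have \<Delta>0: "\<Delta> \<ge> 0" by simp
  have "0 < 272 * \<beta>\<^sup>2 + 16 * (L + 1) * \<beta> + 128 * L\<^sup>2" using \<beta>0 L by (intro add_pos_pos) auto
  then have \<Delta>lt: "\<Delta> < (17 * \<beta>)\<^sup>2" by (simp add: \<Delta> power_mult_distrib)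
  note q = quadratic_from_interval[OF \<Delta>0 \<Delta>lt _ _ \<gamma>]
  show g: "\<gamma> > 0" using q(1) \<beta>0 by simp
  define t where "t = 1 / \<gamma>"
  have "(16 * t - 17 * \<beta>)\<^sup>2 < \<Delta>" using q(2) \<beta>0 by (simp add: t_def)
  then have "((\<beta> + L) / 2 - t + 1 / 2) * \<beta> + 8 * (\<beta> - t)\<^sup>2 + 4 * L\<^sup>2 < 0"
    by (simp add: \<Delta> power2_eq_square algebra_simps add_divide_distrib)
  then have "(((\<beta> + L) / 2 - t + 1 / 2) * \<beta> + 8 * (\<beta> - t)\<^sup>2 + 4 * L\<^sup>2) / \<beta> < 0"
    using \<beta>0 by (simp add: divide_less_0_iff)
  then show "- ((\<beta> + L) / 2 - 1 / \<gamma> + 8 / \<beta> * (\<beta> - 1 / \<gamma>)\<^sup>2 + 4 * L\<^sup>2 / \<beta> + 1 / 2) > 0"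
    using \<beta>0 by (simp add: t_def add_divide_distrib)
qed

text \<open>\<delta> stands for the linearization loss plus the share given to gradient errors: 0, L
  or L + 1 in the three algorithms. The matrix bound is twice what \<open>\<tau>\<close> subtracts
  from half the smallest singular value, so the rate is positive.\<close>

lemma (in block_problem) decrease_rate_bounds:
  fixes H :: "nat \<Rightarrow> real^'n^'n"
  assumes H: "\<And>i. i \<in> blocks \<Longrightarrow> sym_block_matrix P i (H i) \<and> block_succ P i (H i) (2 * c * L\<^sup>2 / \<beta> + \<delta>)"
    and pos: "\<beta> > 0" "c > 0" "\<delta> \<ge> 0" "A > 0"
    and \<tau>: "\<tau> = min A (Min ((\<lambda>i. sigma_min P i (H i) / 2 - c * L\<^sup>2 / \<beta> - \<delta> / 2) ` blocks))"
  shows "\<tau> > 0" "\<tau> \<le> A"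
    "\<And>i v. i \<in> blocks \<Longrightarrow> v \<in> blkspace P i \<Longrightarrow> (\<tau> + c * L\<^sup>2 / \<beta> + \<delta> / 2) * (v \<bullet> v) \<le> 1/2 * (v \<bullet> (H i *v v))"
proof -
  have c0: "0 \<le> 2 * c * L\<^sup>2 / \<beta> + \<delta>" using pos by simp
  note sm = sigma_min_bounds[OF _ _ c0]
  have fin: "finite ((\<lambda>i. sigma_min P i (H i) / 2 - c * L\<^sup>2 / \<beta> - \<delta> / 2) ` blocks)" by simp
  have ne: "(\<lambda>i. sigma_min P i (H i) / 2 - c * L\<^sup>2 / \<beta> - \<delta> / 2) ` blocks \<noteq> {}" using N_ge_2 by auto
  have "0 < sigma_min P i (H i) / 2 - c * L\<^sup>2 / \<beta> - \<delta> / 2" if "i \<in> blocks" for i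
    using sm(1)[where P = P and i = i and B = "H i"] H[OF that] that range_blk by auto
  then show "\<tau> > 0" using pos by (simp add: \<tau> Min_gr_iff[OF fin ne])
  show "\<tau> \<le> A" by (simp add: \<tau>)
  show "(\<tau> + c * L\<^sup>2 / \<beta> + \<delta> / 2) * (v \<bullet> v) \<le> 1/2 * (v \<bullet> (H i *v v))" if i: "i \<in> blocks" "v \<in> blkspace P i" for i v
  proof -
    have "\<tau> \<le> sigma_min P i (H i) / 2 - c * L\<^sup>2 / \<beta> - \<delta> / 2"
      unfolding \<tau> by (rule min.coboundedI2, rule Min_le[OF fin]) (use i in simp)
    then have "(\<tau> + c * L\<^sup>2 / \<beta> + \<delta> / 2) * (v \<bullet> v) \<le> sigma_min P i (H i) / 2 * (v \<bullet> v)"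
      by (intro mult_right_mono) auto
    also have "\<dots> \<le> 1/2 * (v \<bullet> (H i *v v))"
      using sm(2)[where P = P and i = i and B = "H i" and v = v] H[OF i(1)] i range_blk by auto
    finally show ?thesis .
  qed
qed

text \<open>\<open>nat\<close> truncates negative values to 0. An index in {2..K + 1} exists only if
  K \<ge> 1, and then the ceiling is positive and so is C; no separate comparison of initial energy
  and optimal value is required.\<close>

lemma ceiling_iterations:
  assumes "K = nat \<lceil>a * C\<rceil>" "K \<ge> 1" "a > 0"
  shows "C \<ge> 0" "C / real K \<le> 1 / (a::real)"
proof -
  have "\<lceil>a * C\<rceil> \<ge> 1" using assms by linarith
  then have "a * C > 0" by linarith
  then show "C \<ge> 0" using assms(3) by (simp add: zero_less_mult_iff)
  have "a * C \<le> real K" using assms by linarith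
  then show "C / real K \<le> 1 / a" using assms(2,3) by (simp add: field_simps)
qed

context admm_energy
begin

lemma energy_sum:
  "\<tau> * (\<Sum>k\<in>{1..n}. step_sq u y k) \<le> energy 1 - energy (Suc n) + (\<Sum>k\<in>{1..n}. energy_noise k)"
proof (induction n)
  case (Suc n)
  show ?case using Suc energy_descent[of "Suc n"] by (simp add: distrib_left)
qed (simp add: One_nat_def)

text \<open>The three members of the maximum are the factors by which \<open>theta\<close> bounds
  the squared constraint violation, the squared gap in x_N and the squared block gaps.\<close>

lemma eps_stationary_deterministic:
  assumes \<omega>: "\<omega> = 0" and \<epsilon>: "\<epsilon> > 0"
    and K: "K = nat \<lceil>2 * Max {c / \<beta>\<^sup>2 * (s\<^sup>2 + L\<^sup>2), (\<bar>s\<bar> + L)\<^sup>2, (Q_const P L \<beta> H)\<^sup>2} / (\<tau> * \<epsilon>\<^sup>2) * (energy 1 - opt_value)\<rceil>"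
    and ks: "is_arg_min (theta P u y) (\<lambda>k. k \<in> {2..K + 1}) ks"
  shows "eps_stationary P I1 \<epsilon> (u (ks + 1), y (ks + 1)) (lam (ks + 1))"
proof -
  define \<kappa> where "\<kappa> = Max {c / \<beta>\<^sup>2 * (s\<^sup>2 + L\<^sup>2), (\<bar>s\<bar> + L)\<^sup>2, (Q_const P L \<beta> H)\<^sup>2}"
  have \<kappa>: "c / \<beta>\<^sup>2 * (s\<^sup>2 + L\<^sup>2) \<le> \<kappa>" "(\<bar>s\<bar> + L)\<^sup>2 \<le> \<kappa>" "(Q_const P L \<beta> H)\<^sup>2 \<le> \<kappa>"
    unfolding \<kappa>_def by (rule Max_ge; simp)+
  have \<kappa>0: "\<kappa> > 0" using \<kappa>(3) Q_const_pos[OF \<beta>_pos, of H] by (meson less_le_trans zero_less_power)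
  have no1: "eN k = 0" "e k i = 0" for k i
    using mode \<omega> by auto
  have no: "eN k = 0" "e k i = 0" "energy_noise k = 0" for k i
    by (simp_all add: energy_noise_def no1)
  have ks2: "ks \<in> {2..K + 1}" using ks by (simp add: is_arg_min_def)
  then have ks1: "ks \<ge> 1" and K1: "K \<ge> 1" by auto
  have min: "theta P u y ks \<le> theta P u y k" if "k \<in> {2..K + 1}" for k
    using ks that by (auto simp: is_arg_min_linorder)
  define C where "C = energy 1 - opt_value"
  have a: "2 * \<kappa> / (\<tau> * \<epsilon>\<^sup>2) > 0" using \<kappa>0 \<tau>_pos \<epsilon> by simp
  note C = ceiling_iterations[OF K[folded \<kappa>_def C_def] K1 a]
  have sum: "\<tau> * (\<Sum>k\<in>{1..n}. step_sq u y k) \<le> C + real n * 0" for n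
  proof -
    have "opt_value \<le> energy (Suc n)" using energy_lower[of "Suc n"] by (simp add: no1)
    moreover have "(\<Sum>k\<in>{1..n}. energy_noise k) = 0" by (simp only: no sum.neutral_const)
    ultimately show ?thesis using energy_sum[of n] by (simp add: C_def)
  qed
  have "\<tau> * (step_sq u y ks + step_sq u y (ks - 1)) \<le> 2 * C / real K + 2 * 0"
  \<comment> \<open>Averaging with noise level 0; the factor 2 in K is used up by grouping the steps
    into disjoint pairs.\<close>
  proof (rule min_consecutive_pair_le[OF sum _ K1 C(1) \<tau>_pos])
    fix k assume "k \<in> {2..K + 1}"
    then show "step_sq u y ks + step_sq u y (ks - 1) \<le> step_sq u y k + step_sq u y (k - 1)"
      using min[of k] ks1 by (simp add: theta_eq)
  qed
  then have "\<tau> * theta P u y ks \<le> 2 * (C / real K)" using ks1 by (simp add: theta_eq)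
  also have "\<dots> \<le> 2 * (1 / (2 * \<kappa> / (\<tau> * \<epsilon>\<^sup>2)))" using C(2) by simp
  also have "\<dots> = \<tau> * (\<epsilon>\<^sup>2 / \<kappa>)" by simp
  finally have "theta P u y ks \<le> \<epsilon>\<^sup>2 / \<kappa>"
    by (rule mult_left_le_imp_le[OF _ \<tau>_pos])
  then have th: "\<kappa> * theta P u y ks \<le> \<epsilon>\<^sup>2" using \<kappa>0 by (simp add: field_simps)
  have th0: "0 \<le> theta P u y ks" by (rule theta_nonneg[OF ks1])
  have th': "x * theta P u y ks \<le> \<epsilon>\<^sup>2" if "x \<le> \<kappa>" for x
    using mult_right_mono[OF that th0] th by linarith
  have "norm (grad_last P (u (Suc ks), y (Suc ks)) - lam (Suc ks)) \<le> (\<bar>s\<bar> + L) * norm (y (Suc ks) - y ks)"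
    using grad_last_gap_le[of ks] by (simp add: no algebra_simps)
  then have "(norm (grad_last P (u (Suc ks), y (Suc ks)) - lam (Suc ks)))\<^sup>2 \<le> ((\<bar>s\<bar> + L) * norm (y (Suc ks) - y ks))\<^sup>2"
    by (rule power_mono) simp
  also have "\<dots> \<le> (\<bar>s\<bar> + L)\<^sup>2 * theta P u y ks"
    unfolding power_mult_distrib by (intro mult_left_mono dist_y_le_theta ks1) simp
  also have "\<dots> \<le> \<epsilon>\<^sup>2" by (rule th'[OF \<kappa>(2)])
  finally have g1: "norm (grad_last P (u (Suc ks), y (Suc ks)) - lam (Suc ks)) \<le> \<epsilon>"
    using \<epsilon> by (simp add: power2_le_iff_abs_le)
  have "(norm (residual P (u (Suc ks), y (Suc ks))))\<^sup>2 \<le> \<epsilon>\<^sup>2"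
    using residual_sq_le[OF ks1] th'[OF \<kappa>(1)] by (simp add: no)
  then have g2: "norm (residual P (u (Suc ks), y (Suc ks))) \<le> \<epsilon>"
    using \<epsilon> by (simp add: power2_le_iff_abs_le)
  have "(Q_const P L \<beta> H * sqrt (step_sq u y ks))\<^sup>2 \<le> \<epsilon>\<^sup>2"
  proof -
    have "0 \<le> step_sq u y ks" by (simp add: step_sq_def)
    then have "(Q_const P L \<beta> H * sqrt (step_sq u y ks))\<^sup>2 \<le> (Q_const P L \<beta> H)\<^sup>2 * theta P u y ks"
      using step_sq_le_theta[OF ks1] by (simp add: power_mult_distrib mult_left_mono)
    then show ?thesis using th'[OF \<kappa>(3)] by linarith
  qed
  then have "Q_const P L \<beta> H * sqrt (step_sq u y ks) \<le> \<epsilon>"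
    using \<epsilon> by (simp add: power2_le_iff_abs_le)
  then have "block_gap P I1 i (u (Suc ks), y (Suc ks)) (lam (Suc ks)) \<le> ennreal \<epsilon>" if "i \<in> blocks" for i
    using block_gap_bound[OF that, of ks] by (simp add: no) (meson ennreal_leI order_trans)
  then show ?thesis
    using g1 g2 feasible by (simp add: eps_stationary_def Suc_eq_plus1)
qed

end

text \<open>\<delta> = 0 is exact block minimization and \<delta> = L the linearized model.\<close>

lemma (in block_problem) deterministic_case:
  assumes \<beta>: "\<beta> > (6 + 18 * sqrt 3) / 13 * L"
    and \<gamma>: "12 / (13 * \<beta> + sqrt (13 * \<beta>\<^sup>2 - 12 * \<beta> * L - 72 * L\<^sup>2)) < \<gamma>"
      "\<gamma> < 12 / (13 * \<beta> - sqrt (13 * \<beta>\<^sup>2 - 12 * \<beta> * L - 72 * L\<^sup>2))"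
    and H: "\<forall>i\<in>blocks. sym_block_matrix P i (H i) \<and> block_succ P i (H i) (6 * L\<^sup>2 / \<beta> + \<delta>)"
    and \<delta>: "\<delta> \<ge> 0"
    and run: "admm_run P L I1 \<beta> \<gamma> \<delta> H (\<lambda>_ _. 0) (\<lambda>_. 0) u y lam"
    and \<tau>: "\<tau> = min (- ((\<beta> + L) / 2 - 1 / \<gamma> + 6 / \<beta> * (\<beta> - 1 / \<gamma>)\<^sup>2 + 3 * L\<^sup>2 / \<beta>))
                    (Min ((\<lambda>i. sigma_min P i (H i) / 2 - 3 * L\<^sup>2 / \<beta> - \<delta> / 2) ` blocks))"
    and K: "K = nat \<lceil>2 * Max {3 / \<beta>\<^sup>2 * ((\<beta> - 1 / \<gamma>)\<^sup>2 + L\<^sup>2), (\<bar>\<beta> - 1 / \<gamma>\<bar> + L)\<^sup>2, (Q_const P L \<beta> H)\<^sup>2} / (\<tau> * \<epsilon>\<^sup>2) *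
                   (Psi_G P L \<beta> \<gamma> (u 1, y 1) (lam 1) (y 0) - (\<Sum>i\<in>blocks. reg_opt P i) - obj_opt P)\<rceil>"
    and \<epsilon>: "\<epsilon> > 0" and ks: "is_arg_min (theta P u y) (\<lambda>k. k \<in> {2..K + 1}) ks"
  shows "eps_stationary P I1 \<epsilon> (u (ks + 1), y (ks + 1)) (lam (ks + 1))"
proof -
  note st = stepsize_deterministic[OF L_pos \<beta> \<gamma>]
  have \<beta>0: "\<beta> > 0" using st(1) L_pos by linarith
  have H': "sym_block_matrix P i (H i) \<and> block_succ P i (H i) (2 * 3 * L\<^sup>2 / \<beta> + \<delta>)" if "i \<in> blocks" for i
    using H that by simp
  note tau = decrease_rate_bounds[OF H' \<beta>0 _ \<delta> st(3) \<tau>]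
  interpret admm_run P L I1 \<beta> \<gamma> \<delta> H "\<lambda>_ _. 0" "\<lambda>_. 0" u y lam by (rule run)
  interpret admm_energy P L I1 \<beta> \<gamma> \<delta> H "\<lambda>_ _. 0" "\<lambda>_. 0" u y lam 3 0 \<tau>
    by unfold_locales (use tau st(1) in auto)
  have "energy 1 - opt_value = Psi_G P L \<beta> \<gamma> (u 1, y 1) (lam 1) (y 0) - (\<Sum>i\<in>blocks. reg_opt P i) - obj_opt P"
    by (simp add: energy_def Psi_G_def opt_value_def)
  then show ?thesis using eps_stationary_deterministic[OF refl \<epsilon> _ ks] K by simp
qed

section \<open>Batches of fresh samples\<close>

context prob_space
begin

lemma indep_sum_square:
  fixes Y :: "nat \<Rightarrow> 'a \<Rightarrow> real"
  assumes I: "finite I" and ind: "indep_vars (\<lambda>_. borel) Y I"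
    and int: "\<And>j. j \<in> I \<Longrightarrow> integrable M (Y j)" "\<And>j. j \<in> I \<Longrightarrow> integrable M (\<lambda>\<omega>. (Y j \<omega>)\<^sup>2)"
    and mean: "\<And>j. j \<in> I \<Longrightarrow> expectation (Y j) = 0"
  shows "integrable M (\<lambda>\<omega>. (\<Sum>j\<in>I. Y j \<omega>)\<^sup>2)"
    and "expectation (\<lambda>\<omega>. (\<Sum>j\<in>I. Y j \<omega>)\<^sup>2) = (\<Sum>j\<in>I. expectation (\<lambda>\<omega>. (Y j \<omega>)\<^sup>2))"
proof -
  have sq: "(\<Sum>j\<in>I. Y j \<omega>)\<^sup>2 = (\<Sum>i\<in>I. \<Sum>j\<in>I. Y i \<omega> * Y j \<omega>)" for \<omega>
    by (simp add: power2_eq_square sum_product)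
  have cross: "integrable M (\<lambda>\<omega>. Y i \<omega> * Y j \<omega>) \<and>
      expectation (\<lambda>\<omega>. Y i \<omega> * Y j \<omega>) = (if i = j then expectation (\<lambda>\<omega>. (Y i \<omega>)\<^sup>2) else 0)"
    if ij: "i \<in> I" "j \<in> I" for i j
  proof (cases "i = j")
    case True
    then show ?thesis using int(2)[OF ij(1)] by (simp add: power2_eq_square)
  next
    case False
    have sub: "indep_vars (\<lambda>_. borel) Y {i, j}" using ij by (intro indep_vars_subset[OF ind]) auto
    have il: "integrable M (Y l)" if "l \<in> {i, j}" for l using that ij int(1) by auto
    show ?thesis
      using indep_vars_lebesgue_integral[OF _ sub il] indep_vars_integrable[OF _ sub il] mean ij False by simp
  qed
  show "integrable M (\<lambda>\<omega>. (\<Sum>j\<in>I. Y j \<omega>)\<^sup>2)"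
    unfolding sq using cross by (intro Bochner_Integration.integrable_sum) blast
  have "expectation (\<lambda>\<omega>. (\<Sum>j\<in>I. Y j \<omega>)\<^sup>2) = (\<Sum>i\<in>I. \<Sum>j\<in>I. expectation (\<lambda>\<omega>. Y i \<omega> * Y j \<omega>))"
    unfolding sq using cross by (simp add: Bochner_Integration.integral_sum Bochner_Integration.integrable_sum)
  also have "\<dots> = (\<Sum>i\<in>I. \<Sum>j\<in>I. if i = j then expectation (\<lambda>\<omega>. (Y i \<omega>)\<^sup>2) else 0)"
    using cross by (intro sum.cong refl) blast
  also have "\<dots> = (\<Sum>j\<in>I. expectation (\<lambda>\<omega>. (Y j \<omega>)\<^sup>2))" using I by simp
  finally show "expectation (\<lambda>\<omega>. (\<Sum>j\<in>I. Y j \<omega>)\<^sup>2) = (\<Sum>j\<in>I. expectation (\<lambda>\<omega>. (Y j \<omega>)\<^sup>2))" .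
qed

text \<open>Done coordinate by coordinate: each coordinate is a family of independent centred real
  variables, whose cross terms vanish, and summing over the basis restores the norms.\<close>

lemma indep_sum_norm_square_le:
  fixes h :: "nat \<Rightarrow> 'a \<Rightarrow> 'v::euclidean_space"
  assumes I: "finite I" and ind: "indep_vars (\<lambda>_. borel) h I"
    and int: "\<And>j. j \<in> I \<Longrightarrow> integrable M (h j)" "\<And>j. j \<in> I \<Longrightarrow> integrable M (\<lambda>\<omega>. (norm (h j \<omega>))\<^sup>2)"
    and mean: "\<And>j. j \<in> I \<Longrightarrow> expectation (h j) = 0"
    and var: "\<And>j. j \<in> I \<Longrightarrow> expectation (\<lambda>\<omega>. (norm (h j \<omega>))\<^sup>2) \<le> v"
  shows "integrable M (\<lambda>\<omega>. (norm (\<Sum>j\<in>I. h j \<omega>))\<^sup>2)"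
    and "expectation (\<lambda>\<omega>. (norm (\<Sum>j\<in>I. h j \<omega>))\<^sup>2) \<le> real (card I) * v"
proof -
  define Y where "Y = (\<lambda>b j \<omega>. h j \<omega> \<bullet> b)"
  have meas: "h j \<in> borel_measurable M" if "j \<in> I" for j using int(1)[OF that] by simp
  have nsq: "(norm z)\<^sup>2 = (\<Sum>b\<in>Basis. (z \<bullet> b)\<^sup>2)" for z :: 'v
    by (subst power2_norm_eq_inner, subst euclidean_inner) (simp add: power2_eq_square)
  have Yint: "integrable M (Y b j)" "expectation (Y b j) = 0" if "j \<in> I" for b j
    using int(1)[OF that] mean[OF that] by (simp_all add: Y_def)
  have Yint2: "integrable M (\<lambda>\<omega>. (Y b j \<omega>)\<^sup>2)" if b: "b \<in> Basis" and j: "j \<in> I" for b j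
  proof (rule Bochner_Integration.integrable_bound[OF int(2)[OF j]])
    show "(\<lambda>\<omega>. (Y b j \<omega>)\<^sup>2) \<in> borel_measurable M" using meas[OF j] by (simp add: Y_def)
    show "AE \<omega> in M. norm ((Y b j \<omega>)\<^sup>2) \<le> norm ((norm (h j \<omega>))\<^sup>2)"
      using Basis_le_norm[OF b] by (auto simp: Y_def intro!: AE_I2 power2_le_iff_abs_le[THEN iffD2])
  qed
  have Yind: "indep_vars (\<lambda>_. borel) (Y b) I" for b
    unfolding Y_def by (rule indep_vars_compose2[OF ind]) simp
  have Ysum: "(\<Sum>j\<in>I. h j \<omega>) \<bullet> b = (\<Sum>j\<in>I. Y b j \<omega>)" for b \<omega> by (simp add: Y_def inner_sum_left)
  note S = indep_sum_square[OF I Yind Yint(1) Yint2 Yint(2)]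
  show "integrable M (\<lambda>\<omega>. (norm (\<Sum>j\<in>I. h j \<omega>))\<^sup>2)"
    unfolding nsq Ysum by (intro Bochner_Integration.integrable_sum S(1)) auto
  have "expectation (\<lambda>\<omega>. (norm (\<Sum>j\<in>I. h j \<omega>))\<^sup>2) = (\<Sum>b\<in>Basis. expectation (\<lambda>\<omega>. (\<Sum>j\<in>I. Y b j \<omega>)\<^sup>2))"
    unfolding nsq Ysum by (intro Bochner_Integration.integral_sum S(1)) auto
  also have "\<dots> = (\<Sum>b\<in>Basis. \<Sum>j\<in>I. expectation (\<lambda>\<omega>. (Y b j \<omega>)\<^sup>2))"
    by (intro sum.cong refl S(2)) auto
  also have "\<dots> = (\<Sum>j\<in>I. \<Sum>b\<in>Basis. expectation (\<lambda>\<omega>. (Y b j \<omega>)\<^sup>2))" by (rule sum.swap)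
  also have "\<dots> = (\<Sum>j\<in>I. expectation (\<lambda>\<omega>. (norm (h j \<omega>))\<^sup>2))"
    unfolding nsq using Yint2 by (intro sum.cong refl) (simp add: Bochner_Integration.integral_sum Y_def)
  also have "\<dots> \<le> (\<Sum>j\<in>I. v)" by (intro sum_mono var)
  finally show "expectation (\<lambda>\<omega>. (norm (\<Sum>j\<in>I. h j \<omega>))\<^sup>2) \<le> real (card I) * v" by simp
qed

text \<open>Fubini for the product law, with the inner integral taken again over the original space
  so that one argument can be held fixed. The nonnegative form applies before any integrability is
  known.\<close>

lemma nn_integral_indep_pair:
  assumes rv: "X \<in> measurable M S" "Y \<in> measurable M T"
    and eq: "distr M S X \<Otimes>\<^sub>M distr M T Y = distr M (S \<Otimes>\<^sub>M T) (\<lambda>x. (X x, Y x))" and f: "f \<in> borel_measurable (S \<Otimes>\<^sub>M T)"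
  shows "(\<integral>\<^sup>+ \<omega>. f (X \<omega>, Y \<omega>) \<partial>M) = (\<integral>\<^sup>+ \<omega>. (\<integral>\<^sup>+ \<omega>'. f (X \<omega>, Y \<omega>') \<partial>M) \<partial>M)"
proof -
  interpret Y: prob_space "distr M T Y" by (rule prob_space_distr[OF rv(2)])
  have f': "f \<in> borel_measurable (distr M S X \<Otimes>\<^sub>M distr M T Y)"
    using f by (simp cong: measurable_cong_sets)
  have "(\<integral>\<^sup>+ \<omega>. f (X \<omega>, Y \<omega>) \<partial>M) = integral\<^sup>N (distr M (S \<Otimes>\<^sub>M T) (\<lambda>x. (X x, Y x))) f"
    using f rv by (subst nn_integral_distr) auto
  also have "\<dots> = (\<integral>\<^sup>+ x. (\<integral>\<^sup>+ y. f (x, y) \<partial>distr M T Y) \<partial>distr M S X)"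
    unfolding eq[symmetric] using Y.nn_integral_fst[OF f'] by simp
  also have "\<dots> = (\<integral>\<^sup>+ \<omega>. (\<integral>\<^sup>+ y. f (X \<omega>, y) \<partial>distr M T Y) \<partial>M)"
    using rv Y.borel_measurable_nn_integral_fst[OF f'] by (subst nn_integral_distr) (auto cong: measurable_cong_sets)
  also have "\<dots> = (\<integral>\<^sup>+ \<omega>. (\<integral>\<^sup>+ \<omega>'. f (X \<omega>, Y \<omega>') \<partial>M) \<partial>M)"
  proof (rule nn_integral_cong)
    fix \<omega> assume "\<omega> \<in> space M"
    then have "X \<omega> \<in> space S" using rv(1) by (auto dest: measurable_space)
    then have "(\<lambda>y. f (X \<omega>, y)) \<in> borel_measurable T" using f by measurable
    then show "(\<integral>\<^sup>+ y. f (X \<omega>, y) \<partial>distr M T Y) = (\<integral>\<^sup>+ \<omega>'. f (X \<omega>, Y \<omega>') \<partial>M)"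
      using rv(2) by (subst nn_integral_distr) auto
  qed
  finally show ?thesis .
qed

lemma integral_indep_pair:
  fixes f :: "_ \<Rightarrow> real"
  assumes rv: "X \<in> measurable M S" "Y \<in> measurable M T"
    and eq: "distr M S X \<Otimes>\<^sub>M distr M T Y = distr M (S \<Otimes>\<^sub>M T) (\<lambda>x. (X x, Y x))" and f: "f \<in> borel_measurable (S \<Otimes>\<^sub>M T)"
    and int: "integrable M (\<lambda>\<omega>. f (X \<omega>, Y \<omega>))"
  shows "(\<integral> \<omega>. f (X \<omega>, Y \<omega>) \<partial>M) = (\<integral> \<omega>. (\<integral> \<omega>'. f (X \<omega>, Y \<omega>') \<partial>M) \<partial>M)"
proof -
  interpret X: prob_space "distr M S X" by (rule prob_space_distr[OF rv(1)])
  interpret Y: prob_space "distr M T Y" by (rule prob_space_distr[OF rv(2)])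
  interpret XY: pair_prob_space "distr M S X" "distr M T Y" ..
  have int': "integrable (distr M S X \<Otimes>\<^sub>M distr M T Y) f"
    unfolding eq using f rv int by (subst integrable_distr_eq) auto
  have "(\<integral> \<omega>. f (X \<omega>, Y \<omega>) \<partial>M) = integral\<^sup>L (distr M (S \<Otimes>\<^sub>M T) (\<lambda>x. (X x, Y x))) f"
    using f rv by (subst integral_distr) auto
  also have "\<dots> = (\<integral> x. (\<integral> y. f (x, y) \<partial>distr M T Y) \<partial>distr M S X)"
    unfolding eq[symmetric] using XY.integral_fst'[OF int'] by simp
  also have "\<dots> = (\<integral> \<omega>. (\<integral> y. f (X \<omega>, y) \<partial>distr M T Y) \<partial>M)"
    using rv XY.integrable_fst'[OF int'] by (subst integral_distr) (auto cong: measurable_cong_sets)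
  also have "\<dots> = (\<integral> \<omega>. (\<integral> \<omega>'. f (X \<omega>, Y \<omega>') \<partial>M) \<partial>M)"
  proof (rule Bochner_Integration.integral_cong[OF refl])
    fix \<omega> assume "\<omega> \<in> space M"
    then have "X \<omega> \<in> space S" using rv(1) by (auto dest: measurable_space)
    then have "(\<lambda>y. f (X \<omega>, y)) \<in> borel_measurable T" using f by measurable
    then show "(\<integral> y. f (X \<omega>, y) \<partial>distr M T Y) = (\<integral> \<omega>'. f (X \<omega>, Y \<omega>') \<partial>M)"
      using rv(2) by (subst integral_distr) auto
  qed
  finally show ?thesis .
qed

text \<open>The library's independence of two random variables demands a common value type.\<close>

lemma distr_pair_independent:
  assumes F: "subalgebra M F" and X: "X \<in> measurable F S" and Y: "Y \<in> measurable M T"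
    and ind: "indep_set (sets F) (sets (vimage_algebra (space M) Y T))"
  shows "distr M S X \<Otimes>\<^sub>M distr M T Y = distr M (S \<Otimes>\<^sub>M T) (\<lambda>x. (X x, Y x))" (is "?S \<Otimes>\<^sub>M ?T = ?J")
proof -
  have X': "X \<in> measurable M S" using measurable_from_subalg[OF F X] .
  have XY: "(\<lambda>x. (X x, Y x)) \<in> measurable M (S \<Otimes>\<^sub>M T)" using X' Y by simp
  interpret X: prob_space ?S by (rule prob_space_distr[OF X'])
  interpret Y: prob_space ?T by (rule prob_space_distr[OF Y])
  have spF: "space F = space M" using F by (simp add: subalgebra_def)
  show ?thesis
  proof (rule pair_measure_eqI)
    show "sigma_finite_measure ?S" ..
    show "sigma_finite_measure ?T" ..
    fix A B assume A: "A \<in> sets ?S" and B: "B \<in> sets ?T"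
    have a: "X -` A \<inter> space M \<in> sets F" using measurable_sets[OF X, of A] A spF by simp
    have b: "Y -` B \<inter> space M \<in> sets (vimage_algebra (space M) Y T)"
      using B by (intro in_vimage_algebra) simp
    have "emeasure ?J (A \<times> B) = emeasure M ((\<lambda>x. (X x, Y x)) -` (A \<times> B) \<inter> space M)"
      using A B by (intro emeasure_distr[OF XY]) auto
    also have "(\<lambda>x. (X x, Y x)) -` (A \<times> B) \<inter> space M = (X -` A \<inter> space M) \<inter> (Y -` B \<inter> space M)" by auto
    also have "emeasure M \<dots> = emeasure M (X -` A \<inter> space M) * emeasure M (Y -` B \<inter> space M)"
      using indep_setD[OF ind a b] by (simp add: emeasure_eq_measure ennreal_mult)
    also have "\<dots> = emeasure ?S A * emeasure ?T B"
      using X' Y A B by (simp add: emeasure_distr)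
    finally show "emeasure ?S A * emeasure ?T B = emeasure ?J (A \<times> B)" by simp
  qed simp
qed

end

lemma batch_mean_restrict: "batch_mean M g (\<lambda>j\<in>{1..M}. \<xi> j) = batch_mean M g \<xi>"
  by (simp add: batch_mean_def)

text \<open>
  The state \<open>X\<close> is known before the batch is drawn, so by independence it can be frozen in the inner
  integral, where only the i.i.d. samples are random.
\<close>

locale fresh_batch = prob_space Pr
  for Pr :: "'w measure" +
  fixes F :: "'w measure" and D :: "'s measure" and M :: nat and \<xi> :: "nat \<Rightarrow> 'w \<Rightarrow> 's"
    and g :: "'x::euclidean_space \<Rightarrow> 's \<Rightarrow> 'v::euclidean_space" and m :: "'x \<Rightarrow> 'v" and \<sigma> :: real
    and X :: "'w \<Rightarrow> 'x"
  assumes F: "subalgebra Pr F" and M1: "M \<ge> 1"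
    and \<xi>: "\<And>j. j \<in> {1..M} \<Longrightarrow> \<xi> j \<in> measurable Pr D" "\<And>j. j \<in> {1..M} \<Longrightarrow> distr Pr D (\<xi> j) = D"
    and iid: "indep_vars (\<lambda>_. D) \<xi> {1..M}"
    and fresh: "indep_set (sets F) (sets (vimage_algebra (space Pr) (\<lambda>\<omega>. \<lambda>j\<in>{1..M}. \<xi> j \<omega>) (PiM {1..M} (\<lambda>_. D))))"
    and g: "(\<lambda>(x, s). g x s) \<in> borel_measurable (borel \<Otimes>\<^sub>M D)"
    and g_int: "\<And>x. integrable D (g x)" and g_mean: "\<And>x. integral\<^sup>L D (g x) = m x"
    and g_int2: "\<And>x. integrable D (\<lambda>s. (norm (g x s - m x))\<^sup>2)"
    and g_var: "\<And>x. integral\<^sup>L D (\<lambda>s. (norm (g x s - m x))\<^sup>2) \<le> \<sigma>\<^sup>2"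
    and m: "m \<in> borel_measurable borel"
    and X: "X \<in> borel_measurable F"
begin

text \<open>A function of the state and of a point of the product space of samples, so that it is
  jointly measurable and the state can be held fixed while the batch is integrated out.\<close>

definition err :: "'x \<Rightarrow> (nat \<Rightarrow> 's) \<Rightarrow> 'v" where
  "err x \<zeta> = batch_mean M (g x) \<zeta> - m x"

abbreviation batch :: "'w \<Rightarrow> nat \<Rightarrow> 's" where
  "batch \<omega> \<equiv> \<lambda>j\<in>{1..M}. \<xi> j \<omega>"

abbreviation batch_space where "batch_space \<equiv> PiM {1..M} (\<lambda>_. D)"

lemma err_sum: "err x (batch \<omega>) = (1 / real M) *\<^sub>R (\<Sum>j\<in>{1..M}. g x (\<xi> j \<omega>) - m x)"
  using M1 by (simp add: err_def batch_mean_def sum_subtractf scaleR_diff_right sum_constant_scaleR)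

lemma err_restrict: "err x (batch \<omega>) = batch_mean M (g x) (\<lambda>j. \<xi> j \<omega>) - m x"
  by (simp add: err_def batch_mean_restrict)

lemma batch_measurable: "batch \<in> measurable Pr batch_space"
  using \<xi>(1) by (intro measurable_restrict) auto

lemma err_measurable: "(\<lambda>(x, \<zeta>). err x \<zeta>) \<in> borel_measurable (borel \<Otimes>\<^sub>M batch_space)"
proof -
  have "(\<lambda>p. g (fst p) (snd p j)) \<in> borel_measurable (borel \<Otimes>\<^sub>M batch_space)" if "j \<in> {1..M}" for j
  proof -
    have "(\<lambda>p. (fst p, snd p j)) \<in> measurable (borel \<Otimes>\<^sub>M batch_space) (borel \<Otimes>\<^sub>M D)"
      using that by measurable
    from measurable_compose[OF this g] show ?thesis by simp
  qed
  then show ?thesis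
    using m unfolding err_def batch_mean_def case_prod_unfold
    by (intro borel_measurable_diff borel_measurable_scaleR borel_measurable_sum borel_measurable_const)
       (auto intro: measurable_compose[OF measurable_fst])
qed

lemma g_section: "g x \<in> borel_measurable D"
  using g_int[of x] by simp

lemma sample_integral:
  assumes "j \<in> {1..M}"
  shows "integrable Pr (\<lambda>\<omega>. g x (\<xi> j \<omega>) - m x)" "expectation (\<lambda>\<omega>. g x (\<xi> j \<omega>) - m x) = 0"
    "integrable Pr (\<lambda>\<omega>. (norm (g x (\<xi> j \<omega>) - m x))\<^sup>2)"
    "expectation (\<lambda>\<omega>. (norm (g x (\<xi> j \<omega>) - m x))\<^sup>2) \<le> \<sigma>\<^sup>2"
proof -
  note x = \<xi>[OF assms]
  have i: "integrable Pr (\<lambda>\<omega>. g x (\<xi> j \<omega>))"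
    using integrable_distr[OF x(1), of "g x"] g_int x(2) by simp
  then show "integrable Pr (\<lambda>\<omega>. g x (\<xi> j \<omega>) - m x)" by simp
  have "expectation (\<lambda>\<omega>. g x (\<xi> j \<omega>)) = m x"
    using integral_distr[OF x(1), of "g x"] g_section g_mean x(2) by simp
  then show "expectation (\<lambda>\<omega>. g x (\<xi> j \<omega>) - m x) = 0"
    using i by (simp add: prob_space)
  show "integrable Pr (\<lambda>\<omega>. (norm (g x (\<xi> j \<omega>) - m x))\<^sup>2)"
    using integrable_distr[OF x(1), of "\<lambda>s. (norm (g x s - m x))\<^sup>2"] g_int2 x(2) by simp
  have "(\<lambda>s. (norm (g x s - m x))\<^sup>2) \<in> borel_measurable D" using g_int2[of x] by simp
  from integral_distr[OF x(1) this] show "expectation (\<lambda>\<omega>. (norm (g x (\<xi> j \<omega>) - m x))\<^sup>2) \<le> \<sigma>\<^sup>2"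
    using g_var[of x] x(2) by simp
qed

lemma err_fixed:
  shows "integrable Pr (\<lambda>\<omega>. err x (batch \<omega>))" "expectation (\<lambda>\<omega>. err x (batch \<omega>)) = 0"
    "integrable Pr (\<lambda>\<omega>. (norm (err x (batch \<omega>)))\<^sup>2)"
    "expectation (\<lambda>\<omega>. (norm (err x (batch \<omega>)))\<^sup>2) \<le> \<sigma>\<^sup>2 / real M"
proof -
  have ind: "indep_vars (\<lambda>_. borel) (\<lambda>j \<omega>. g x (\<xi> j \<omega>) - m x) {1..M}"
    by (rule indep_vars_compose2[OF iid]) (use g_section in simp)
  note S = indep_sum_norm_square_le[OF _ ind sample_integral(1,3,2,4)]
  have nsq: "(norm (err x (batch \<omega>)))\<^sup>2 = (1 / real M)\<^sup>2 * (norm (\<Sum>j\<in>{1..M}. g x (\<xi> j \<omega>) - m x))\<^sup>2" for \<omega>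
    by (simp add: err_sum power_mult_distrib power_divide)
  show "integrable Pr (\<lambda>\<omega>. err x (batch \<omega>))"
    unfolding err_sum by (intro integrable_scaleR_right Bochner_Integration.integrable_sum sample_integral)
  show "expectation (\<lambda>\<omega>. err x (batch \<omega>)) = 0"
    unfolding err_sum by (simp add: Bochner_Integration.integral_sum sample_integral del: sum_subtractf)
  show "integrable Pr (\<lambda>\<omega>. (norm (err x (batch \<omega>)))\<^sup>2)"
    unfolding nsq using S(1) by (intro integrable_mult_right) auto
  have "expectation (\<lambda>\<omega>. (norm (err x (batch \<omega>)))\<^sup>2) \<le> (1 / real M)\<^sup>2 * (real M * \<sigma>\<^sup>2)"
    unfolding nsq using S by (auto intro!: mult_left_mono)
  also have "\<dots> = \<sigma>\<^sup>2 / real M" by (simp add: power2_eq_square)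
  finally show "expectation (\<lambda>\<omega>. (norm (err x (batch \<omega>)))\<^sup>2) \<le> \<sigma>\<^sup>2 / real M" .
qed

lemma distr_pair_batch:
  assumes "Z \<in> measurable F S"
  shows "distr Pr S Z \<Otimes>\<^sub>M distr Pr batch_space batch = distr Pr (S \<Otimes>\<^sub>M batch_space) (\<lambda>\<omega>. (Z \<omega>, batch \<omega>))"
  by (rule distr_pair_independent[OF F assms batch_measurable fresh])

lemma X_measurable: "X \<in> borel_measurable Pr"
  using measurable_from_subalg[OF F X] .

lemma err_X_measurable: "(\<lambda>\<omega>. err (X \<omega>) (batch \<omega>)) \<in> borel_measurable Pr"
  using measurable_compose[OF measurable_Pair[OF X_measurable batch_measurable] err_measurable] by simp

text \<open>The bound for a frozen state is uniform in the state, hence survives integration over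
  it; its finiteness then yields integrability.\<close>

lemma err_second_moment:
  shows "integrable Pr (\<lambda>\<omega>. (norm (err (X \<omega>) (batch \<omega>)))\<^sup>2)"
    and "expectation (\<lambda>\<omega>. (norm (err (X \<omega>) (batch \<omega>)))\<^sup>2) \<le> \<sigma>\<^sup>2 / real M"
proof -
  let ?f = "\<lambda>p. ennreal ((norm (err (fst p) (snd p)))\<^sup>2)"
  have fm: "?f \<in> borel_measurable (borel \<Otimes>\<^sub>M batch_space)"
    using err_measurable by (simp add: case_prod_unfold)
  have "(\<integral>\<^sup>+ \<omega>. ennreal ((norm (err (X \<omega>) (batch \<omega>)))\<^sup>2) \<partial>Pr)
      = (\<integral>\<^sup>+ \<omega>. (\<integral>\<^sup>+ \<omega>'. ennreal ((norm (err (X \<omega>) (batch \<omega>')))\<^sup>2) \<partial>Pr) \<partial>Pr)"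
    using nn_integral_indep_pair[OF X_measurable batch_measurable distr_pair_batch[OF X] fm] by simp
  also have "\<dots> \<le> (\<integral>\<^sup>+ \<omega>. ennreal (\<sigma>\<^sup>2 / real M) \<partial>Pr)"
    using err_fixed(3,4) by (intro nn_integral_mono) (simp add: nn_integral_eq_integral ennreal_leI)
  also have "\<dots> = ennreal (\<sigma>\<^sup>2 / real M)" by (simp add: emeasure_space_1)
  finally have le: "(\<integral>\<^sup>+ \<omega>. ennreal ((norm (err (X \<omega>) (batch \<omega>)))\<^sup>2) \<partial>Pr) \<le> ennreal (\<sigma>\<^sup>2 / real M)" .
  show int: "integrable Pr (\<lambda>\<omega>. (norm (err (X \<omega>) (batch \<omega>)))\<^sup>2)"
    using err_X_measurable le by (intro integrableI_bounded) (auto simp: le_less_trans ennreal_less_top)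
  show "expectation (\<lambda>\<omega>. (norm (err (X \<omega>) (batch \<omega>)))\<^sup>2) \<le> \<sigma>\<^sup>2 / real M"
    using le int by (simp add: nn_integral_eq_integral)
qed

text \<open>\<open>X\<close> and \<open>Z\<close> are both known before the batch is drawn and can
  be frozen together, and the mean of the error is 0 for each fixed state. \<open>Z\<close> will be
  the error of the preceding iteration.\<close>

lemma err_orthogonal:
  assumes Z: "Z \<in> borel_measurable F" and Z2: "integrable Pr (\<lambda>\<omega>. (norm (Z \<omega> :: 'v))\<^sup>2)"
  shows "integrable Pr (\<lambda>\<omega>. err (X \<omega>) (batch \<omega>) \<bullet> Z \<omega>)"
    and "expectation (\<lambda>\<omega>. err (X \<omega>) (batch \<omega>) \<bullet> Z \<omega>) = 0"
proof -
  have Zm: "Z \<in> borel_measurable Pr" using measurable_from_subalg[OF F Z] .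
  show int: "integrable Pr (\<lambda>\<omega>. err (X \<omega>) (batch \<omega>) \<bullet> Z \<omega>)"
  proof (rule Bochner_Integration.integrable_bound[OF Bochner_Integration.integrable_add[OF err_second_moment(1) Z2]])
    show "AE \<omega> in Pr. norm (err (X \<omega>) (batch \<omega>) \<bullet> Z \<omega>) \<le> norm ((norm (err (X \<omega>) (batch \<omega>)))\<^sup>2 + (norm (Z \<omega>))\<^sup>2)"
    proof (rule AE_I2)
      fix \<omega>
      let ?a = "norm (err (X \<omega>) (batch \<omega>))" and ?b = "norm (Z \<omega>)"
      have "0 \<le> (?a - ?b)\<^sup>2" by simp
      then have "2 * (?a * ?b) \<le> ?a\<^sup>2 + ?b\<^sup>2" by (simp add: power2_eq_square algebra_simps)
      moreover have "\<bar>err (X \<omega>) (batch \<omega>) \<bullet> Z \<omega>\<bar> \<le> ?a * ?b" by (rule Cauchy_Schwarz_ineq2)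
      moreover have "0 \<le> ?a * ?b" by simp
      ultimately show "norm (err (X \<omega>) (batch \<omega>) \<bullet> Z \<omega>) \<le> norm (?a\<^sup>2 + ?b\<^sup>2)" by simp
    qed
  qed (use err_X_measurable Zm in simp)
  let ?f = "\<lambda>p. err (fst (fst p)) (snd p) \<bullet> snd (fst p)"
  have "(\<lambda>p. (fst (fst p), snd p)) \<in> measurable ((borel \<Otimes>\<^sub>M borel) \<Otimes>\<^sub>M batch_space) (borel \<Otimes>\<^sub>M batch_space)"
    by measurable
  from measurable_compose[OF this err_measurable]
  have fm: "?f \<in> borel_measurable ((borel \<Otimes>\<^sub>M borel) \<Otimes>\<^sub>M batch_space)"
    by (intro borel_measurable_inner) (auto intro: measurable_compose[OF measurable_fst])
  have XZ: "(\<lambda>\<omega>. (X \<omega>, Z \<omega>)) \<in> measurable F (borel \<Otimes>\<^sub>M borel)" using X Z by simp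
  have "expectation (\<lambda>\<omega>. err (X \<omega>) (batch \<omega>) \<bullet> Z \<omega>) = (\<integral> \<omega>. (\<integral> \<omega>'. err (X \<omega>) (batch \<omega>') \<bullet> Z \<omega> \<partial>Pr) \<partial>Pr)"
    using integral_indep_pair[OF measurable_from_subalg[OF F XZ] batch_measurable distr_pair_batch[OF XZ] fm] int by simp
  also have "\<dots> = 0" using err_fixed(1,2) by simp
  finally show "expectation (\<lambda>\<omega>. err (X \<omega>) (batch \<omega>) \<bullet> Z \<omega>) = 0" .
qed

end

section \<open>Square integrability of the iterates\<close>

context prob_space
begin

definition L2 :: "('a \<Rightarrow> 'v::euclidean_space) \<Rightarrow> bool" where
  "L2 X \<longleftrightarrow> X \<in> borel_measurable M \<and> integrable M (\<lambda>\<omega>. (norm (X \<omega>))\<^sup>2)"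

lemma L2_D: "L2 X \<Longrightarrow> X \<in> borel_measurable M" "L2 X \<Longrightarrow> integrable M (\<lambda>\<omega>. (norm (X \<omega>))\<^sup>2)"
  by (simp_all add: L2_def)

lemma L2_bound:
  assumes "X \<in> borel_measurable M" "integrable M h" "\<And>\<omega>. \<omega> \<in> space M \<Longrightarrow> (norm (X \<omega>))\<^sup>2 \<le> h \<omega>"
  shows "L2 X"
  unfolding L2_def
proof (intro conjI assms(1) Bochner_Integration.integrable_bound[OF assms(2)])
  show "AE \<omega> in M. norm ((norm (X \<omega>))\<^sup>2) \<le> norm (h \<omega>)"
    by (intro AE_I2) (use assms(3) in \<open>simp add: order_trans[OF _ abs_ge_self]\<close>)
qed (use assms(1) in measurable)

lemma L2_const: "L2 (\<lambda>_. c)" by (simp add: L2_def)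

lemma L2_cong:
  assumes "L2 X" "\<And>\<omega>. \<omega> \<in> space M \<Longrightarrow> X \<omega> = Y \<omega>"
  shows "L2 Y"
  using assms by (simp add: L2_def cong: measurable_cong Bochner_Integration.integrable_cong)

lemma L2_add:
  assumes "L2 X" "L2 Y" shows "L2 (\<lambda>\<omega>. X \<omega> + Y \<omega>)"
proof (rule L2_bound)
  show "(\<lambda>\<omega>. X \<omega> + Y \<omega>) \<in> borel_measurable M"
    using L2_D(1)[OF assms(1)] L2_D(1)[OF assms(2)] by simp
  show "integrable M (\<lambda>\<omega>. 2 * (norm (X \<omega>))\<^sup>2 + 2 * (norm (Y \<omega>))\<^sup>2)" using assms by (simp add: L2_def)
  fix \<omega>
  let ?a = "norm (X \<omega>)" and ?b = "norm (Y \<omega>)"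
  have "(norm (X \<omega> + Y \<omega>))\<^sup>2 \<le> (?a + ?b)\<^sup>2" by (intro power_mono norm_triangle_ineq) simp
  moreover have "0 \<le> (?a - ?b)\<^sup>2" by simp
  ultimately show "(norm (X \<omega> + Y \<omega>))\<^sup>2 \<le> 2 * ?a\<^sup>2 + 2 * ?b\<^sup>2" by (simp add: power2_eq_square algebra_simps)
qed

text \<open>A Lipschitz map grows at most linearly, with f 0 as the constant term.\<close>

lemma L2_lipschitz:
  fixes f :: "'v::euclidean_space \<Rightarrow> 'w::euclidean_space"
  assumes X: "L2 X" and f: "\<And>x x'. norm (f x - f x') \<le> C * norm (x - x')"
  shows "L2 (\<lambda>\<omega>. f (X \<omega>))"
proof (rule L2_bound)
  have "\<bar>C\<bar>-lipschitz_on UNIV f"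
    by (intro lipschitz_onI) (auto simp: dist_norm intro!: order_trans[OF f] mult_right_mono)
  then have "f \<in> borel_measurable borel"
    by (intro borel_measurable_continuous_onI lipschitz_on_continuous_on)
  then show "(\<lambda>\<omega>. f (X \<omega>)) \<in> borel_measurable M" using L2_D(1)[OF X] by measurable
  show "integrable M (\<lambda>\<omega>. 2 * (norm (f 0))\<^sup>2 + 2 * (C\<^sup>2 * (norm (X \<omega>))\<^sup>2))" using X by (simp add: L2_def)
  fix \<omega>
  let ?a = "norm (f 0)" and ?b = "\<bar>C\<bar> * norm (X \<omega>)"
  have "norm (f (X \<omega>)) \<le> ?a + norm (f (X \<omega>) - f 0)" by (rule norm_triangle_sub)
  also have "norm (f (X \<omega>) - f 0) \<le> ?b" using f[of "X \<omega>" 0] by (simp add: mult_right_mono order_trans[OF _ mult_right_mono[OF abs_ge_self]])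
  finally have "(norm (f (X \<omega>)))\<^sup>2 \<le> (?a + ?b)\<^sup>2" by (intro power_mono) auto
  moreover have "0 \<le> (?a - ?b)\<^sup>2" by simp
  ultimately have "(norm (f (X \<omega>)))\<^sup>2 \<le> 2 * ?a\<^sup>2 + 2 * ?b\<^sup>2" by (simp only: power2_diff power2_sum)
  then show "(norm (f (X \<omega>)))\<^sup>2 \<le> 2 * ?a\<^sup>2 + 2 * (C\<^sup>2 * (norm (X \<omega>))\<^sup>2)" by (simp add: power_mult_distrib)
qed

lemma L2_scaleR: "L2 X \<Longrightarrow> L2 (\<lambda>\<omega>. c *\<^sub>R X \<omega>)"
  by (rule L2_lipschitz[where C = "\<bar>c\<bar>"]) (auto simp flip: scaleR_diff_right)

lemma L2_diff: "L2 X \<Longrightarrow> L2 Y \<Longrightarrow> L2 (\<lambda>\<omega>. X \<omega> - Y \<omega>)"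
  using L2_add[OF _ L2_scaleR[of Y "-1"]] by simp

lemma L2_matrix:
  fixes A :: "real^'x^'y"
  shows "L2 X \<Longrightarrow> L2 (\<lambda>\<omega>. A *v X \<omega>)"
  by (rule L2_lipschitz[where C = "spec_norm A"]) (simp_all add: spec_norm_le flip: matrix_vector_mult_diff_distrib)

lemma L2_Pair:
  assumes "L2 X" "L2 Y" shows "L2 (\<lambda>\<omega>. (X \<omega>, Y \<omega>))"
  using L2_D[OF assms(1)] L2_D[OF assms(2)] by (simp add: L2_def norm_prod_def)

text \<open>By polarization, from the squared norms alone.\<close>

lemma L2_inner_integrable:
  assumes "L2 X" "L2 Y" shows "integrable M (\<lambda>\<omega>. X \<omega> \<bullet> Y \<omega>)"
proof -
  have "X \<omega> \<bullet> Y \<omega> = ((norm (X \<omega> + Y \<omega>))\<^sup>2 - (norm (X \<omega>))\<^sup>2 - (norm (Y \<omega>))\<^sup>2) / 2" for \<omega>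
    by (simp add: power2_norm_eq_inner inner_add_left inner_add_right inner_commute)
  then show ?thesis
    using L2_D(2)[OF L2_add[OF assms]] L2_D(2)[OF assms(1)] L2_D(2)[OF assms(2)] by (simp only:) simp
qed

text \<open>\<open>h \<le> (h\<^sup>2 / \<epsilon> + \<epsilon>) / 2\<close> replaces Jensen's inequality.\<close>

lemma upper_expectation_le:
  assumes h: "h \<in> borel_measurable M" "\<And>\<omega>. \<omega> \<in> space M \<Longrightarrow> 0 \<le> h \<omega>"
    and g: "\<And>\<omega>. \<omega> \<in> space M \<Longrightarrow> g \<omega> \<le> ennreal (h \<omega>)"
    and q: "integrable M q" "\<And>\<omega>. \<omega> \<in> space M \<Longrightarrow> (h \<omega>)\<^sup>2 \<le> q \<omega>" "expectation q \<le> \<epsilon>\<^sup>2"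
    and \<epsilon>: "\<epsilon> > 0"
  shows "upper_expectation M g \<le> ennreal \<epsilon>"
proof -
  have le: "h \<omega> \<le> (q \<omega> / \<epsilon> + \<epsilon>) / 2" if "\<omega> \<in> space M" for \<omega>
  proof -
    have "0 \<le> (h \<omega> - \<epsilon>)\<^sup>2 / \<epsilon>" using \<epsilon> by simp
    also have "\<dots> = (h \<omega>)\<^sup>2 / \<epsilon> + \<epsilon> - 2 * h \<omega>" using \<epsilon> by (simp add: power2_eq_square field_simps)
    also have "\<dots> \<le> q \<omega> / \<epsilon> + \<epsilon> - 2 * h \<omega>" using q(2)[OF that] \<epsilon> by (simp add: divide_right_mono)
    finally show ?thesis by simp
  qed
  have int: "integrable M (\<lambda>\<omega>. (q \<omega> / \<epsilon> + \<epsilon>) / 2)" using q(1) by simp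
  have hint: "integrable M h"
    by (rule Bochner_Integration.integrable_bound[OF int h(1)])
       (use h(2) le in \<open>auto intro!: AE_I2 order_trans[OF _ abs_ge_self]\<close>)
  have "upper_expectation M g \<le> (\<integral>\<^sup>+ \<omega>. ennreal (h \<omega>) \<partial>M)"
    unfolding upper_expectation_def using h(1) g by (intro INF_lower) auto
  also have "\<dots> = ennreal (expectation h)"
    using hint h(2) by (intro nn_integral_eq_integral AE_I2)
  also have "expectation h \<le> expectation (\<lambda>\<omega>. (q \<omega> / \<epsilon> + \<epsilon>) / 2)"
    by (rule integral_mono[OF hint int le])
  also have "\<dots> = (expectation q / \<epsilon> + \<epsilon>) / 2" using q(1) by (simp add: prob_space)
  also have "\<dots> \<le> \<epsilon>" using q(3) \<epsilon> by (simp add: power2_eq_square field_simps)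
  finally show ?thesis by (simp add: ennreal_leI)
qed

end

section \<open>Growth of the objective and integrability of the augmented Lagrangian\<close>

context block_problem
begin

lemma obj_measurable: "obj P \<in> borel_measurable borel"
proof (rule borel_measurable_continuous_onI, intro continuous_at_imp_continuous_on ballI)
  fix x
  show "isCont (obj P) x"
    using obj_gderiv[of x] by (auto simp: gderiv_def dest: has_derivative_continuous)
qed

lemma reg_measurable: "i \<in> blocks \<Longrightarrow> reg P i \<in> borel_measurable borel"
  by (intro borel_measurable_continuous_onI continuous_at_imp_continuous_on ballI
        locally_lipschitz_isCont block_assms)

text \<open>The descent lemma between x and 0, used in both directions, gives quadratic growth; a
  square integrable point thus has an integrable objective value.\<close>

lemma obj_abs_le:
  "\<bar>obj P x\<bar> \<le> \<bar>obj P 0\<bar> + (norm (grad (obj P) 0))\<^sup>2 / 2 + (1 / 2 + 3 / 2 * L) * (norm x)\<^sup>2"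
proof -
  let ?g = "grad (obj P)"
  have am: "norm (?g 0) * norm x \<le> (norm (?g 0))\<^sup>2 / 2 + (norm x)\<^sup>2 / 2"
  proof -
    have "0 \<le> (norm (?g 0) - norm x)\<^sup>2" by simp
    then show ?thesis by (simp add: power2_eq_square algebra_simps)
  qed
  have u: "obj P x \<le> obj P 0 + ?g 0 \<bullet> x + L / 2 * (norm x)\<^sup>2"
    using descent_lemma[OF obj_gderiv grad_lipschitz, of x 0] by simp
  have l: "obj P 0 \<le> obj P x - ?g x \<bullet> x + L / 2 * (norm x)\<^sup>2"
    using descent_lemma[OF obj_gderiv grad_lipschitz, of 0 x] by simp
  have "norm (?g x) \<le> norm (?g 0) + L * norm x"
    using norm_triangle_sub[of "?g x" "?g 0"] grad_norm_le[of x 0] by simp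
  then have "norm (?g x) * norm x \<le> norm (?g 0) * norm x + L * (norm x)\<^sup>2"
    using mult_right_mono[of _ _ "norm x"] by (fastforce simp: power2_eq_square algebra_simps)
  then have gx: "- (norm (?g 0) * norm x + L * (norm x)\<^sup>2) \<le> ?g x \<bullet> x"
    using norm_cauchy_schwarz[of "- ?g x" x] by simp
  have g0: "?g 0 \<bullet> x \<le> norm (?g 0) * norm x" by (rule norm_cauchy_schwarz)
  have L0: "0 \<le> L * (norm x)\<^sup>2" using L_pos by simp
  show ?thesis unfolding abs_le_iff distrib_right using u l gx g0 am L0 by (intro conjI; linarith)
qed

end

locale block_problem_prob = block_problem P L + prob_space Pr
  for P :: "('n::finite, 'm::finite) problem" and L and Pr :: "'w measure"
begin

lemma L2_residual: "L2 U \<Longrightarrow> L2 Y \<Longrightarrow> L2 (\<lambda>\<omega>. residual P (U \<omega>, Y \<omega>))"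
  unfolding residual_eq by (intro L2_diff L2_add L2_matrix L2_const)

lemma L2_grad_last: "L2 U \<Longrightarrow> L2 Y \<Longrightarrow> L2 (\<lambda>\<omega>. grad_last P (U \<omega>, Y \<omega>))"
  by (rule L2_lipschitz[OF L2_Pair grad_last_norm_le])

lemma integrable_obj:
  assumes "L2 X" shows "integrable Pr (\<lambda>\<omega>. obj P (X \<omega>))"
proof (rule Bochner_Integration.integrable_bound)
  show "integrable Pr (\<lambda>\<omega>. \<bar>obj P 0\<bar> + (norm (grad (obj P) 0))\<^sup>2 / 2 + (1 / 2 + 3 / 2 * L) * (norm (X \<omega>))\<^sup>2)"
    using L2_D(2)[OF assms] by simp
  show "(\<lambda>\<omega>. obj P (X \<omega>)) \<in> borel_measurable Pr" using obj_measurable L2_D(1)[OF assms] by measurable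
  show "AE \<omega> in Pr. norm (obj P (X \<omega>)) \<le>
      norm (\<bar>obj P 0\<bar> + (norm (grad (obj P) 0))\<^sup>2 / 2 + (1 / 2 + 3 / 2 * L) * (norm (X \<omega>))\<^sup>2)"
    unfolding real_norm_def by (intro AE_I2 order_trans[OF obj_abs_le abs_ge_self])
qed

definition reg_sum :: "real^'n \<Rightarrow> real" where
  "reg_sum v = (\<Sum>i\<in>blocks. reg P i (part P i v))"

lemma reg_sum_measurable:
  assumes "U \<in> borel_measurable Pr" shows "(\<lambda>\<omega>. reg_sum (U \<omega>)) \<in> borel_measurable Pr"
  unfolding reg_sum_def
proof (intro borel_measurable_sum)
  fix i assume i: "i \<in> blocks"
  have "part P i \<in> borel_measurable borel"
    by (intro borel_measurable_continuous_onI linear_continuous_on linear_conv_bounded_linear[THEN iffD1] linearI)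
       (simp_all add: part_add part_scaleR)
  then show "(\<lambda>\<omega>. reg P i (part P i (U \<omega>))) \<in> borel_measurable Pr"
    using reg_measurable[OF i] assms by measurable
qed

lemma integrable_aug_minus_reg:
  assumes "L2 U" "L2 Y" "L2 l"
  shows "integrable Pr (\<lambda>\<omega>. aug_lagrangian P \<beta> (U \<omega>, Y \<omega>) (l \<omega>) - reg_sum (U \<omega>))"
  unfolding aug_lagrangian_def fst_conv reg_sum_def[symmetric]
  using integrable_obj[OF L2_Pair[OF assms(1,2)]] L2_inner_integrable[OF L2_residual[OF assms(1,2)] assms(3)]
    L2_D(2)[OF L2_residual[OF assms(1,2)]] by simp

text \<open>Local Lipschitz continuity gives the regularizers no growth bound, so square
  integrability of the point does not settle their integrability. All other terms are integrable,
  which lets it be read off from the augmented Lagrangian.\<close>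

lemma integrable_aug_iff:
  assumes "L2 U" "L2 Y" "L2 l"
  shows "integrable Pr (\<lambda>\<omega>. aug_lagrangian P \<beta> (U \<omega>, Y \<omega>) (l \<omega>)) \<longleftrightarrow> integrable Pr (\<lambda>\<omega>. reg_sum (U \<omega>))"
  using Bochner_Integration.integrable_add[OF integrable_aug_minus_reg[OF assms, of \<beta>], of "\<lambda>\<omega>. reg_sum (U \<omega>)"]
    Bochner_Integration.integrable_diff[OF _ integrable_aug_minus_reg[OF assms, of \<beta>], of "\<lambda>\<omega>. aug_lagrangian P \<beta> (U \<omega>, Y \<omega>) (l \<omega>)"]
  by auto

lemma aug_measurable:
  assumes "U \<in> borel_measurable Pr" "Y \<in> borel_measurable Pr" "l \<in> borel_measurable Pr"
  shows "(\<lambda>\<omega>. aug_lagrangian P \<beta> (U \<omega>, Y \<omega>) (l \<omega>)) \<in> borel_measurable Pr"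
proof -
  have "(\<lambda>\<omega>. (U \<omega>, Y \<omega>)) \<in> borel_measurable Pr" using assms by simp
  then have o: "(\<lambda>\<omega>. obj P (U \<omega>, Y \<omega>)) \<in> borel_measurable Pr" using obj_measurable by measurable
  have "(*v) (conmat P) \<in> borel_measurable borel"
    by (intro borel_measurable_continuous_onI linear_continuous_on) simp
  then have "(\<lambda>\<omega>. conmat P *v U \<omega>) \<in> borel_measurable Pr" using assms(1) by measurable
  then have r: "(\<lambda>\<omega>. residual P (U \<omega>, Y \<omega>)) \<in> borel_measurable Pr"
    unfolding residual_eq using assms by simp
  show ?thesis
    unfolding aug_lagrangian_def fst_conv reg_sum_def[symmetric]
    using o r assms reg_sum_measurable[OF assms(1)] by simp
qed

end

section \<open>The stochastic algorithm\<close>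

text \<open>\<open>e\<close> and \<open>eN\<close> are the realized gradient errors; with them every
  path satisfies the deterministic energy inequalities with c = 4 and \<omega> = 1.\<close>

locale admm_stochastic = block_problem P L for P :: "('n::finite, 'm::finite) problem" and L +
  fixes I1 :: "nat set" and \<beta> \<gamma> \<tau> \<sigma> :: real and H :: "nat \<Rightarrow> real^'n^'n"
    and Pr :: "'w measure" and F :: "nat \<Rightarrow> 'w measure" and D :: "nat \<Rightarrow> 's measure"
    and G :: "nat \<Rightarrow> (real^'n) \<times> (real^'m) \<Rightarrow> 's \<Rightarrow> real^'n"
    and GN :: "(real^'n) \<times> (real^'m) \<Rightarrow> 's \<Rightarrow> real^'m"
    and \<xi> :: "nat \<Rightarrow> nat \<Rightarrow> nat \<Rightarrow> 'w \<Rightarrow> 's" and M :: nat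
    and u :: "'w \<Rightarrow> nat \<Rightarrow> real^'n" and y lam :: "'w \<Rightarrow> nat \<Rightarrow> real^'m"
    and e :: "'w \<Rightarrow> nat \<Rightarrow> nat \<Rightarrow> real^'n" and eN :: "'w \<Rightarrow> nat \<Rightarrow> real^'m"
  assumes sampling: "fresh_sampling P Pr F D M \<xi>"
    and adapted: "adapted_iterates P Pr F u y lam"
    and oracles: "oracle_assms P D G GN \<sigma>"
    and M1: "M \<ge> 1"
    and e_eq: "\<And>\<omega> k i. e \<omega> k i = batch_mean M (G i (query P (u \<omega>) (y \<omega>) k i)) (\<lambda>j. \<xi> k i j \<omega>)
        - grad_block P i (query P (u \<omega>) (y \<omega>) k i)"
    and eN_eq: "\<And>\<omega> k. eN \<omega> k = batch_mean M (GN (u \<omega> (Suc k), y \<omega> k)) (\<lambda>j. \<xi> k (nblocks P) j \<omega>)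
        - grad_last P (u \<omega> (Suc k), y \<omega> k)"
    and run: "\<And>\<omega>. \<omega> \<in> space Pr \<Longrightarrow>
        admm_energy P L I1 \<beta> \<gamma> L H (e \<omega>) (eN \<omega>) (u \<omega>) (y \<omega>) (lam \<omega>) 4 1 \<tau>"
begin

sublocale prob_space Pr
  using sampling by (simp add: fresh_sampling_def)

sublocale block_problem_prob P L Pr ..

section \<open>Adaptedness and moments of the gradient errors\<close>

lemma F_subalgebra: "subalgebra Pr (F t)" and space_F: "space (F t) = space Pr"
  and F_mono: "t \<le> t' \<Longrightarrow> sets (F t) \<subseteq> sets (F t')"
  using sampling by (auto simp: fresh_sampling_def filtration_def)

lemma measurable_F_mono: "X \<in> measurable (F t) S \<Longrightarrow> t \<le> t' \<Longrightarrow> X \<in> measurable (F t') S"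
  using F_mono[of t t'] by (auto simp: measurable_def space_F)

lemma measurable_F: "X \<in> measurable (F t) S \<Longrightarrow> X \<in> measurable Pr S"
  by (rule measurable_from_subalg[OF F_subalgebra])

lemma initial_constant: "\<exists>u0 y0 lam0. \<forall>\<omega>\<in>space Pr. u \<omega> 0 = u0 \<and> y \<omega> 0 = y0 \<and> lam \<omega> 0 = lam0"
  using adapted by (simp add: adapted_iterates_def)

lemma part_Suc_measurable: "i \<in> blocks \<Longrightarrow> (\<lambda>\<omega>. part P i (u \<omega> (Suc k))) \<in> borel_measurable (F (k * N + i))"
  using adapted by (simp add: adapted_iterates_def)

lemma part_measurable:
  assumes "i \<in> blocks"
  shows "(\<lambda>\<omega>. part P i (u \<omega> k)) \<in> borel_measurable (F (k * N))"
proof (cases k)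
  case 0
  obtain u0 where "\<forall>\<omega>\<in>space Pr. u \<omega> 0 = u0" using initial_constant by blast
  then show ?thesis
    unfolding 0 by (subst measurable_cong[where g = "\<lambda>_. part P i u0"]) (auto simp: space_F)
next
  case (Suc k')
  show ?thesis
    unfolding Suc by (rule measurable_F_mono[OF part_Suc_measurable[OF assms]]) (use assms in simp)
qed

lemma u_measurable_F: "(\<lambda>\<omega>. u \<omega> k) \<in> borel_measurable (F (k * N))"
proof -
  have "(\<lambda>\<omega>. \<Sum>i\<in>blocks. part P i (u \<omega> k)) \<in> borel_measurable (F (k * N))"
    by (intro borel_measurable_sum part_measurable)
  then show ?thesis by (simp add: sum_part)
qed

lemma y_measurable_F: "(\<lambda>\<omega>. y \<omega> k) \<in> borel_measurable (F (k * N))"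
proof (cases k)
  case 0
  obtain y0 where "\<forall>\<omega>\<in>space Pr. y \<omega> 0 = y0" using initial_constant by blast
  then show ?thesis
    unfolding 0 by (subst measurable_cong[where g = "\<lambda>_. y0"]) (auto simp: space_F)
qed (use adapted in \<open>simp only: adapted_iterates_def\<close>)

lemma u_Suc_measurable_F: "(\<lambda>\<omega>. u \<omega> (Suc k)) \<in> borel_measurable (F (k * N + (N - 1)))"
proof -
  have "(\<lambda>\<omega>. \<Sum>i\<in>blocks. part P i (u \<omega> (Suc k))) \<in> borel_measurable (F (k * N + (N - 1)))"
    by (intro borel_measurable_sum measurable_F_mono[OF part_Suc_measurable]) auto
  then show ?thesis by (simp add: sum_part)
qed

text \<open>The query of block i uses new values only of the blocks before i, so it is known just
  before its own oracle call. Adaptedness is given per block; the vector is reassembled from its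
  parts.\<close>

lemma query_measurable:
  assumes i: "i \<in> blocks"
  shows "(\<lambda>\<omega>. query P (u \<omega>) (y \<omega>) k i) \<in> borel_measurable (F (k * N + (i - 1)))"
proof -
  have "(\<lambda>\<omega>. \<Sum>j\<in>blocks. part P j (splice P i (u \<omega> (Suc k)) (u \<omega> k) (u \<omega> k))) \<in> borel_measurable (F (k * N + (i - 1)))"
  proof (intro borel_measurable_sum)
    fix j assume j: "j \<in> blocks"
    show "(\<lambda>\<omega>. part P j (splice P i (u \<omega> (Suc k)) (u \<omega> k) (u \<omega> k))) \<in> borel_measurable (F (k * N + (i - 1)))"
    proof (cases "j < i")
      case True
      then show ?thesis
        using measurable_F_mono[OF part_Suc_measurable[OF j], of k "k * N + (i - 1)"] by (simp add: part_splice)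
    next
      case False
      then show ?thesis
        using measurable_F_mono[OF part_measurable[OF j], of k "k * N + (i - 1)"] by (simp add: part_splice)
    qed
  qed
  then have "(\<lambda>\<omega>. splice P i (u \<omega> (Suc k)) (u \<omega> k) (u \<omega> k)) \<in> borel_measurable (F (k * N + (i - 1)))"
    by (simp add: sum_part)
  then show ?thesis
    unfolding query_def using measurable_F_mono[OF y_measurable_F, of k "k * N + (i - 1)"] by simp
qed

lemma last_query_measurable: "(\<lambda>\<omega>. (u \<omega> (Suc k), y \<omega> k)) \<in> borel_measurable (F (k * N + (N - 1)))"
  using u_Suc_measurable_F measurable_F_mono[OF y_measurable_F, of k "k * N + (N - 1)"] by simp

lemma N_in: "N \<in> {1..N}" using N_ge_2 by simp

lemma batch_facts:
  assumes "i \<in> {1..N}"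
  shows "j \<in> {1..M} \<Longrightarrow> \<xi> k i j \<in> measurable (F (k * N + i)) (D i)"
    "j \<in> {1..M} \<Longrightarrow> distr Pr (D i) (\<xi> k i j) = D i"
    "indep_vars (\<lambda>_. D i) (\<xi> k i) {1..M}"
    "indep_set (sets (F (k * N + (i - 1))))
       (sets (vimage_algebra (space Pr) (\<lambda>\<omega>. \<lambda>j\<in>{1..M}. \<xi> k i j \<omega>) (PiM {1..M} (\<lambda>_. D i))))"
  using sampling assms unfolding fresh_sampling_def by blast+

lemma grad_block_measurable: "grad_block P i \<in> borel_measurable borel"
  by (intro borel_measurable_continuous_onI lipschitz_on_continuous_on[of L] lipschitz_onI)
     (use grad_block_norm_le L_pos in \<open>auto simp: dist_norm\<close>)

lemma grad_last_measurable: "grad_last P \<in> borel_measurable borel"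
  by (intro borel_measurable_continuous_onI lipschitz_on_continuous_on[of L] lipschitz_onI)
     (use grad_last_norm_le L_pos in \<open>auto simp: dist_norm\<close>)

lemma fresh_batch_block:
  assumes i: "i \<in> blocks"
  shows "fresh_batch Pr (F (k * N + (i - 1))) (D i) M (\<xi> k i) (G i) (grad_block P i) \<sigma>
    (\<lambda>\<omega>. query P (u \<omega>) (y \<omega>) k i)"
proof -
  have i': "i \<in> {1..N}" using i by auto
  note o = oracles[unfolded oracle_assms_def, THEN conjunct2, THEN conjunct1, THEN bspec, OF i]
  show ?thesis
    by unfold_locales
       (use o M1 batch_facts[OF i'] F_subalgebra grad_block_measurable query_measurable[OF i]
        in \<open>auto intro: measurable_F\<close>)
qed

lemma fresh_batch_last:
  "fresh_batch Pr (F (k * N + (N - 1))) (D N) M (\<xi> k N) GN (grad_last P) \<sigma> (\<lambda>\<omega>. (u \<omega> (Suc k), y \<omega> k))"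
  by unfold_locales
     (use oracles M1 batch_facts[OF N_in] F_subalgebra grad_last_measurable last_query_measurable
      in \<open>auto simp: oracle_assms_def intro: measurable_F\<close>)

abbreviation "noise_var \<equiv> \<sigma>\<^sup>2 / real M"

lemma L2_e:
  assumes i: "i \<in> blocks"
  shows "L2 (\<lambda>\<omega>. e \<omega> k i)" "expectation (\<lambda>\<omega>. (norm (e \<omega> k i))\<^sup>2) \<le> noise_var"
proof -
  interpret fb: fresh_batch Pr "F (k * N + (i - 1))" "D i" M "\<xi> k i" "G i" "grad_block P i" \<sigma>
    "\<lambda>\<omega>. query P (u \<omega>) (y \<omega>) k i"
    by (rule fresh_batch_block[OF i])
  show "L2 (\<lambda>\<omega>. e \<omega> k i)" "expectation (\<lambda>\<omega>. (norm (e \<omega> k i))\<^sup>2) \<le> noise_var"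
    unfolding e_eq fb.err_restrict[symmetric] L2_def
    using fb.err_X_measurable fb.err_second_moment by auto
qed

text \<open>The error is known at the end of its iteration, hence before the last oracle call of the
  next one, as orthogonality requires.\<close>

lemma eN_measurable_F: "(\<lambda>\<omega>. eN \<omega> k) \<in> borel_measurable (F (Suc k * N))"
proof -
  have X: "(\<lambda>\<omega>. (u \<omega> (Suc k), y \<omega> k)) \<in> borel_measurable (F (Suc k * N))"
    by (rule measurable_F_mono[OF last_query_measurable]) simp
  have "(\<lambda>\<omega>. GN (u \<omega> (Suc k), y \<omega> k) (\<xi> k N j \<omega>)) \<in> borel_measurable (F (Suc k * N))" if "j \<in> {1..M}" for j
  proof -
    have "\<xi> k N j \<in> measurable (F (Suc k * N)) (D N)"
      using batch_facts(1)[OF N_in that, of k] by (simp add: add.commute)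
    with X have "(\<lambda>\<omega>. ((u \<omega> (Suc k), y \<omega> k), \<xi> k N j \<omega>)) \<in> measurable (F (Suc k * N)) (borel \<Otimes>\<^sub>M D N)" by simp
    moreover have "(\<lambda>(x, s). GN x s) \<in> borel_measurable (borel \<Otimes>\<^sub>M D N)" using oracles by (simp add: oracle_assms_def)
    ultimately show ?thesis using measurable_compose by fastforce
  qed
  then have "(\<lambda>\<omega>. batch_mean M (GN (u \<omega> (Suc k), y \<omega> k)) (\<lambda>j. \<xi> k N j \<omega>)) \<in> borel_measurable (F (Suc k * N))"
    unfolding batch_mean_def by (intro borel_measurable_scaleR borel_measurable_sum borel_measurable_const)
  moreover have "(\<lambda>\<omega>. grad_last P (u \<omega> (Suc k), y \<omega> k)) \<in> borel_measurable (F (Suc k * N))"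
    using measurable_compose[OF X grad_last_measurable] .
  ultimately show ?thesis unfolding eN_eq by (rule borel_measurable_diff)
qed

lemma L2_eN:
  shows "L2 (\<lambda>\<omega>. eN \<omega> k)" "expectation (\<lambda>\<omega>. (norm (eN \<omega> k))\<^sup>2) \<le> noise_var"
proof -
  interpret fb: fresh_batch Pr "F (k * N + (N - 1))" "D N" M "\<xi> k N" GN "grad_last P" \<sigma> "\<lambda>\<omega>. (u \<omega> (Suc k), y \<omega> k)"
    by (rule fresh_batch_last)
  show "L2 (\<lambda>\<omega>. eN \<omega> k)" "expectation (\<lambda>\<omega>. (norm (eN \<omega> k))\<^sup>2) \<le> noise_var"
    unfolding eN_eq fb.err_restrict[symmetric] L2_def
    using fb.err_X_measurable fb.err_second_moment by auto
qed

text \<open>Orthogonality of consecutive errors gives twice the variance, where the triangle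
  inequality would give four times. This produces the 8 in 8 / \<beta> of \<kappa>_4 and in 8 /
  \<beta>^2 of the batch size.\<close>

lemma eN_diff_second_moment:
  "integrable Pr (\<lambda>\<omega>. (norm (eN \<omega> (Suc k) - eN \<omega> k))\<^sup>2)"
  "expectation (\<lambda>\<omega>. (norm (eN \<omega> (Suc k) - eN \<omega> k))\<^sup>2) \<le> 2 * noise_var"
proof -
  show int: "integrable Pr (\<lambda>\<omega>. (norm (eN \<omega> (Suc k) - eN \<omega> k))\<^sup>2)"
    using L2_D(2)[OF L2_diff[OF L2_eN(1) L2_eN(1)]] .
  interpret fb: fresh_batch Pr "F (Suc k * N + (N - 1))" "D N" M "\<xi> (Suc k) N" GN "grad_last P" \<sigma>
    "\<lambda>\<omega>. (u \<omega> (Suc (Suc k)), y \<omega> (Suc k))"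
    by (rule fresh_batch_last)
  have "(\<lambda>\<omega>. eN \<omega> k) \<in> borel_measurable (F (Suc k * N + (N - 1)))"
    by (rule measurable_F_mono[OF eN_measurable_F]) simp
  from fb.err_orthogonal[OF this L2_D(2)[OF L2_eN(1)]]
  have orth: "integrable Pr (\<lambda>\<omega>. eN \<omega> (Suc k) \<bullet> eN \<omega> k)" "expectation (\<lambda>\<omega>. eN \<omega> (Suc k) \<bullet> eN \<omega> k) = 0"
    unfolding fb.err_restrict eN_eq[symmetric] by auto
  have "(norm (eN \<omega> (Suc k) - eN \<omega> k))\<^sup>2 = (norm (eN \<omega> (Suc k)))\<^sup>2 + (norm (eN \<omega> k))\<^sup>2 - 2 * (eN \<omega> (Suc k) \<bullet> eN \<omega> k)" for \<omega>
    by (simp add: power2_norm_eq_inner inner_diff_left inner_diff_right inner_commute)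
  then have "expectation (\<lambda>\<omega>. (norm (eN \<omega> (Suc k) - eN \<omega> k))\<^sup>2)
      = expectation (\<lambda>\<omega>. (norm (eN \<omega> (Suc k)))\<^sup>2) + expectation (\<lambda>\<omega>. (norm (eN \<omega> k))\<^sup>2)"
    using orth L2_D(2)[OF L2_eN(1)] by (simp only:) simp
  then show "expectation (\<lambda>\<omega>. (norm (eN \<omega> (Suc k) - eN \<omega> k))\<^sup>2) \<le> 2 * noise_var"
    using L2_eN(2)[of k] L2_eN(2)[of "Suc k"] by linarith
qed

lemma space_nonempty: "\<exists>\<omega>. \<omega> \<in> space Pr" using not_empty by blast

lemma constants: "\<beta> > 0" "\<gamma> > 0" "\<tau> > 0"
proof -
  obtain \<omega> where \<omega>: "\<omega> \<in> space Pr" using space_nonempty by blast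
  interpret admm_energy P L I1 \<beta> \<gamma> L H "e \<omega>" "eN \<omega>" "u \<omega>" "y \<omega>" "lam \<omega>" 4 1 \<tau> by (rule run[OF \<omega>])
  show "\<beta> > 0" "\<gamma> > 0" "\<tau> > 0" by (rule \<beta>_pos \<gamma>_pos \<tau>_pos)+
qed

definition opt where "opt = obj_opt P + (\<Sum>i\<in>blocks. reg_opt P i)"

text \<open>
  Needed because the integral of a non-integrable function is 0. The block step is square integrable
  since the augmented Lagrangian, which it decreases, is bounded below by an integrable function.
\<close>

lemma L2_iterates:
  "L2 (\<lambda>\<omega>. u \<omega> k) \<and> L2 (\<lambda>\<omega>. y \<omega> k) \<and> L2 (\<lambda>\<omega>. lam \<omega> k) \<and> integrable Pr (\<lambda>\<omega>. reg_sum (u \<omega> k))"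
proof (induction k)
  case 0
  obtain u0 y0 lam0 where 0: "\<forall>\<omega>\<in>space Pr. u \<omega> 0 = u0 \<and> y \<omega> 0 = y0 \<and> lam \<omega> 0 = lam0"
    using initial_constant by blast
  have "integrable Pr (\<lambda>\<omega>. reg_sum (u \<omega> 0)) = integrable Pr (\<lambda>\<omega>. reg_sum u0)"
    by (rule Bochner_Integration.integrable_cong) (use 0 in auto)
  then show ?case
    using L2_cong[OF L2_const[of u0], of "\<lambda>\<omega>. u \<omega> 0"] L2_cong[OF L2_const[of y0], of "\<lambda>\<omega>. y \<omega> 0"]
      L2_cong[OF L2_const[of lam0], of "\<lambda>\<omega>. lam \<omega> 0"] 0 by simp
next
  case (Suc k)
  then have L: "L2 (\<lambda>\<omega>. u \<omega> k)" "L2 (\<lambda>\<omega>. y \<omega> k)" "L2 (\<lambda>\<omega>. lam \<omega> k)"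
    and R: "integrable Pr (\<lambda>\<omega>. reg_sum (u \<omega> k))" by auto
  define a where "a \<omega> = aug_lagrangian P \<beta> (u \<omega> k, y \<omega> k) (lam \<omega> k)" for \<omega>
  define b where "b \<omega> = aug_lagrangian P \<beta> (u \<omega> (Suc k), y \<omega> k) (lam \<omega> k)" for \<omega>
  define E where "E \<omega> = (\<Sum>i\<in>blocks. (norm (e \<omega> k i))\<^sup>2)" for \<omega>
  define l where "l \<omega> = (norm (lam \<omega> k))\<^sup>2 / (2 * \<beta>)" for \<omega>
  have a: "integrable Pr a" unfolding a_def using integrable_aug_iff[OF L] R by simp
  have E: "integrable Pr E" unfolding E_def by (intro Bochner_Integration.integrable_sum L2_D(2) L2_e(1))
  have l: "integrable Pr l" unfolding l_def using L2_D(2)[OF L(3)] by simp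
  have um: "(\<lambda>\<omega>. u \<omega> (Suc k)) \<in> borel_measurable Pr" by (rule measurable_F[OF u_measurable_F])
  have bm: "b \<in> borel_measurable Pr"
    unfolding b_def by (rule aug_measurable[OF um L2_D(1)[OF L(2)] L2_D(1)[OF L(3)]])
  have path: "b \<omega> \<le> a \<omega> + E \<omega> / 2 - (\<tau> + 4 * L\<^sup>2 / \<beta>) * (norm (u \<omega> (Suc k) - u \<omega> k))\<^sup>2"
    "opt - l \<omega> \<le> b \<omega>" "y \<omega> (Suc k) = y \<omega> k - \<gamma> *\<^sub>R (grad_last P (u \<omega> (Suc k), y \<omega> k) + eN \<omega> k - lam \<omega> k
        + \<beta> *\<^sub>R residual P (u \<omega> (Suc k), y \<omega> k))"
    "lam \<omega> (Suc k) = lam \<omega> k - \<beta> *\<^sub>R residual P (u \<omega> (Suc k), y \<omega> (Suc k))"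
    if \<omega>: "\<omega> \<in> space Pr" for \<omega>
  proof -
    interpret admm_energy P L I1 \<beta> \<gamma> L H "e \<omega>" "eN \<omega>" "u \<omega>" "y \<omega>" "lam \<omega>" 4 1 \<tau> by (rule run[OF \<omega>])
    show "b \<omega> \<le> a \<omega> + E \<omega> / 2 - (\<tau> + 4 * L\<^sup>2 / \<beta>) * (norm (u \<omega> (Suc k) - u \<omega> k))\<^sup>2"
      using block_descent_rate[of k] by (simp add: a_def b_def E_def)
    show "opt - l \<omega> \<le> b \<omega>"
      using aug_lagrangian_lower_crude[of "lam \<omega> k" "Suc k" "y \<omega> k"] by (simp add: opt_def l_def b_def)
  qed (use admm_run.y_step[OF admm_energy.axioms(1)[OF run[OF \<omega>]]] admm_run.lam_step[OF admm_energy.axioms(1)[OF run[OF \<omega>]]] in auto)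
  have c0: "\<tau> + 4 * L\<^sup>2 / \<beta> > 0" using constants by (intro add_pos_nonneg) auto
  have du: "L2 (\<lambda>\<omega>. u \<omega> (Suc k) - u \<omega> k)"
  proof (rule L2_bound)
    show "(\<lambda>\<omega>. u \<omega> (Suc k) - u \<omega> k) \<in> borel_measurable Pr" using um L2_D(1)[OF L(1)] by simp
    show "integrable Pr (\<lambda>\<omega>. (a \<omega> + E \<omega> / 2 - opt + l \<omega>) / (\<tau> + 4 * L\<^sup>2 / \<beta>))" using a E l by simp
    show "(norm (u \<omega> (Suc k) - u \<omega> k))\<^sup>2 \<le> (a \<omega> + E \<omega> / 2 - opt + l \<omega>) / (\<tau> + 4 * L\<^sup>2 / \<beta>)" if "\<omega> \<in> space Pr" for \<omega>
    proof -
      have "(norm (u \<omega> (Suc k) - u \<omega> k))\<^sup>2 * (\<tau> + 4 * L\<^sup>2 / \<beta>) \<le> a \<omega> + E \<omega> / 2 - opt + l \<omega>"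
        using path(1,2)[OF that] by (simp only: mult.commute[of "(norm (u \<omega> (Suc k) - u \<omega> k))\<^sup>2"])
      then show ?thesis using c0 by (simp only: pos_le_divide_eq)
    qed
  qed
  have u': "L2 (\<lambda>\<omega>. u \<omega> (Suc k))" using L2_add[OF L(1) du] by simp
  \<comment> \<open>\<open>b\<close> lies between \<open>opt - l\<close> and
    \<open>a + E / 2\<close>, all integrable. By \<open>integrable_aug_iff\<close> this carries the
    integrability of the regularizers to the next iterate and closes the induction.\<close>
  have "integrable Pr b"
  proof (rule Bochner_Integration.integrable_bound[OF _ bm])
    show "integrable Pr (\<lambda>\<omega>. \<bar>a \<omega>\<bar> + E \<omega> / 2 + \<bar>opt\<bar> + l \<omega>)" using a E l by simp
    show "AE \<omega> in Pr. norm (b \<omega>) \<le> norm (\<bar>a \<omega>\<bar> + E \<omega> / 2 + \<bar>opt\<bar> + l \<omega>)"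
    proof (rule AE_I2)
      fix \<omega> assume \<omega>: "\<omega> \<in> space Pr"
      have "0 \<le> (\<tau> + 4 * L\<^sup>2 / \<beta>) * (norm (u \<omega> (Suc k) - u \<omega> k))\<^sup>2" using c0 by simp
      moreover have "0 \<le> E \<omega>" unfolding E_def by (intro sum_nonneg) simp
      moreover have "0 \<le> l \<omega>" unfolding l_def using constants by simp
      ultimately show "norm (b \<omega>) \<le> norm (\<bar>a \<omega>\<bar> + E \<omega> / 2 + \<bar>opt\<bar> + l \<omega>)"
        using path(1,2)[OF \<omega>] unfolding real_norm_def by linarith
    qed
  qed
  then have R': "integrable Pr (\<lambda>\<omega>. reg_sum (u \<omega> (Suc k)))"
    unfolding b_def using integrable_aug_iff[OF u' L(2,3)] by simp
  have "L2 (\<lambda>\<omega>. y \<omega> k - \<gamma> *\<^sub>R (grad_last P (u \<omega> (Suc k), y \<omega> k) + eN \<omega> k - lam \<omega> k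
        + \<beta> *\<^sub>R residual P (u \<omega> (Suc k), y \<omega> k)))"
    by (intro L2_diff L2_scaleR L2_add L2_grad_last L2_residual u' L L2_eN)
  then have y': "L2 (\<lambda>\<omega>. y \<omega> (Suc k))" by (rule L2_cong) (simp add: path(3))
  have "L2 (\<lambda>\<omega>. lam \<omega> k - \<beta> *\<^sub>R residual P (u \<omega> (Suc k), y \<omega> (Suc k)))"
    by (intro L2_diff L2_scaleR L2_residual u' L y')
  then have l': "L2 (\<lambda>\<omega>. lam \<omega> (Suc k))" by (rule L2_cong) (simp add: path(4))
  show ?case using u' y' l' R' by blast
qed

lemma L2_u: "L2 (\<lambda>\<omega>. u \<omega> k)" and L2_y: "L2 (\<lambda>\<omega>. y \<omega> k)" and L2_lam: "L2 (\<lambda>\<omega>. lam \<omega> k)"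
  and integrable_reg_sum: "integrable Pr (\<lambda>\<omega>. reg_sum (u \<omega> k))"
  using L2_iterates[of k] by auto

abbreviation step where "step k \<equiv> \<lambda>\<omega>. step_sq (u \<omega>) (y \<omega>) k"

lemma integrable_step: "integrable Pr (step k)"
  unfolding step_sq_def
  using L2_D(2)[OF L2_diff[OF L2_u[of "Suc k"] L2_u[of k]]] L2_D(2)[OF L2_diff[OF L2_y[of "Suc k"] L2_y[of k]]] by simp

section \<open>The energy inequality in expectation\<close>

definition Psi where
  "Psi k \<omega> = Psi_S P L \<beta> \<gamma> (u \<omega> k, y \<omega> k) (lam \<omega> k) (y \<omega> (k - 1))"

lemma integrable_Psi: "integrable Pr (Psi k)"
  unfolding Psi_def Psi_S_def
  using integrable_aug_iff[OF L2_u[of k] L2_y[of k] L2_lam[of k], of \<beta>] integrable_reg_sum[of k]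
    L2_D(2)[OF L2_diff[OF L2_y[of "k - 1"] L2_y[of k]]] by simp

definition noise where
  "noise k \<omega> = 1 / 2 * ((\<Sum>i\<in>blocks. (norm (e \<omega> k i))\<^sup>2) + (norm (eN \<omega> k))\<^sup>2)
     + 4 / \<beta> * (norm (eN \<omega> k - eN \<omega> (k - 1)))\<^sup>2"

text \<open>Equals \<tau> \<kappa>_4 / 2 times the batch variance: N / 2 comes from the N gradient
  errors of one iteration, 8 / \<beta> from 4 / \<beta> times the doubled variance.\<close>

definition noise_rate where "noise_rate = (8 / \<beta> + real N / 2) * noise_var"

lemma eN_diff_second_moment':
  assumes "k \<ge> 1"
  shows "integrable Pr (\<lambda>\<omega>. (norm (eN \<omega> k - eN \<omega> (k - 1)))\<^sup>2)"
  "expectation (\<lambda>\<omega>. (norm (eN \<omega> k - eN \<omega> (k - 1)))\<^sup>2) \<le> 2 * noise_var"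
  using eN_diff_second_moment[of "k - 1"] assms by auto

lemma noise_bound:
  assumes "k \<ge> 1"
  shows "integrable Pr (noise k)" "expectation (noise k) \<le> noise_rate"
proof -
  note d = eN_diff_second_moment'[OF assms]
  have ei: "integrable Pr (\<lambda>\<omega>. (norm (e \<omega> k i))\<^sup>2)" if "i \<in> blocks" for i
    by (rule L2_D(2)[OF L2_e(1)[OF that]])
  have si: "integrable Pr (\<lambda>\<omega>. \<Sum>i\<in>blocks. (norm (e \<omega> k i))\<^sup>2)" using ei by (rule Bochner_Integration.integrable_sum)
  have ni: "integrable Pr (\<lambda>\<omega>. (norm (eN \<omega> k))\<^sup>2)" by (rule L2_D(2)[OF L2_eN(1)])
  show "integrable Pr (noise k)" unfolding noise_def using si ni d(1) by simp
  have "expectation (\<lambda>\<omega>. \<Sum>i\<in>blocks. (norm (e \<omega> k i))\<^sup>2) = (\<Sum>i\<in>blocks. expectation (\<lambda>\<omega>. (norm (e \<omega> k i))\<^sup>2))"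
    using ei by (rule Bochner_Integration.integral_sum)
  also have "\<dots> \<le> (\<Sum>i\<in>blocks. noise_var)" by (intro sum_mono L2_e(2))
  also have "\<dots> = (real N - 1) * noise_var" using N_ge_2 by (simp add: of_nat_diff)
  finally have s: "expectation (\<lambda>\<omega>. \<Sum>i\<in>blocks. (norm (e \<omega> k i))\<^sup>2) \<le> (real N - 1) * noise_var" .
  have d': "4 / \<beta> * expectation (\<lambda>\<omega>. (norm (eN \<omega> k - eN \<omega> (k - 1)))\<^sup>2) \<le> 4 / \<beta> * (2 * noise_var)"
    using d(2) constants by (intro mult_left_mono) auto
  have eq: "expectation (noise k) = 1 / 2 * (expectation (\<lambda>\<omega>. \<Sum>i\<in>blocks. (norm (e \<omega> k i))\<^sup>2)
      + expectation (\<lambda>\<omega>. (norm (eN \<omega> k))\<^sup>2)) + 4 / \<beta> * expectation (\<lambda>\<omega>. (norm (eN \<omega> k - eN \<omega> (k - 1)))\<^sup>2)"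
    unfolding noise_def using si ni d(1) by simp
  have "expectation (noise k) \<le> 1 / 2 * ((real N - 1) * noise_var + noise_var) + 4 / \<beta> * (2 * noise_var)"
    unfolding eq by (intro add_mono mult_left_mono[of _ _ "1 / 2"] s L2_eN(2) d') simp
  also have "\<dots> = noise_rate"
  proof -
    have "1 / 2 * ((n - 1) * v + v) + 4 / b * (2 * v) = (8 / b + n / 2) * v" for n v b :: real
      by (simp add: algebra_simps diff_divide_distrib)
    then show ?thesis unfolding noise_rate_def .
  qed
  finally show "expectation (noise k) \<le> noise_rate" .
qed

lemma expected_descent:
  assumes k: "k \<ge> 1"
  shows "expectation (Psi (Suc k)) \<le> expectation (Psi k) - \<tau> * expectation (step k) + noise_rate"
proof -
  have "expectation (Psi (Suc k)) \<le> expectation (\<lambda>\<omega>. Psi k \<omega> - \<tau> * step k \<omega> + noise k \<omega>)"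
  proof (rule integral_mono)
    show "Psi (Suc k) \<omega> \<le> Psi k \<omega> - \<tau> * step k \<omega> + noise k \<omega>" if \<omega>: "\<omega> \<in> space Pr" for \<omega>
    proof -
      interpret admm_energy P L I1 \<beta> \<gamma> L H "e \<omega>" "eN \<omega>" "u \<omega>" "y \<omega>" "lam \<omega>" 4 1 \<tau> by (rule run[OF \<omega>])
      show ?thesis
        using energy_descent[OF k] by (simp add: Psi_def Psi_S_def energy_def noise_def energy_noise_def)
    qed
  qed (use integrable_Psi[of k] integrable_Psi[of "Suc k"] integrable_step[of k] noise_bound(1)[OF k] in auto)
  also have "\<dots> = expectation (Psi k) - \<tau> * expectation (step k) + expectation (noise k)"
    using integrable_Psi[of k] integrable_step[of k] noise_bound(1)[OF k] by simp
  finally show ?thesis using noise_bound(2)[OF k] by linarith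
qed

lemma expected_lower:
  assumes k: "k \<ge> 1"
  shows "opt - 2 * \<sigma>\<^sup>2 / \<beta> \<le> expectation (Psi k)"
proof -
  have ni: "integrable Pr (\<lambda>\<omega>. (norm (eN \<omega> (k - 1)))\<^sup>2)" by (rule L2_D(2)[OF L2_eN(1)])
  \<comment> \<open>Drops the batch size, so that the bound matches the summand 2 \<sigma>^2 /
    \<beta> in the iteration count.\<close>
  have "noise_var \<le> \<sigma>\<^sup>2" using M1 by (simp add: divide_le_eq mult_le_cancel_left1)
  then have "2 / \<beta> * expectation (\<lambda>\<omega>. (norm (eN \<omega> (k - 1)))\<^sup>2) \<le> 2 / \<beta> * \<sigma>\<^sup>2"
    using L2_eN(2)[of "k - 1"] constants by (intro mult_left_mono) auto
  moreover have "opt - 2 / \<beta> * expectation (\<lambda>\<omega>. (norm (eN \<omega> (k - 1)))\<^sup>2)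
      = expectation (\<lambda>\<omega>. opt - 2 / \<beta> * (norm (eN \<omega> (k - 1)))\<^sup>2)"
    using ni by (simp add: prob_space)
  moreover have "\<dots> \<le> expectation (Psi k)"
  proof (rule integral_mono)
    show "opt - 2 / \<beta> * (norm (eN \<omega> (k - 1)))\<^sup>2 \<le> Psi k \<omega>" if \<omega>: "\<omega> \<in> space Pr" for \<omega>
    proof -
      interpret admm_energy P L I1 \<beta> \<gamma> L H "e \<omega>" "eN \<omega>" "u \<omega>" "y \<omega>" "lam \<omega>" 4 1 \<tau> by (rule run[OF \<omega>])
      show ?thesis
        using energy_lower[OF k] by (simp add: Psi_def Psi_S_def energy_def opt_def opt_value_def)
    qed
  qed (use integrable_Psi[of k] ni in auto)
  ultimately show ?thesis by simp
qed

lemma expected_step_sum: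
  "\<tau> * (\<Sum>k\<in>{1..n}. expectation (step k)) \<le> (expectation (Psi 1) - opt + 2 * \<sigma>\<^sup>2 / \<beta>) + real n * noise_rate"
proof -
  have "\<tau> * (\<Sum>k\<in>{1..n}. expectation (step k)) \<le> expectation (Psi 1) - expectation (Psi (Suc n)) + real n * noise_rate"
  proof (induction n)
    case (Suc n)
    show ?case using Suc expected_descent[of "Suc n"] by (simp add: distrib_left distrib_right)
  qed (simp add: One_nat_def)
  then show ?thesis using expected_lower[of "Suc n"] by simp
qed

lemma integral_theta:
  assumes "k \<ge> 1"
  shows "expectation (\<lambda>\<omega>. theta P (u \<omega>) (y \<omega>) k) = expectation (step k) + expectation (step (k - 1))"
  using integrable_step[of k] integrable_step[of "k - 1"] by (simp add: theta_eq[OF assms])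

lemma integrable_theta: "k \<ge> 1 \<Longrightarrow> integrable Pr (\<lambda>\<omega>. theta P (u \<omega>) (y \<omega>) k)"
  using integrable_step[of k] integrable_step[of "k - 1"] by (simp add: theta_eq)


text \<open>The target \<epsilon>^2 is split in halves: the iteration count K pays for the part of
  \<open>T\<close> without noise, the batch size M for all variance terms.\<close>

lemma moment_budget:
  fixes T :: real
  assumes T: "T \<le> \<epsilon>\<^sup>2 / (2 * \<kappa>) + \<kappa>4 * noise_var" and \<kappa>: "0 \<le> \<kappa>'" "\<kappa>' \<le> \<kappa>" "0 < \<kappa>"
    and X: "\<kappa>' * \<kappa>4 + a \<le> X" and M: "real M \<ge> 2 * \<sigma>\<^sup>2 / \<epsilon>\<^sup>2 * X" and \<epsilon>: "\<epsilon> > 0"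
  shows "\<kappa>' * T + a * noise_var \<le> \<epsilon>\<^sup>2"
proof -
  have M0: "real M > 0" using M1 by simp
  have v0: "noise_var \<ge> 0" by simp
  have "\<kappa>' * T \<le> \<kappa>' * (\<epsilon>\<^sup>2 / (2 * \<kappa>) + \<kappa>4 * noise_var)" using T \<kappa>(1) by (rule mult_left_mono)
  also have "\<dots> = \<kappa>' * (\<epsilon>\<^sup>2 / (2 * \<kappa>)) + \<kappa>' * \<kappa>4 * noise_var" by (simp add: distrib_left)
  also have "\<kappa>' * (\<epsilon>\<^sup>2 / (2 * \<kappa>)) \<le> \<kappa> * (\<epsilon>\<^sup>2 / (2 * \<kappa>))"
    using \<kappa> by (intro mult_right_mono) auto
  also have "\<kappa> * (\<epsilon>\<^sup>2 / (2 * \<kappa>)) = \<epsilon>\<^sup>2 / 2" using \<kappa>(3) by simp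
  finally have 1: "\<kappa>' * T + a * noise_var \<le> \<epsilon>\<^sup>2 / 2 + (\<kappa>' * \<kappa>4 + a) * noise_var"
    unfolding distrib_right by linarith
  have "(\<kappa>' * \<kappa>4 + a) * noise_var \<le> X * noise_var" by (rule mult_right_mono[OF X v0])
  moreover have "X * noise_var \<le> \<epsilon>\<^sup>2 / 2"
  proof -
    have "2 * \<sigma>\<^sup>2 * X \<le> real M * \<epsilon>\<^sup>2" using M \<epsilon> by (simp add: field_simps)
    then show ?thesis using M0 by (simp add: field_simps)
  qed
  ultimately show ?thesis using 1 by linarith
qed

lemma eps_stationary_stochastic:
  assumes \<epsilon>: "\<epsilon> > 0"
    and \<kappa>: "\<kappa> = Max {4 / \<beta>\<^sup>2 * ((\<beta> - 1 / \<gamma>)\<^sup>2 + L\<^sup>2), 3 * ((\<beta> - 1 / \<gamma>)\<^sup>2 + L\<^sup>2), 2 * (Q_const P L \<beta> H)\<^sup>2}"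
    and \<kappa>4: "\<kappa>4 = 2 / \<tau> * (8 / \<beta> + real N / 2)"
    and M: "real M \<ge> 2 * \<sigma>\<^sup>2 / \<epsilon>\<^sup>2 * Max {4 / \<beta>\<^sup>2 * ((\<beta> - 1 / \<gamma>)\<^sup>2 + L\<^sup>2) * \<kappa>4 + 8 / \<beta>\<^sup>2,
        3 * ((\<beta> - 1 / \<gamma>)\<^sup>2 + L\<^sup>2) * \<kappa>4 + 3, 2 * (Q_const P L \<beta> H)\<^sup>2 * \<kappa>4 + 2}"
    and K: "K = nat \<lceil>4 * \<kappa> / (\<tau> * \<epsilon>\<^sup>2) * (expectation (Psi 1) - opt + 2 * \<sigma>\<^sup>2 / \<beta>)\<rceil>"
    and ks: "is_arg_min (\<lambda>k. expectation (\<lambda>\<omega>. theta P (u \<omega>) (y \<omega>) k)) (\<lambda>k. k \<in> {2..K + 1}) ks"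
  shows "eps_stationary_in_expectation P I1 Pr \<epsilon> (\<lambda>\<omega>. (u \<omega> (ks + 1), y \<omega> (ks + 1))) (\<lambda>\<omega>. lam \<omega> (ks + 1))"
proof -
  let ?s = "\<beta> - 1 / \<gamma>"
  define \<kappa>1 \<kappa>2 \<kappa>3 where "\<kappa>1 = 4 / \<beta>\<^sup>2 * (?s\<^sup>2 + L\<^sup>2)" and "\<kappa>2 = 3 * (?s\<^sup>2 + L\<^sup>2)" and "\<kappa>3 = 2 * (Q_const P L \<beta> H)\<^sup>2"
  note \<kappa>_defs = \<kappa>1_def \<kappa>2_def \<kappa>3_def
  define X where "X = Max {\<kappa>1 * \<kappa>4 + 8 / \<beta>\<^sup>2, \<kappa>2 * \<kappa>4 + 3, \<kappa>3 * \<kappa>4 + 2}"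
  have MX: "real M \<ge> 2 * \<sigma>\<^sup>2 / \<epsilon>\<^sup>2 * X" using M unfolding X_def \<kappa>_defs .
  have \<kappa>i: "\<kappa>1 \<le> \<kappa>" "\<kappa>2 \<le> \<kappa>" "\<kappa>3 \<le> \<kappa>"
    unfolding \<kappa> \<kappa>_defs by (rule Max_ge; simp)+
  have Xi: "\<kappa>1 * \<kappa>4 + 8 / \<beta>\<^sup>2 \<le> X" "\<kappa>2 * \<kappa>4 + 3 \<le> X" "\<kappa>3 * \<kappa>4 + 2 \<le> X"
    unfolding X_def by (rule Max_ge; simp)+
  have nn: "0 \<le> \<kappa>1" "0 \<le> \<kappa>2" "0 \<le> \<kappa>3" by (simp_all add: \<kappa>_defs)
  have Q0: "Q_const P L \<beta> H > 0" using Q_const_pos[OF constants(1)] .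
  then have "\<kappa>3 > 0" by (simp add: \<kappa>3_def)
  then have \<kappa>0: "\<kappa> > 0" using \<kappa>i(3) by linarith
  have ks2: "ks \<in> {2..K + 1}" using ks by (simp add: is_arg_min_def)
  then have ks1: "ks \<ge> 1" and K1: "K \<ge> 1" by auto
  define T where "T = expectation (\<lambda>\<omega>. theta P (u \<omega>) (y \<omega>) ks)"
  define C where "C = expectation (Psi 1) - opt + 2 * \<sigma>\<^sup>2 / \<beta>"
  have a: "4 * \<kappa> / (\<tau> * \<epsilon>\<^sup>2) > 0" using \<kappa>0 constants \<epsilon> by simp
  note C = ceiling_iterations[OF K[folded C_def] K1 a]
  have min: "T \<le> expectation (\<lambda>\<omega>. theta P (u \<omega>) (y \<omega>) k)" if "k \<in> {2..K + 1}" for k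
    using ks that unfolding T_def by (auto simp: is_arg_min_linorder)
  have "\<tau> * (expectation (step ks) + expectation (step (ks - 1))) \<le> 2 * C / real K + 2 * noise_rate"
  proof (rule min_consecutive_pair_le[OF expected_step_sum[folded C_def] _ K1 C(1) constants(3)])
    fix k assume k: "k \<in> {2..K + 1}"
    then have k1: "k \<ge> 1" by simp
    show "expectation (step ks) + expectation (step (ks - 1)) \<le> expectation (step k) + expectation (step (k - 1))"
      using min[OF k] unfolding T_def integral_theta[OF ks1] integral_theta[OF k1] .
  qed
  then have "\<tau> * T \<le> 2 * (C / real K) + 2 * noise_rate" unfolding T_def integral_theta[OF ks1] by simp
  \<comment> \<open>The factor 4 in K, twice the deterministic one, leaves half of the budget
    \<epsilon>^2 / \<kappa> to the noise.\<close>
  also have "\<dots> \<le> 2 * (1 / (4 * \<kappa> / (\<tau> * \<epsilon>\<^sup>2))) + 2 * noise_rate" using C(2) by simp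
  also have "\<dots> = \<tau> * (\<epsilon>\<^sup>2 / (2 * \<kappa>) + \<kappa>4 * noise_var)"
    using constants(3) by (simp add: \<kappa>4 noise_rate_def distrib_left)
  finally have T: "T \<le> \<epsilon>\<^sup>2 / (2 * \<kappa>) + \<kappa>4 * noise_var"
    by (rule mult_left_le_imp_le[OF _ constants(3)])
  note budget1 = moment_budget[OF T nn(1) \<kappa>i(1) \<kappa>0 Xi(1) MX \<epsilon>]
    and budget2 = moment_budget[OF T nn(2) \<kappa>i(2) \<kappa>0 Xi(2) MX \<epsilon>]
    and budget3 = moment_budget[OF T nn(3) \<kappa>i(3) \<kappa>0 Xi(3) MX \<epsilon>]
  note it = integrable_theta[OF ks1]
  have eNi: "integrable Pr (\<lambda>\<omega>. (norm (eN \<omega> ks))\<^sup>2)" by (rule L2_D(2)[OF L2_eN(1)])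
  note dN = eN_diff_second_moment'[OF ks1]
  have um: "(\<lambda>\<omega>. u \<omega> k) \<in> borel_measurable Pr" and ym: "(\<lambda>\<omega>. y \<omega> k) \<in> borel_measurable Pr"
    and lm: "(\<lambda>\<omega>. lam \<omega> k) \<in> borel_measurable Pr" for k
    using L2_D(1)[OF L2_u] L2_D(1)[OF L2_y] L2_D(1)[OF L2_lam] by auto
  have rm: "(\<lambda>\<omega>. residual P (u \<omega> (Suc ks), y \<omega> (Suc ks))) \<in> borel_measurable Pr"
    by (rule L2_D(1)[OF L2_residual[OF L2_u L2_y]])
  have gm: "(\<lambda>\<omega>. grad_last P (u \<omega> (Suc ks), y \<omega> (Suc ks)) - lam \<omega> (Suc ks)) \<in> borel_measurable Pr"
    by (rule L2_D(1)[OF L2_diff[OF L2_grad_last[OF L2_u L2_y] L2_lam]])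
  have path:
    "(norm (residual P (u \<omega> (Suc ks), y \<omega> (Suc ks))))\<^sup>2
      \<le> \<kappa>1 * theta P (u \<omega>) (y \<omega>) ks + 4 / \<beta>\<^sup>2 * (norm (eN \<omega> ks - eN \<omega> (ks - 1)))\<^sup>2"
    "(norm (grad_last P (u \<omega> (Suc ks), y \<omega> (Suc ks)) - lam \<omega> (Suc ks)))\<^sup>2
      \<le> \<kappa>2 * theta P (u \<omega>) (y \<omega>) ks + 3 * (norm (eN \<omega> ks))\<^sup>2"
    "i \<in> blocks \<Longrightarrow> block_gap P I1 i (u \<omega> (Suc ks), y \<omega> (Suc ks)) (lam \<omega> (Suc ks))
        \<le> ennreal (Q_const P L \<beta> H * sqrt (step ks \<omega>) + norm (e \<omega> ks i))"
    "step ks \<omega> \<le> theta P (u \<omega>) (y \<omega>) ks"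
    "i \<in> blocks \<Longrightarrow> part P i (u \<omega> (Suc ks)) \<in> feasible_block P i"
    if \<omega>: "\<omega> \<in> space Pr" for \<omega> i
  proof -
    interpret admm_energy P L I1 \<beta> \<gamma> L H "e \<omega>" "eN \<omega>" "u \<omega>" "y \<omega>" "lam \<omega>" 4 1 \<tau> by (rule run[OF \<omega>])
    show "(norm (residual P (u \<omega> (Suc ks), y \<omega> (Suc ks))))\<^sup>2
      \<le> \<kappa>1 * theta P (u \<omega>) (y \<omega>) ks + 4 / \<beta>\<^sup>2 * (norm (eN \<omega> ks - eN \<omega> (ks - 1)))\<^sup>2"
      using residual_sq_le[OF ks1] unfolding \<kappa>1_def .
    let ?d = "norm (y \<omega> (Suc ks) - y \<omega> ks)"
    have "(norm (grad_last P (u \<omega> (Suc ks), y \<omega> (Suc ks)) - lam \<omega> (Suc ks)))\<^sup>2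
        \<le> (L * ?d + \<bar>?s\<bar> * ?d + norm (eN \<omega> ks))\<^sup>2"
      by (intro power_mono grad_last_gap_le) simp
    \<comment> \<open>Three summands explain the factor 3 in \<kappa>_2. Keeping the squares of L
      and of the step size deviation separate lets the error enter on equal terms.\<close>
    also have "\<dots> \<le> 3 * ((L * ?d)\<^sup>2 + (\<bar>?s\<bar> * ?d)\<^sup>2 + (norm (eN \<omega> ks))\<^sup>2)" by (rule square_sum3_le)
    also have "\<dots> = \<kappa>2 * ?d\<^sup>2 + 3 * (norm (eN \<omega> ks))\<^sup>2"
      by (simp add: \<kappa>2_def power_mult_distrib algebra_simps)
    also have "\<dots> \<le> \<kappa>2 * theta P (u \<omega>) (y \<omega>) ks + 3 * (norm (eN \<omega> ks))\<^sup>2"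
      by (intro add_right_mono mult_left_mono dist_y_le_theta ks1 nn)
    finally show "(norm (grad_last P (u \<omega> (Suc ks), y \<omega> (Suc ks)) - lam \<omega> (Suc ks)))\<^sup>2
      \<le> \<kappa>2 * theta P (u \<omega>) (y \<omega>) ks + 3 * (norm (eN \<omega> ks))\<^sup>2" .
    show "i \<in> blocks \<Longrightarrow> block_gap P I1 i (u \<omega> (Suc ks), y \<omega> (Suc ks)) (lam \<omega> (Suc ks))
        \<le> ennreal (Q_const P L \<beta> H * sqrt (step ks \<omega>) + norm (e \<omega> ks i))"
      by (rule block_gap_bound)
    show "step ks \<omega> \<le> theta P (u \<omega>) (y \<omega>) ks" by (rule step_sq_le_theta[OF ks1])
    show "i \<in> blocks \<Longrightarrow> part P i (u \<omega> (Suc ks)) \<in> feasible_block P i" by (rule feasible)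
  qed
  have res: "upper_expectation Pr (\<lambda>\<omega>. ennreal (norm (residual P (u \<omega> (Suc ks), y \<omega> (Suc ks))))) \<le> ennreal \<epsilon>"
  proof (rule upper_expectation_le[OF _ _ order.refl _ path(1) _ \<epsilon>])
    have "expectation (\<lambda>\<omega>. \<kappa>1 * theta P (u \<omega>) (y \<omega>) ks + 4 / \<beta>\<^sup>2 * (norm (eN \<omega> ks - eN \<omega> (ks - 1)))\<^sup>2)
        = \<kappa>1 * T + 4 / \<beta>\<^sup>2 * expectation (\<lambda>\<omega>. (norm (eN \<omega> ks - eN \<omega> (ks - 1)))\<^sup>2)"
      using it dN(1) by (simp add: T_def)
    also have "\<dots> \<le> \<kappa>1 * T + 4 / \<beta>\<^sup>2 * (2 * noise_var)"
      using dN(2) by (intro add_left_mono mult_left_mono) auto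
    also have "\<dots> \<le> \<epsilon>\<^sup>2" using budget1 by simp
    finally show "expectation (\<lambda>\<omega>. \<kappa>1 * theta P (u \<omega>) (y \<omega>) ks + 4 / \<beta>\<^sup>2 * (norm (eN \<omega> ks - eN \<omega> (ks - 1)))\<^sup>2) \<le> \<epsilon>\<^sup>2" .
  qed (use it dN(1) rm in auto)
  have grd: "upper_expectation Pr (\<lambda>\<omega>. ennreal (norm (grad_last P (u \<omega> (Suc ks), y \<omega> (Suc ks)) - lam \<omega> (Suc ks)))) \<le> ennreal \<epsilon>"
  proof (rule upper_expectation_le[OF _ _ order.refl _ path(2) _ \<epsilon>])
    have "expectation (\<lambda>\<omega>. \<kappa>2 * theta P (u \<omega>) (y \<omega>) ks + 3 * (norm (eN \<omega> ks))\<^sup>2)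
        = \<kappa>2 * T + 3 * expectation (\<lambda>\<omega>. (norm (eN \<omega> ks))\<^sup>2)"
      using it eNi by (simp add: T_def)
    also have "\<dots> \<le> \<kappa>2 * T + 3 * noise_var" using L2_eN(2)[of ks] by simp
    also have "\<dots> \<le> \<epsilon>\<^sup>2" by (rule budget2)
    finally show "expectation (\<lambda>\<omega>. \<kappa>2 * theta P (u \<omega>) (y \<omega>) ks + 3 * (norm (eN \<omega> ks))\<^sup>2) \<le> \<epsilon>\<^sup>2" .
  qed (use it eNi gm in auto)
  have gap: "upper_expectation Pr (\<lambda>\<omega>. block_gap P I1 i (u \<omega> (Suc ks), y \<omega> (Suc ks)) (lam \<omega> (Suc ks))) \<le> ennreal \<epsilon>"
    if i: "i \<in> blocks" for i
  proof (rule upper_expectation_le[OF _ _ path(3)[OF _ i] _ _ _ \<epsilon>])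
    have s0: "0 \<le> step ks \<omega>" for \<omega> by (simp add: step_sq_def)
    show "(\<lambda>\<omega>. Q_const P L \<beta> H * sqrt (step ks \<omega>) + norm (e \<omega> ks i)) \<in> borel_measurable Pr"
      using integrable_step[of ks] L2_D(1)[OF L2_e(1)[OF i, of ks]] by simp
    show "0 \<le> Q_const P L \<beta> H * sqrt (step ks \<omega>) + norm (e \<omega> ks i)" for \<omega>
      using Q0 s0[of \<omega>] by simp
    have ei: "integrable Pr (\<lambda>\<omega>. (norm (e \<omega> ks i))\<^sup>2)" by (rule L2_D(2)[OF L2_e(1)[OF i]])
    show "integrable Pr (\<lambda>\<omega>. \<kappa>3 * theta P (u \<omega>) (y \<omega>) ks + 2 * (norm (e \<omega> ks i))\<^sup>2)" using it ei by simp
    show "(Q_const P L \<beta> H * sqrt (step ks \<omega>) + norm (e \<omega> ks i))\<^sup>2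
        \<le> \<kappa>3 * theta P (u \<omega>) (y \<omega>) ks + 2 * (norm (e \<omega> ks i))\<^sup>2" if \<omega>: "\<omega> \<in> space Pr" for \<omega>
    proof -
      let ?q = "Q_const P L \<beta> H * sqrt (step ks \<omega>)" and ?e = "norm (e \<omega> ks i)"
      have "0 \<le> (?q - ?e)\<^sup>2" by simp
      \<comment> \<open>The doubling of Q^2 in \<kappa>_3, and the summand 2 in the batch size
        condition, come from splitting this square.\<close>
      then have "(?q + ?e)\<^sup>2 \<le> 2 * ?q\<^sup>2 + 2 * ?e\<^sup>2" by (simp only: power2_sum power2_diff)
      also have "2 * ?q\<^sup>2 = \<kappa>3 * step ks \<omega>" using s0[of \<omega>] by (simp add: \<kappa>3_def power_mult_distrib)
      also have "\<dots> \<le> \<kappa>3 * theta P (u \<omega>) (y \<omega>) ks" by (intro mult_left_mono path(4)[OF \<omega>] nn)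
      finally show ?thesis by simp
    qed
    have "expectation (\<lambda>\<omega>. \<kappa>3 * theta P (u \<omega>) (y \<omega>) ks + 2 * (norm (e \<omega> ks i))\<^sup>2)
        = \<kappa>3 * T + 2 * expectation (\<lambda>\<omega>. (norm (e \<omega> ks i))\<^sup>2)"
      using it ei by (simp add: T_def)
    also have "\<dots> \<le> \<kappa>3 * T + 2 * noise_var" using L2_e(2)[OF i, of ks] by simp
    also have "\<dots> \<le> \<epsilon>\<^sup>2" by (rule budget3)
    finally show "expectation (\<lambda>\<omega>. \<kappa>3 * theta P (u \<omega>) (y \<omega>) ks + 2 * (norm (e \<omega> ks i))\<^sup>2) \<le> \<epsilon>\<^sup>2" .
  qed
  show ?thesis
    unfolding eps_stationary_in_expectation_def Suc_eq_plus1[symmetric] fst_conv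
    using um ym lm path(5) res grd gap by simp
qed

end

lemma (in block_problem) stochastic_case:
  assumes \<Delta>: "\<Delta> = 17 * \<beta>\<^sup>2 - 16 * (L + 1) * \<beta> - 128 * L\<^sup>2"
    and \<kappa>: "\<kappa> = Max {4 / \<beta>\<^sup>2 * ((\<beta> - 1 / \<gamma>)\<^sup>2 + L\<^sup>2), 3 * ((\<beta> - 1 / \<gamma>)\<^sup>2 + L\<^sup>2), 2 * (Q_const P L \<beta> H)\<^sup>2}"
    and \<tau>: "\<tau> = min (- ((\<beta> + L) / 2 - 1 / \<gamma> + 8 / \<beta> * (\<beta> - 1 / \<gamma>)\<^sup>2 + 4 * L\<^sup>2 / \<beta> + 1 / 2))
                    (Min ((\<lambda>i. sigma_min P i (H i) / 2 - 4 * L\<^sup>2 / \<beta> - (L + 1) / 2) ` blocks))"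
    and \<kappa>4: "\<kappa>4 = 2 / \<tau> * (8 / \<beta> + real N / 2)"
    and K: "K = nat \<lceil>4 * \<kappa> / (\<tau> * \<epsilon>\<^sup>2) *
        (integral\<^sup>L Pr (\<lambda>\<omega>. Psi_S P L \<beta> \<gamma> (u \<omega> 1, y \<omega> 1) (lam \<omega> 1) (y \<omega> 0))
          - (\<Sum>i\<in>blocks. reg_opt P i) - obj_opt P + 2 * \<sigma>\<^sup>2 / \<beta>)\<rceil>"
    and \<beta>: "\<beta> > (8 * (L + 1) + 8 * sqrt ((L + 1)\<^sup>2 + 34 * L\<^sup>2)) / 17"
    and \<gamma>: "16 / (17 * \<beta> + sqrt \<Delta>) < \<gamma>" "\<gamma> < 16 / (17 * \<beta> - sqrt \<Delta>)"
    and H: "\<forall>i\<in>blocks. sym_block_matrix P i (H i) \<and> block_succ P i (H i) (8 * L\<^sup>2 / \<beta> + L + 1)"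
    and M1: "M \<ge> 1"
    and M: "real M \<ge> 2 * \<sigma>\<^sup>2 / \<epsilon>\<^sup>2 * Max {4 / \<beta>\<^sup>2 * ((\<beta> - 1 / \<gamma>)\<^sup>2 + L\<^sup>2) * \<kappa>4 + 8 / \<beta>\<^sup>2,
        3 * ((\<beta> - 1 / \<gamma>)\<^sup>2 + L\<^sup>2) * \<kappa>4 + 3, 2 * (Q_const P L \<beta> H)\<^sup>2 * \<kappa>4 + 2}"
    and or: "oracle_assms P D G GN \<sigma>"
    and alg: "algorithm3 P Pr D G GN \<xi> M \<beta> \<gamma> H u y lam"
    and I1: "\<And>i. i \<in> I1 \<Longrightarrow> convex_on UNIV (reg P i)"
    and \<epsilon>: "\<epsilon> > 0"
    and ks: "is_arg_min (\<lambda>k. integral\<^sup>L Pr (\<lambda>\<omega>. theta P (u \<omega>) (y \<omega>) k)) (\<lambda>k. k \<in> {2..K + 1}) ks"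
  shows "eps_stationary_in_expectation P I1 Pr \<epsilon> (\<lambda>\<omega>. (u \<omega> (ks + 1), y \<omega> (ks + 1))) (\<lambda>\<omega>. lam \<omega> (ks + 1))"
proof -
  note st = stepsize_stochastic[OF L_pos \<Delta> \<beta> \<gamma>]
  have \<beta>0: "\<beta> > 0" using st(1) L_pos by linarith
  \<comment> \<open>The share L + 1 is the linearization loss L plus 1 for the gradient
    errors.\<close>
  have H': "sym_block_matrix P i (H i) \<and> block_succ P i (H i) (2 * 4 * L\<^sup>2 / \<beta> + (L + 1))" if "i \<in> blocks" for i
    using H that by (simp add: add.assoc)
  have L1: "L + 1 \<ge> 0" using L_pos by simp
  note tau = decrease_rate_bounds[OF H' \<beta>0 _ L1 st(3) \<tau>]
  \<comment> \<open>Chosen as the actual deviation from the exact gradient, so that each path fits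
    the linearized scheme with errors.\<close>
  define e where "e = (\<lambda>\<omega> k i. batch_mean M (G i (query P (u \<omega>) (y \<omega>) k i)) (\<lambda>j. \<xi> k i j \<omega>)
      - grad_block P i (query P (u \<omega>) (y \<omega>) k i))"
  define eN where "eN = (\<lambda>\<omega> k. batch_mean M (GN (u \<omega> (Suc k), y \<omega> k)) (\<lambda>j. \<xi> k N j \<omega>)
      - grad_last P (u \<omega> (Suc k), y \<omega> k))"
  obtain F where F: "fresh_sampling P Pr F D M \<xi>" "adapted_iterates P Pr F u y lam"
    using alg unfolding algorithm3_def by blast
  have run: "admm_energy P L I1 \<beta> \<gamma> L H (e \<omega>) (eN \<omega>) (u \<omega>) (y \<omega>) (lam \<omega>) 4 1 \<tau>" if \<omega>: "\<omega> \<in> space Pr" for \<omega>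
  proof -
    have "admm_run P L I1 \<beta> \<gamma> L H (e \<omega>) (eN \<omega>) (u \<omega>) (y \<omega>) (lam \<omega>)"
    proof (rule admm_run_Phi[OF \<beta>0 st(2) I1])
      show "scheme P \<beta> \<gamma> H
          (\<lambda>k i z. Phi P \<beta> i z (query P (u \<omega>) (y \<omega>) k i) (lam \<omega> k)
                     (batch_mean M (G i (query P (u \<omega>) (y \<omega>) k i)) (\<lambda>j. \<xi> k i j \<omega>)))
          (\<lambda>k. batch_mean M (GN (u \<omega> (Suc k), y \<omega> k)) (\<lambda>j. \<xi> k N j \<omega>))
          (u \<omega>) (y \<omega>) (lam \<omega>)"
        using alg \<omega> unfolding algorithm3_def by blast
    qed (use H in \<open>auto simp: e_def eN_def sym_block_matrix_def\<close>)
    then interpret admm_run P L I1 \<beta> \<gamma> L H "e \<omega>" "eN \<omega>" "u \<omega>" "y \<omega>" "lam \<omega>" .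
    show ?thesis by unfold_locales (use tau st(1) in auto)
  qed
  interpret admm_stochastic P L I1 \<beta> \<gamma> \<tau> \<sigma> H Pr F D G GN \<xi> M u y lam e eN
    by (intro admm_stochastic.intro admm_stochastic_axioms.intro block_problem_axioms F or M1 run)
       (simp_all add: e_def eN_def)
  have "expectation (Psi 1) - opt = integral\<^sup>L Pr (\<lambda>\<omega>. Psi_S P L \<beta> \<gamma> (u \<omega> 1, y \<omega> 1) (lam \<omega> 1) (y \<omega> 0))
          - (\<Sum>i\<in>blocks. reg_opt P i) - obj_opt P"
    by (simp add: Psi_def[abs_def] opt_def)
  then have K': "K = nat \<lceil>4 * \<kappa> / (\<tau> * \<epsilon>\<^sup>2) * (expectation (Psi 1) - opt + 2 * \<sigma>\<^sup>2 / \<beta>)\<rceil>"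
    unfolding K by simp
  show ?thesis by (rule eps_stationary_stochastic[OF \<epsilon> \<kappa> \<kappa>4 M K' ks])
qed

theorem proposition4p1:
  fixes P :: "('n::finite, 'm::finite) problem"
    and L \<epsilon> :: real
    and I1 I2 :: "nat set"
  assumes "problem_assms P L"
    and "I1 \<union> I2 = {1..<nblocks P}" and "I1 \<inter> I2 = {}"
    and "\<forall>i\<in>I1. convex_on UNIV (reg P i)"
    and "\<forall>i\<in>I2. manifold P i = blkspace P i"
    and "\<epsilon> > 0"
  shows
   "(\<forall>\<beta> \<gamma> (H :: nat \<Rightarrow> real^'n^'n) u y lam.
       \<beta> > (6 + 18 * sqrt 3) / 13 * L \<and>
       12 / (13 * \<beta> + sqrt (13 * \<beta>\<^sup>2 - 12 * \<beta> * L - 72 * L\<^sup>2)) < \<gamma> \<and>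
       \<gamma> < 12 / (13 * \<beta> - sqrt (13 * \<beta>\<^sup>2 - 12 * \<beta> * L - 72 * L\<^sup>2)) \<and>
       (\<forall>i\<in>{1..<nblocks P}. sym_block_matrix P i (H i) \<and> block_succ P i (H i) (6 * L\<^sup>2 / \<beta>)) \<and>
       algorithm1 P \<beta> \<gamma> H u y lam \<longrightarrow>
       (let \<kappa>1 = 3 / \<beta>\<^sup>2 * ((\<beta> - 1 / \<gamma>)\<^sup>2 + L\<^sup>2);
            \<kappa>2 = (\<bar>\<beta> - 1 / \<gamma>\<bar> + L)\<^sup>2;
            \<kappa>3 = (Q_const P L \<beta> H)\<^sup>2;
            \<tau> = min (- ((\<beta> + L) / 2 - 1 / \<gamma> + 6 / \<beta> * (\<beta> - 1 / \<gamma>)\<^sup>2 + 3 * L\<^sup>2 / \<beta>))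
                    (Min ((\<lambda>i. sigma_min P i (H i) / 2 - 3 * L\<^sup>2 / \<beta>) ` {1..<nblocks P}));
            K = nat \<lceil>2 * Max {\<kappa>1, \<kappa>2, \<kappa>3} / (\<tau> * \<epsilon>\<^sup>2) *
                   (Psi_G P L \<beta> \<gamma> (u 1, y 1) (lam 1) (y 0)
                    - (\<Sum>i\<in>{1..<nblocks P}. reg_opt P i) - obj_opt P)\<rceil>
        in \<forall>ks. is_arg_min (theta P u y) (\<lambda>k. k \<in> {2..K + 1}) ks \<longrightarrow>
             eps_stationary P I1 \<epsilon> (u (ks + 1), y (ks + 1)) (lam (ks + 1))))
    \<and>
    (\<forall>\<beta> \<gamma> (H :: nat \<Rightarrow> real^'n^'n) u y lam.
       \<beta> > (6 + 18 * sqrt 3) / 13 * L \<and>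
       12 / (13 * \<beta> + sqrt (13 * \<beta>\<^sup>2 - 12 * \<beta> * L - 72 * L\<^sup>2)) < \<gamma> \<and>
       \<gamma> < 12 / (13 * \<beta> - sqrt (13 * \<beta>\<^sup>2 - 12 * \<beta> * L - 72 * L\<^sup>2)) \<and>
       (\<forall>i\<in>{1..<nblocks P}. sym_block_matrix P i (H i) \<and> block_succ P i (H i) (6 * L\<^sup>2 / \<beta> + L)) \<and>
       algorithm2 P \<beta> \<gamma> H u y lam \<longrightarrow>
       (let \<kappa>1 = 3 / \<beta>\<^sup>2 * ((\<beta> - 1 / \<gamma>)\<^sup>2 + L\<^sup>2);
            \<kappa>2 = (\<bar>\<beta> - 1 / \<gamma>\<bar> + L)\<^sup>2;
            \<kappa>3 = (Q_const P L \<beta> H)\<^sup>2;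
            \<tau> = min (- ((\<beta> + L) / 2 - 1 / \<gamma> + 6 / \<beta> * (\<beta> - 1 / \<gamma>)\<^sup>2 + 3 * L\<^sup>2 / \<beta>))
                    (Min ((\<lambda>i. sigma_min P i (H i) / 2 - 3 * L\<^sup>2 / \<beta> - L / 2) ` {1..<nblocks P}));
            K = nat \<lceil>2 * Max {\<kappa>1, \<kappa>2, \<kappa>3} / (\<tau> * \<epsilon>\<^sup>2) *
                   (Psi_G P L \<beta> \<gamma> (u 1, y 1) (lam 1) (y 0)
                    - (\<Sum>i\<in>{1..<nblocks P}. reg_opt P i) - obj_opt P)\<rceil>
        in \<forall>ks. is_arg_min (theta P u y) (\<lambda>k. k \<in> {2..K + 1}) ks \<longrightarrow>
             eps_stationary P I1 \<epsilon> (u (ks + 1), y (ks + 1)) (lam (ks + 1))))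
    \<and>
    (\<forall>\<beta> \<gamma> (H :: nat \<Rightarrow> real^'n^'n) \<sigma> (M::nat)
       (Pr :: 'w measure) (D :: nat \<Rightarrow> 's measure) G GN \<xi> u y lam.
       (let \<Delta> = 17 * \<beta>\<^sup>2 - 16 * (L + 1) * \<beta> - 128 * L\<^sup>2;
            \<kappa>1 = 4 / \<beta>\<^sup>2 * ((\<beta> - 1 / \<gamma>)\<^sup>2 + L\<^sup>2);
            \<kappa>2 = 3 * ((\<beta> - 1 / \<gamma>)\<^sup>2 + L\<^sup>2);
            \<kappa>3 = 2 * (Q_const P L \<beta> H)\<^sup>2;
            \<tau> = min (- ((\<beta> + L) / 2 - 1 / \<gamma> + 8 / \<beta> * (\<beta> - 1 / \<gamma>)\<^sup>2 + 4 * L\<^sup>2 / \<beta> + 1 / 2))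
                    (Min ((\<lambda>i. sigma_min P i (H i) / 2 - 4 * L\<^sup>2 / \<beta> - (L + 1) / 2)
                           ` {1..<nblocks P}));
            \<kappa>4 = 2 / \<tau> * (8 / \<beta> + real (nblocks P) / 2);
            K = nat \<lceil>4 * Max {\<kappa>1, \<kappa>2, \<kappa>3} / (\<tau> * \<epsilon>\<^sup>2) *
                   (integral\<^sup>L Pr (\<lambda>\<omega>. Psi_S P L \<beta> \<gamma> (u \<omega> 1, y \<omega> 1) (lam \<omega> 1) (y \<omega> 0))
                    - (\<Sum>i\<in>{1..<nblocks P}. reg_opt P i) - obj_opt P + 2 * \<sigma>\<^sup>2 / \<beta>)\<rceil>
        in
          \<beta> > (8 * (L + 1) + 8 * sqrt ((L + 1)\<^sup>2 + 34 * L\<^sup>2)) / 17 \<and>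
          16 / (17 * \<beta> + sqrt \<Delta>) < \<gamma> \<and> \<gamma> < 16 / (17 * \<beta> - sqrt \<Delta>) \<and>
          (\<forall>i\<in>{1..<nblocks P}. sym_block_matrix P i (H i) \<and>
             block_succ P i (H i) (8 * L\<^sup>2 / \<beta> + L + 1)) \<and>
          M \<ge> 1 \<and>
          real M \<ge> 2 * \<sigma>\<^sup>2 / \<epsilon>\<^sup>2 *
            Max {\<kappa>1 * \<kappa>4 + 8 / \<beta>\<^sup>2, \<kappa>2 * \<kappa>4 + 3, \<kappa>3 * \<kappa>4 + 2} \<and>
          oracle_assms P D G GN \<sigma> \<and>
          algorithm3 P Pr D G GN \<xi> M \<beta> \<gamma> H u y lam \<longrightarrow>
          (\<forall>ks. is_arg_min (\<lambda>k. integral\<^sup>L Pr (\<lambda>\<omega>. theta P (u \<omega>) (y \<omega>) k))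
                  (\<lambda>k. k \<in> {2..K + 1}) ks \<longrightarrow>
             eps_stationary_in_expectation P I1 Pr \<epsilon>
               (\<lambda>\<omega>. (u \<omega> (ks + 1), y \<omega> (ks + 1))) (\<lambda>\<omega>. lam \<omega> (ks + 1)))))"
proof -
  interpret block_problem P L by unfold_locales (rule assms(1))
  have conv: "convex_on UNIV (reg P i)" if "i \<in> I1" for i using assms(4) that by blast
  show ?thesis
    unfolding Let_def
  proof ((intro conjI allI impI; elim conjE), goal_cases)
    case (1 \<beta> \<gamma> H u y lam ks)
    note st = stepsize_deterministic[OF L_pos 1(2-4)]
    have "\<beta> > 0" using st(1) L_pos by linarith
    from admm_run_algorithm1[OF this st(2) conv _ 1(6)] 1(5)
    have run: "admm_run P L I1 \<beta> \<gamma> 0 H (\<lambda>_ _. 0) (\<lambda>_. 0) u y lam" by (auto simp: sym_block_matrix_def)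
    have H: "\<forall>i\<in>blocks. sym_block_matrix P i (H i) \<and> block_succ P i (H i) (6 * L\<^sup>2 / \<beta> + 0)"
      using 1(5) by simp
    show ?case
      by (rule deterministic_case[OF 1(2-4) H order.refl run refl refl assms(6)]) (use 1(1) in simp)
  next
    case (2 \<beta> \<gamma> H u y lam ks)
    note st = stepsize_deterministic[OF L_pos 2(2-4)]
    have "\<beta> > 0" using st(1) L_pos by linarith
    \<comment> \<open>Algorithm 2 is the linearized scheme with exact gradients, so both error
      sequences are 0.\<close>
    then have run: "admm_run P L I1 \<beta> \<gamma> L H (\<lambda>_ _. 0) (\<lambda>_. 0) u y lam"
      by (rule admm_run_Phi[OF _ st(2) conv _ 2(6)[unfolded algorithm2_def]])
         (use 2(5) in \<open>auto simp: sym_block_matrix_def\<close>)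
    have L0: "L \<ge> 0" using L_pos by simp
    show ?case by (rule deterministic_case[OF 2(2-5) L0 run refl refl assms(6) 2(1)])
  next
    case (3 \<beta> \<gamma> H \<sigma> M Pr D G GN \<xi> u y lam ks)
    show ?case
      by (rule stochastic_case[OF refl refl refl refl refl 3(2-9) conv assms(6) 3(1)])
  qed
qed

end
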